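(* Let $S$ be a truncation set, let $R_0$ be a commutative unital ring, $R$ a commutative unital $R_0$-algebra, and let $(\pi)$ be any presentation of the $R_0$-algebra $R$, with rows $0\to I_0\to A_0\to R_0\to0$ and $0\to I\to A\to R\to0$. Let $\Omega=\Omega^\bullet_{A/A_0}$ and $\Omega_{\mathbb{Q}}=\Omega\otimes_{\mathbb{Z}}\mathbb{Q}$. Then there are inclusions not only in $\Omega_{\mathbb{Q}}^S$ but in fact in $\Omega^S$: $$X_S^\bullet(I,A)\subset X_S^\bullet(A)\subset\Omega^S .$$ For $n,m\in S$ the Frobenius and Verschiebung maps $F_m$ and $V_n$ for the family $(\Omega^S)$ respect these inclusions, i.e. $F_m(X_S^\bullet(A))\subset X_{S/m}^\bullet(A)$, $F_m(X_S^\bullet(I,A))\subset X_{S/m}^\bullet(I,A)$, $V_n(X_{S/n}^\bullet(A))\subset X_S^\bullet(A)$ and $V_n(X_{S/n}^\bullet(I,A))\subset X_S^\bullet(I,A)$.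
   Context: A truncation set is a non-empty subset $S\subset\mathbb{N}=\{1,2,\ldots\}$ closed under taking positive divisors; for $n\in S$, $S/n=\{\nu\in\mathbb{N}\mid\nu n\in S\}$. For a discrete abelian group or ring $B$, $B^S$ has componentwise operations and the product topology; for $n,m\in S$, $F_m : B^S\to B^{S/m}$, $F_m((b_\nu)_{\nu\in S})=(b_{\nu m})_{\nu\in S/m}$, and $V_n : B^{S/n}\to B^S$, $V_n((b_\nu)_{\nu\in S/n})=n(\delta_{n\mid\nu}b_{\nu/n})_{\nu\in S}$ ($\delta_{n\mid\nu}=1$ if $n\mid\nu$, else $0$). A presentation $(\pi)$ of an $R_0$-algebra $R$ (all rings commutative and unital) is a commutative diagram with exact rows $0\to I_0\to A_0\xrightarrow{\pi_0}R_0\to0$ and $0\to I\to A\xrightarrow{\pi}R\to0$ and vertical maps $I_0\hookrightarrow I$, $A_0\hookrightarrow A$, $R_0\to R$, where $A_0$ has no $\mathbb{Z}$-torsion and $A$ is a polynomial ring over $A_0$ via $A_0\hookrightarrow A$. For $a\in A$, $V_n\langle a\rangle:=V_n((a^\nu)_{\nu\in S/n})\in A^S$. $X_S(A)$ is the closed additive subgroup of $A^S$ generated by all $V_n\langle a\rangle$, $n\in S$, $a\in A$ (a subring), and $X_S(I)$ the closed subgroup generated by those with $a\in I$ (an ideal of $X_S(A)$). Since $\Omega$ is a free $A_0$-module, $\Omega\subset\Omega_{\mathbb{Q}}$. $\Omega_{\mathbb{Q}}^S$ is a differential graded ring with the differential $\mathrm{dl}((\omega_n)_{n\in S})=(n^{-1}d\omega_n)_{n\in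 S}$ (which does not preserve $\Omega^S$). $X_S^\bullet(A)$ is the (topologically) closed differential graded subring of $(\Omega_{\mathbb{Q}}^S,\mathrm{dl})$ generated by $X_S(A)\subset A^S=(\Omega^0)^S$, and $X_S^\bullet(I,A)$ is the closed differential graded ideal of $X_S^\bullet(A)$ generated by $X_S(I)$. *)

theory Defs
  imports
    "HOL-Analysis.Function_Topology"
    "HOL-Algebra.QuotRing"
    "HOL-Algebra.Indexed_Polynomials"
    "HOL-Library.Poly_Mapping"
begin

section \<open>Truncation sets, the rings \<open>B\<^sup>S\<close>, Frobenius and Verschiebung\<close>

definition truncation_set :: "nat set \<Rightarrow> bool" where
  "truncation_set S \<longleftrightarrow> S \<noteq> {} \<and> (\<forall>n\<in>S. 0 < n \<and> (\<forall>k. k dvd n \<longrightarrow> k \<in> S))"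

definition trunc_quot :: "nat set \<Rightarrow> nat \<Rightarrow> nat set" where
  "trunc_quot S n = {k. 0 < k \<and> k * n \<in> S}"

definition power_ring :: "('b, 'm) ring_scheme \<Rightarrow> nat set \<Rightarrow> (nat \<Rightarrow> 'b) ring" where
  "power_ring B S =
    \<lparr>carrier = (\<Pi>\<^sub>E k\<in>S. carrier B),
     monoid.mult = (\<lambda>x y. \<lambda>k\<in>S. x k \<otimes>\<^bsub>B\<^esub> y k),
     one = (\<lambda>k\<in>S. \<one>\<^bsub>B\<^esub>),
     zero = (\<lambda>k\<in>S. \<zero>\<^bsub>B\<^esub>),
     add = (\<lambda>x y. \<lambda>k\<in>S. x k \<oplus>\<^bsub>B\<^esub> y k)\<rparr>"

definition power_topology :: "'b set \<Rightarrow> nat set \<Rightarrow> (nat \<Rightarrow> 'b) topology" where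
  "power_topology D S = product_topology (\<lambda>_. discrete_topology D) S"

definition frobenius :: "nat set \<Rightarrow> nat \<Rightarrow> (nat \<Rightarrow> 'b) \<Rightarrow> (nat \<Rightarrow> 'b)" where
  "frobenius S m x = (\<lambda>k\<in>trunc_quot S m. x (k * m))"

definition verschiebung ::
    "('b, 'm) ring_scheme \<Rightarrow> nat set \<Rightarrow> nat \<Rightarrow> (nat \<Rightarrow> 'b) \<Rightarrow> (nat \<Rightarrow> 'b)" where
  "verschiebung B S n x =
    (\<lambda>k\<in>S. if n dvd k then [n] \<cdot>\<^bsub>B\<^esub> x (k div n) else \<zero>\<^bsub>B\<^esub>)"

definition angle :: "('a, 'm) ring_scheme \<Rightarrow> nat set \<Rightarrow> 'a \<Rightarrow> (nat \<Rightarrow> 'a)" where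
  "angle A S a = (\<lambda>k\<in>S. a [^]\<^bsub>A\<^esub> k)"

text \<open>For \<open>D = carrier A\<close> this is \<open>X\<^sub>S(A)\<close>, for \<open>D = I\<close> an ideal it is \<open>X\<^sub>S(I)\<close>.\<close>

definition X0 :: "('a, 'm) ring_scheme \<Rightarrow> nat set \<Rightarrow> 'a set \<Rightarrow> (nat \<Rightarrow> 'a) set" where
  "X0 A S D = \<Inter>{H. additive_subgroup H (power_ring A S) \<and>
     closedin (power_topology (carrier A) S) H \<and>
     {verschiebung A S n (angle A (trunc_quot S n) a) | n a. n \<in> S \<and> a \<in> D} \<subseteq> H}"


section \<open>Presentations\<close>

text \<open>The polynomial ring \<open>A0[X\<^sub>t | t \<in> T]\<close> is \<^const>\<open>ring.indexed_pset\<close>, whose elements are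
  the finitely supported coefficient functions on multisets over \<open>T\<close>.  For \<open>T \<subseteq> carrier A\<close> the map
  \<open>poly_subst\<close> is the homomorphism of \<open>A0\<close>-algebras to \<open>A\<close> sending \<open>X\<^sub>t\<close> to \<open>t\<close>.\<close>

definition poly_subst :: "('a0, 'm) ring_scheme \<Rightarrow> ('a, 'n) ring_scheme \<Rightarrow> ('a0 \<Rightarrow> 'a) \<Rightarrow>
    ('a multiset \<Rightarrow> 'a0) \<Rightarrow> 'a" where
  "poly_subst A0 A \<phi> P =
    (\<Oplus>\<^bsub>A\<^esub>M\<in>{M. P M \<noteq> \<zero>\<^bsub>A0\<^esub>}. \<phi> (P M) \<otimes>\<^bsub>A\<^esub> (\<Otimes>\<^bsub>A\<^esub>t\<in>set_mset M. t [^]\<^bsub>A\<^esub> count M t))"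

definition polynomial_ring_via ::
    "('a0, 'm) ring_scheme \<Rightarrow> ('a, 'n) ring_scheme \<Rightarrow> ('a0 \<Rightarrow> 'a) \<Rightarrow> bool" where
  "polynomial_ring_via A0 A \<phi> \<longleftrightarrow> (\<exists>T \<subseteq> carrier A.
     bij_betw (poly_subst A0 A \<phi>) (ring.indexed_pset A0 T (carrier A0)) (carrier A))"

locale algebra_presentation =
  R0: cring R0 + R: cring R + A0: cring A0 + A: cring A
  for R0 :: "('r0, 'k) ring_scheme" and R :: "('r, 'l) ring_scheme"
    and \<rho> :: "'r0 \<Rightarrow> 'r"
    and A0 :: "('a0, 'm) ring_scheme" and A :: "('a, 'n) ring_scheme"
    and \<phi> :: "'a0 \<Rightarrow> 'a"
    and \<pi>0 :: "'a0 \<Rightarrow> 'r0" and \<pi> :: "'a \<Rightarrow> 'r"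
    and I0 :: "'a0 set" and I :: "'a set" +
  assumes algebra_hom: "\<rho> \<in> ring_hom R0 R"
    and incl_hom: "\<phi> \<in> ring_hom A0 A"
    and incl_inj: "inj_on \<phi> (carrier A0)"
    and pi0_hom: "\<pi>0 \<in> ring_hom A0 R0"
    and pi0_surj: "\<pi>0 ` carrier A0 = carrier R0"
    and pi_hom: "\<pi> \<in> ring_hom A R"
    and pi_surj: "\<pi> ` carrier A = carrier R"
    and commutes: "\<And>x. x \<in> carrier A0 \<Longrightarrow> \<pi> (\<phi> x) = \<rho> (\<pi>0 x)"
    and kernel0: "I0 = a_kernel A0 R0 \<pi>0"
    and kernel: "I = a_kernel A R \<pi>"
    and torsion_free:
      "\<And>(n::nat) x. 0 < n \<Longrightarrow> x \<in> carrier A0 \<Longrightarrow> [n] \<cdot>\<^bsub>A0\<^esub> x = \<zero>\<^bsub>A0\<^esub> \<Longrightarrow> x = \<zero>\<^bsub>A0\<^esub>"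
    and polynomial: "polynomial_ring_via A0 A \<phi>"


section \<open>Differential graded rings given by generators and relations\<close>

text \<open>The carrier of a differential graded ring contains its homogeneous parts; it need not be
  their direct sum (for \<open>\<Omega>\<^sub>\<rat>\<^sup>S\<close> below it is larger if \<open>S\<close> is infinite).\<close>

record 'a dg_ring = "'a ring" +
  homog :: "nat \<Rightarrow> 'a set"
  differential :: "'a \<Rightarrow> 'a"

text \<open>The integral monoid ring \<open>\<int>[M]\<close>.\<close>

definition monoid_ring :: "('a, 'm) monoid_scheme \<Rightarrow> ('a \<Rightarrow>\<^sub>0 int) ring" where
  "monoid_ring M =
    \<lparr>carrier = {c. Poly_Mapping.keys c \<subseteq> carrier M},
     monoid.mult = (\<lambda>x y. frag_extend (\<lambda>a. frag_extend (\<lambda>b. frag_of (a \<otimes>\<^bsub>M\<^esub> b)) y) x),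
     one = frag_of \<one>\<^bsub>M\<^esub>,
     zero = 0,
     add = (+)\<rparr>"

text \<open>The map on cosets of \<open>J\<close> induced by a map \<open>f\<close> on representatives.\<close>

definition coset_map :: "('a, 'm) ring_scheme \<Rightarrow> 'a set \<Rightarrow> ('a \<Rightarrow> 'a) \<Rightarrow> 'a set \<Rightarrow> 'a set" where
  "coset_map F J f C = (\<Union>x\<in>C. J +>\<^bsub>F\<^esub> f x)"


subsection \<open>The de Rham complex\<close>

text \<open>The symbol \<open>(a, [a\<^sub>1, \<dots>, a\<^sub>q])\<close> stands for \<open>a da\<^sub>1 \<and> \<dots> \<and> da\<^sub>q\<close>.  The symbols form the monoid
  \<open>A \<times> lists (carrier A)\<close> (multiplication of coefficients, concatenation of words).  Modulo the first
  relation its monoid ring is the tensor algebra over \<open>A\<close> of the free \<open>A\<close>-module on the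
  symbols \<open>da\<close>; the next three relations are those of the Kaehler differentials
  \<open>\<Omega>\<^sup>1\<^bsub>A/A0\<^esub>\<close>, and the last one passes from the tensor algebra to the exterior algebra (applied to
  \<open>a + b\<close> it also gives \<open>da \<and> db = - db \<and> da\<close>).\<close>

definition word_monoid :: "'a set \<Rightarrow> 'a list monoid" where
  "word_monoid D = \<lparr>carrier = lists D, monoid.mult = (@), one = []\<rparr>"

definition form_symbols :: "('a, 'n) ring_scheme \<Rightarrow> (('a \<times> 'a list) \<Rightarrow>\<^sub>0 int) ring" where
  "form_symbols A = monoid_ring (A \<times>\<times> word_monoid (carrier A))"

definition form_relations ::
    "('a0, 'm) ring_scheme \<Rightarrow> ('a, 'n) ring_scheme \<Rightarrow> ('a0 \<Rightarrow> 'a) \<Rightarrow> (('a \<times> 'a list) \<Rightarrow>\<^sub>0 int) set" where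
  "form_relations A0 A \<phi> =
    {frag_of (a \<oplus>\<^bsub>A\<^esub> b, []) - frag_of (a, []) - frag_of (b, []) | a b. a \<in> carrier A \<and> b \<in> carrier A}
    \<union> {frag_of (\<one>\<^bsub>A\<^esub>, [a \<oplus>\<^bsub>A\<^esub> b]) - frag_of (\<one>\<^bsub>A\<^esub>, [a]) - frag_of (\<one>\<^bsub>A\<^esub>, [b]) | a b.
         a \<in> carrier A \<and> b \<in> carrier A}
    \<union> {frag_of (\<one>\<^bsub>A\<^esub>, [a \<otimes>\<^bsub>A\<^esub> b]) - frag_of (a, [b]) - frag_of (b, [a]) | a b.
         a \<in> carrier A \<and> b \<in> carrier A}
    \<union> {frag_of (\<one>\<^bsub>A\<^esub>, [\<phi> c]) | c. c \<in> carrier A0}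
    \<union> {frag_of (\<one>\<^bsub>A\<^esub>, [a, a]) | a. a \<in> carrier A}"

definition form_ideal ::
    "('a0, 'm) ring_scheme \<Rightarrow> ('a, 'n) ring_scheme \<Rightarrow> ('a0 \<Rightarrow> 'a) \<Rightarrow> (('a \<times> 'a list) \<Rightarrow>\<^sub>0 int) set" where
  "form_ideal A0 A \<phi> = Idl\<^bsub>form_symbols A\<^esub> (form_relations A0 A \<phi>)"

definition de_Rham ::
    "('a0, 'm) ring_scheme \<Rightarrow> ('a, 'n) ring_scheme \<Rightarrow> ('a0 \<Rightarrow> 'a) \<Rightarrow>
      (('a \<times> 'a list) \<Rightarrow>\<^sub>0 int) set dg_ring" where
  "de_Rham A0 A \<phi> = ring.extend (form_symbols A Quot form_ideal A0 A \<phi>)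
    (dg_ring.fields
      (\<lambda>q. {form_ideal A0 A \<phi> +>\<^bsub>form_symbols A\<^esub> c | c.
             Poly_Mapping.keys c \<subseteq> carrier A \<times> {w \<in> lists (carrier A). length w = q}})
      (coset_map (form_symbols A) (form_ideal A0 A \<phi>)
        (frag_extend (\<lambda>(a, w). frag_of (\<one>\<^bsub>A\<^esub>, a # w)))))"

definition form_const ::
    "('a0, 'm) ring_scheme \<Rightarrow> ('a, 'n) ring_scheme \<Rightarrow> ('a0 \<Rightarrow> 'a) \<Rightarrow> 'a \<Rightarrow> (('a \<times> 'a list) \<Rightarrow>\<^sub>0 int) set" where
  "form_const A0 A \<phi> a = form_ideal A0 A \<phi> +>\<^bsub>form_symbols A\<^esub> frag_of (a, [])"


subsection \<open>The tensor product with the rational numbers\<close>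

text \<open>The pair \<open>(x, r)\<close> stands for \<open>x \<otimes> r\<close>.  Since \<open>(x \<otimes> r) (y \<otimes> s) = x y \<otimes> r s\<close>, the
  additive subgroup generated by the biadditivity relations is already an ideal.\<close>

definition rat_monoid :: "rat monoid" where
  "rat_monoid = \<lparr>carrier = UNIV, monoid.mult = (*), one = 1\<rparr>"

definition tensor_symbols :: "('b, 'm) ring_scheme \<Rightarrow> (('b \<times> rat) \<Rightarrow>\<^sub>0 int) ring" where
  "tensor_symbols B = monoid_ring (B \<times>\<times> rat_monoid)"

definition tensor_relations :: "('b, 'm) ring_scheme \<Rightarrow> (('b \<times> rat) \<Rightarrow>\<^sub>0 int) set" where
  "tensor_relations B =
    {frag_of (x \<oplus>\<^bsub>B\<^esub> y, r) - frag_of (x, r) - frag_of (y, r) | x y r. x \<in> carrier B \<and> y \<in> carrier B}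
    \<union> {frag_of (x, r + s) - frag_of (x, r) - frag_of (x, s) | x r s. x \<in> carrier B}"

definition tensor_ideal :: "('b, 'm) ring_scheme \<Rightarrow> (('b \<times> rat) \<Rightarrow>\<^sub>0 int) set" where
  "tensor_ideal B = Idl\<^bsub>tensor_symbols B\<^esub> (tensor_relations B)"

definition tensor :: "('b, 'm) ring_scheme \<Rightarrow> 'b \<Rightarrow> rat \<Rightarrow> (('b \<times> rat) \<Rightarrow>\<^sub>0 int) set" where
  "tensor B x r = tensor_ideal B +>\<^bsub>tensor_symbols B\<^esub> frag_of (x, r)"

definition rationalization :: "('b, 'm) dg_ring_scheme \<Rightarrow> (('b \<times> rat) \<Rightarrow>\<^sub>0 int) set dg_ring" where
  "rationalization B = ring.extend (tensor_symbols B Quot tensor_ideal B)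
    (dg_ring.fields
      (\<lambda>q. {tensor_ideal B +>\<^bsub>tensor_symbols B\<^esub> c | c. Poly_Mapping.keys c \<subseteq> homog B q \<times> UNIV})
      (coset_map (tensor_symbols B) (tensor_ideal B)
        (frag_extend (\<lambda>(x, r). frag_of (differential B x, r)))))"


section \<open>The differential graded ring \<open>\<Omega>\<^sub>\<rat>\<^sup>S\<close> and its sub-objects \<open>\<Omega>\<^sup>S\<close>, \<open>X\<^sub>S\<^sup>\<bullet>(A)\<close>, \<open>X\<^sub>S\<^sup>\<bullet>(I,A)\<close>\<close>

text \<open>Here \<open>B\<close> plays the role of \<open>\<Omega>\<close>.\<close>

definition rat_power :: "('b, 'm) dg_ring_scheme \<Rightarrow> nat set \<Rightarrow> (nat \<Rightarrow> (('b \<times> rat) \<Rightarrow>\<^sub>0 int) set) dg_ring" where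
  "rat_power B S = ring.extend (power_ring (rationalization B) S)
    (dg_ring.fields
      (\<lambda>q. \<Pi>\<^sub>E k\<in>S. homog (rationalization B) q)
      (\<lambda>x. \<lambda>k\<in>S. tensor B \<one>\<^bsub>B\<^esub> (inverse (of_nat k))
                 \<otimes>\<^bsub>rationalization B\<^esub> differential (rationalization B) (x k)))"

text \<open>The degree \<open>q\<close> part of \<open>\<Omega>\<^sup>S\<close>, regarded as a subset of \<open>\<Omega>\<^sub>\<rat>\<^sup>S\<close> via \<open>\<omega> \<mapsto> \<omega> \<otimes> 1\<close>.\<close>

definition integral_power ::
    "('b, 'm) dg_ring_scheme \<Rightarrow> nat set \<Rightarrow> nat \<Rightarrow> (nat \<Rightarrow> (('b \<times> rat) \<Rightarrow>\<^sub>0 int) set) set" where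
  "integral_power B S q = (\<Pi>\<^sub>E k\<in>S. (\<lambda>x. tensor B x 1) ` homog B q)"

text \<open>Graded sub-objects are families \<open>Y\<close> of subgroups \<open>Y q\<close> of the homogeneous parts, and closedness is
  required in each degree, for the product topology on \<open>(\<Omega>\<^sup>q\<^sub>\<rat>)\<^sup>S\<close>.\<close>

definition closed_graded_subgroup ::
    "('b, 'm) dg_ring_scheme \<Rightarrow> nat set \<Rightarrow> (nat \<Rightarrow> (nat \<Rightarrow> (('b \<times> rat) \<Rightarrow>\<^sub>0 int) set) set) \<Rightarrow> bool" where
  "closed_graded_subgroup B S Y \<longleftrightarrow>
    (\<forall>q. additive_subgroup (Y q) (rat_power B S) \<and> Y q \<subseteq> homog (rat_power B S) q \<and>
         closedin (power_topology (homog (rationalization B) q) S) (Y q))"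

definition closed_dg_subring ::
    "('b, 'm) dg_ring_scheme \<Rightarrow> nat set \<Rightarrow> (nat \<Rightarrow> (nat \<Rightarrow> (('b \<times> rat) \<Rightarrow>\<^sub>0 int) set) set) \<Rightarrow> bool" where
  "closed_dg_subring B S Y \<longleftrightarrow>
    closed_graded_subgroup B S Y \<and>
    \<one>\<^bsub>rat_power B S\<^esub> \<in> Y 0 \<and>
    (\<forall>p q. \<forall>x\<in>Y p. \<forall>y\<in>Y q. x \<otimes>\<^bsub>rat_power B S\<^esub> y \<in> Y (p + q)) \<and>
    (\<forall>q. \<forall>x\<in>Y q. differential (rat_power B S) x \<in> Y (Suc q))"

definition closed_dg_ideal ::
    "('b, 'm) dg_ring_scheme \<Rightarrow> nat set \<Rightarrow> (nat \<Rightarrow> (nat \<Rightarrow> (('b \<times> rat) \<Rightarrow>\<^sub>0 int) set) set) \<Rightarrow>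
      (nat \<Rightarrow> (nat \<Rightarrow> (('b \<times> rat) \<Rightarrow>\<^sub>0 int) set) set) \<Rightarrow> bool" where
  "closed_dg_ideal B S Z Y \<longleftrightarrow>
    closed_graded_subgroup B S Y \<and>
    (\<forall>q. Y q \<subseteq> Z q) \<and>
    (\<forall>p q. \<forall>x\<in>Z p. \<forall>y\<in>Y q. x \<otimes>\<^bsub>rat_power B S\<^esub> y \<in> Y (p + q) \<and>
                            y \<otimes>\<^bsub>rat_power B S\<^esub> x \<in> Y (q + p)) \<and>
    (\<forall>q. \<forall>y\<in>Y q. differential (rat_power B S) y \<in> Y (Suc q))"

text \<open>The image of a subset of \<open>A\<^sup>S = (\<Omega>\<^sup>0)\<^sup>S\<close> in \<open>\<Omega>\<^sub>\<rat>\<^sup>S\<close>.\<close>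

definition const_image ::
    "('a0, 'm) ring_scheme \<Rightarrow> ('a, 'n) ring_scheme \<Rightarrow> ('a0 \<Rightarrow> 'a) \<Rightarrow> nat set \<Rightarrow> (nat \<Rightarrow> 'a) set \<Rightarrow>
      (nat \<Rightarrow> (((('a \<times> 'a list) \<Rightarrow>\<^sub>0 int) set \<times> rat) \<Rightarrow>\<^sub>0 int) set) set" where
  "const_image A0 A \<phi> S H =
    (\<lambda>x. \<lambda>k\<in>S. tensor (de_Rham A0 A \<phi>) (form_const A0 A \<phi> (x k)) 1) ` H"

text \<open>\<open>X_dg A0 A \<phi> S q\<close> and \<open>X_dg_ideal A0 A \<phi> I S q\<close> are the degree \<open>q\<close> parts of
  \<open>X\<^sub>S\<^sup>\<bullet>(A)\<close> and \<open>X\<^sub>S\<^sup>\<bullet>(I,A)\<close>.\<close>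

definition X_dg ::
    "('a0, 'm) ring_scheme \<Rightarrow> ('a, 'n) ring_scheme \<Rightarrow> ('a0 \<Rightarrow> 'a) \<Rightarrow> nat set \<Rightarrow> nat \<Rightarrow>
      (nat \<Rightarrow> (((('a \<times> 'a list) \<Rightarrow>\<^sub>0 int) set \<times> rat) \<Rightarrow>\<^sub>0 int) set) set" where
  "X_dg A0 A \<phi> S q = \<Inter>{Y q | Y. closed_dg_subring (de_Rham A0 A \<phi>) S Y \<and>
     const_image A0 A \<phi> S (X0 A S (carrier A)) \<subseteq> Y 0}"

definition X_dg_ideal ::
    "('a0, 'm) ring_scheme \<Rightarrow> ('a, 'n) ring_scheme \<Rightarrow> ('a0 \<Rightarrow> 'a) \<Rightarrow> 'a set \<Rightarrow> nat set \<Rightarrow> nat \<Rightarrow>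
      (nat \<Rightarrow> (((('a \<times> 'a list) \<Rightarrow>\<^sub>0 int) set \<times> rat) \<Rightarrow>\<^sub>0 int) set) set" where
  "X_dg_ideal A0 A \<phi> I S q = \<Inter>{Y q | Y.
     closed_dg_ideal (de_Rham A0 A \<phi>) S (X_dg A0 A \<phi> S) Y \<and>
     const_image A0 A \<phi> S (X0 A S I) \<subseteq> Y 0}"

end

theory Submission
  imports Defs
begin

text \<open>The point of the proof is that \<open>X\<^sub>S\<^sup>\<bullet>(A)\<close> and \<open>X\<^sub>S\<^sup>\<bullet>(I,A)\<close> can be generated degree by degree.  The degree \<open>0\<close>
part of \<open>X\<^sub>S\<^sup>\<bullet>(I,A)\<close> is the closed subgroup generated by \<open>X\<^sub>S(I)\<close>, and its degree \<open>q + 1\<close> part is the closed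
subgroup generated by the products \<open>dl(a) \<omega>\<close> and \<open>dl(x) \<eta>\<close>, where \<open>a\<close> lies in \<open>X\<^sub>S(A)\<close>, \<open>\<omega>\<close> in the degree \<open>q\<close>
part of \<open>X\<^sub>S\<^sup>\<bullet>(I,A)\<close>, \<open>x\<close> in \<open>X\<^sub>S(I)\<close> and \<open>\<eta>\<close> in the degree \<open>q\<close> part of \<open>X\<^sub>S\<^sup>\<bullet>(A)\<close>; the case \<open>I = A\<close> is the
description of \<open>X\<^sub>S\<^sup>\<bullet>(A)\<close>.  The family defined in this way (\<open>graded_forms\<close>) is stable under products, because
elements of degree \<open>0\<close> are central and \<open>X\<^sub>S(I)\<close> is an ideal of \<open>X\<^sub>S(A)\<close>, and under \<open>dl\<close>, because
\<open>dl(dl(a) \<omega>) = - dl(a) dl(\<omega>)\<close>; so it is the least closed differential graded subring, respectively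
ideal (\<open>X_dg_eq\<close>, \<open>X_dg_ideal_eq\<close>).

All maps that occur (products with a fixed element, \<open>dl\<close>, \<open>F\<^sub>m\<close>, \<open>V\<^sub>n\<close>) are additive and each coordinate of the
value depends on a single coordinate of the argument.  Preimages of closed subgroups under such maps are closed
subgroups (\<open>closed_subgroup_vimage\<close>), so that everything can be checked on generators, by
induction on the degree.

  \<^item> Integrality.  The coordinate of \<open>V\<^sub>n\<langle>a\<rangle>\<close> at \<open>k = n \<nu>\<close> is \<open>n a\<^sup>\<nu>\<close>, and therefore that of \<open>dl V\<^sub>n\<langle>a\<rangle>\<close> is
    \<open>a\<^bsup>\<nu>-1\<^esup> da\<close>: the denominator \<open>k\<close> cancels (\<open>dl_ver_gen\<close>).
  \<^item> Verschiebung.  \<open>V\<^sub>n(dl(a) \<omega>) = dl(V\<^sub>n a) V\<^sub>n(\<omega>)\<close> (\<open>verschiebung_dl_times\<close>).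
  \<^item> Frobenius.  As \<open>F\<^sub>m\<close> is multiplicative, only \<open>F\<^sub>m dl V\<^sub>n\<langle>a\<rangle>\<close> has to be understood.  With \<open>g = gcd n m\<close>,
    \<open>n = g n'\<close> and \<open>m = g m'\<close>, its \<open>m'\<close>-fold multiple is \<open>dl V\<^bsub>n'\<^esub>\<langle>a\<^bsup>m'\<^esup>\<rangle>\<close> and its \<open>n'\<close>-fold multiple is
    \<open>V\<^bsub>n'\<^esub>\<langle>a\<^bsup>m'-1\<^esup>\<rangle> dl V\<^bsub>n'\<^esub>\<langle>a\<rangle>\<close>; since \<open>m'\<close> and \<open>n'\<close> are coprime, it lies in the subgroup itself
    (\<open>frobenius_dl_emb\<close>).

Before that, the calculus of \<open>\<Omega>\<close> and \<open>\<Omega>\<^sub>\<rat>\<close> has to be derived from their presentations by generators and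
relations.  Both are quotients of an integral monoid ring, with a differential induced by a map on symbols
(\<open>symbol_quotient\<close>), and the rules needed later (\<open>dg_algebra\<close>) hold for \<open>\<Omega>\<close> and pass to
\<open>\<Omega>\<^sub>\<rat>\<close>.\<close>

section \<open>The integral monoid ring\<close>

lemma frag_cmul_diff: "frag_cmul k (x - y) = frag_cmul k x - frag_cmul k y"
  by (rule poly_mapping_eqI) (simp add: lookup_minus right_diff_distrib)

lemma frag_extend_diff_fun:
  fixes f g :: "'a \<Rightarrow> 'b \<Rightarrow>\<^sub>0 int"
  shows "frag_extend (\<lambda>a. f a - g a) x = frag_extend f x - frag_extend g x"
  by (simp add: frag_extend_def sum_subtractf frag_cmul_diff)

lemma monoid_ring_simps [simp]:
  "x \<in> carrier (monoid_ring M) \<longleftrightarrow> Poly_Mapping.keys x \<subseteq> carrier M"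
  "\<one>\<^bsub>monoid_ring M\<^esub> = frag_of \<one>\<^bsub>M\<^esub>"
  "\<zero>\<^bsub>monoid_ring M\<^esub> = 0"
  "x \<oplus>\<^bsub>monoid_ring M\<^esub> y = x + y"
  by (auto simp: monoid_ring_def)

lemma monoid_ring_mult_of [simp]:
  "frag_of a \<otimes>\<^bsub>monoid_ring M\<^esub> frag_of b = frag_of (a \<otimes>\<^bsub>M\<^esub> b)"
  by (simp add: monoid_ring_def)

lemma monoid_ring_mult_diff:
  "(x - y) \<otimes>\<^bsub>monoid_ring M\<^esub> z = x \<otimes>\<^bsub>monoid_ring M\<^esub> z - y \<otimes>\<^bsub>monoid_ring M\<^esub> z"
  "z \<otimes>\<^bsub>monoid_ring M\<^esub> (x - y) = z \<otimes>\<^bsub>monoid_ring M\<^esub> x - z \<otimes>\<^bsub>monoid_ring M\<^esub> y"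
  by (simp_all add: monoid_ring_def frag_extend_diff frag_extend_diff_fun)

lemma monoid_ring_mult_zero [simp]:
  "0 \<otimes>\<^bsub>monoid_ring M\<^esub> z = 0" "z \<otimes>\<^bsub>monoid_ring M\<^esub> 0 = 0"
  using monoid_ring_mult_diff(1)[where x = 0 and y = 0 and z = z]
    monoid_ring_mult_diff(2)[where x = 0 and y = 0 and z = z] by simp_all

lemma monoid_ring_mult_add:
  "(x + y) \<otimes>\<^bsub>monoid_ring M\<^esub> z = x \<otimes>\<^bsub>monoid_ring M\<^esub> z + y \<otimes>\<^bsub>monoid_ring M\<^esub> z"
  "z \<otimes>\<^bsub>monoid_ring M\<^esub> (x + y) = z \<otimes>\<^bsub>monoid_ring M\<^esub> x + z \<otimes>\<^bsub>monoid_ring M\<^esub> y"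
  using monoid_ring_mult_diff(1)[where M = M and x = x and y = "- y" and z = z]
    monoid_ring_mult_diff(1)[where M = M and x = 0 and y = y and z = z]
    monoid_ring_mult_diff(2)[of M z x "- y"] monoid_ring_mult_diff(2)[of M z 0 y] by simp_all

lemma monoid_ring_mult_cmul:
  "frag_cmul k x \<otimes>\<^bsub>monoid_ring M\<^esub> y = frag_cmul k (x \<otimes>\<^bsub>monoid_ring M\<^esub> y)"
  "x \<otimes>\<^bsub>monoid_ring M\<^esub> frag_cmul k y = frag_cmul k (x \<otimes>\<^bsub>monoid_ring M\<^esub> y)"
proof -
  show "frag_cmul k x \<otimes>\<^bsub>monoid_ring M\<^esub> y = frag_cmul k (x \<otimes>\<^bsub>monoid_ring M\<^esub> y)"
    by (simp add: monoid_ring_def frag_extend_cmul)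
  have "frag_extend (\<lambda>a. frag_cmul k (g a)) x = frag_cmul k (frag_extend g x)"
    for g :: "'a \<Rightarrow> 'a \<Rightarrow>\<^sub>0 int"
    by (simp add: frag_extend_def frag_cmul_sum mult.commute)
  then show "x \<otimes>\<^bsub>monoid_ring M\<^esub> frag_cmul k y = frag_cmul k (x \<otimes>\<^bsub>monoid_ring M\<^esub> y)"
    by (simp add: monoid_ring_def frag_extend_cmul)
qed

lemma keys_subset_diff:
  "Poly_Mapping.keys x \<subseteq> K \<Longrightarrow> Poly_Mapping.keys y \<subseteq> K \<Longrightarrow> Poly_Mapping.keys (x - y) \<subseteq> K"
  by (rule order_trans[OF keys_diff]) simp

lemma monoid_ring_mult_closed:
  assumes "monoid M" "Poly_Mapping.keys x \<subseteq> carrier M" "Poly_Mapping.keys y \<subseteq> carrier M"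
  shows "Poly_Mapping.keys (x \<otimes>\<^bsub>monoid_ring M\<^esub> y) \<subseteq> carrier M"
  using assms(2)
proof (induction x rule: frag_induction)
  case (one a)
  show ?case using assms(3)
  proof (induction y rule: frag_induction)
    case (one b)
    then show ?case using \<open>a \<in> _\<close> assms(1) by (simp add: monoid.m_closed)
  qed (auto simp: monoid_ring_mult_diff keys_subset_diff)
qed (auto simp: monoid_ring_mult_diff keys_subset_diff)

lemma monoid_ring_assoc:
  assumes "monoid M" "Poly_Mapping.keys x \<subseteq> carrier M" "Poly_Mapping.keys y \<subseteq> carrier M"
    "Poly_Mapping.keys z \<subseteq> carrier M"
  shows "(x \<otimes>\<^bsub>monoid_ring M\<^esub> y) \<otimes>\<^bsub>monoid_ring M\<^esub> z = x \<otimes>\<^bsub>monoid_ring M\<^esub> (y \<otimes>\<^bsub>monoid_ring M\<^esub> z)"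
  using assms(2)
proof (induction x rule: frag_induction)
  case (one a)
  show ?case using assms(3)
  proof (induction y rule: frag_induction)
    case (one b)
    show ?case using assms(4)
    proof (induction z rule: frag_induction)
      case (one c)
      then show ?case using \<open>a \<in> _\<close> \<open>b \<in> _\<close> assms(1) by (simp add: monoid.m_assoc)
    qed (auto simp: monoid_ring_mult_diff)
  qed (auto simp: monoid_ring_mult_diff)
qed (auto simp: monoid_ring_mult_diff)

lemma monoid_ring_ring:
  assumes "monoid M"
  shows "ring (monoid_ring M)"
proof -
  interpret M: monoid M by fact
  have unit: "frag_of \<one>\<^bsub>M\<^esub> \<otimes>\<^bsub>monoid_ring M\<^esub> x = x" "x \<otimes>\<^bsub>monoid_ring M\<^esub> frag_of \<one>\<^bsub>M\<^esub> = x"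
    if "Poly_Mapping.keys x \<subseteq> carrier M" for x
    using that by (induction x rule: frag_induction) (auto simp: monoid_ring_mult_diff)
  show ?thesis
  proof (intro ringI abelian_groupI monoidI, goal_cases)
    case (1 x y)
    then show ?case using keys_add[of x y] by auto
  next
    case (6 x)
    then show ?case by (auto intro!: bexI[of _ "- x"])
  next
    case (7 x y)
    then show ?case using monoid_ring_mult_closed[OF assms] by simp
  next
    case (12 x y z)
    then show ?case by (simp add: monoid_ring_def frag_extend_add)
  next
    case (13 x y z)
    then show ?case
      using monoid_ring_mult_diff(2)[of M z x "- y"] monoid_ring_mult_diff(2)[of M z 0 y] by simp
  qed (use unit monoid_ring_assoc[OF assms] in \<open>simp_all add: add_ac\<close>)
qed

lemma monoid_ring_a_inv [simp]:
  assumes "monoid M" "Poly_Mapping.keys x \<subseteq> carrier M"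
  shows "\<ominus>\<^bsub>monoid_ring M\<^esub> x = - x"
  by (rule abelian_group.minus_equality[OF ring.is_abelian_group[OF monoid_ring_ring]])
     (use assms in simp_all)

text \<open>Closure under subtraction is the form in which the induction principle \<open>frag_induction\<close> for formal sums
delivers additivity; this is why subgroups are described by differences throughout.\<close>

lemma monoid_ring_idealI:
  assumes "monoid M"
    and sub: "\<And>a. a \<in> H \<Longrightarrow> Poly_Mapping.keys a \<subseteq> carrier M"
    and zero: "0 \<in> H"
    and diff: "\<And>a b. \<lbrakk>a \<in> H; b \<in> H\<rbrakk> \<Longrightarrow> a - b \<in> H"
    and left: "\<And>a x. \<lbrakk>a \<in> H; Poly_Mapping.keys x \<subseteq> carrier M\<rbrakk> \<Longrightarrow> x \<otimes>\<^bsub>monoid_ring M\<^esub> a \<in> H"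
    and right: "\<And>a x. \<lbrakk>a \<in> H; Poly_Mapping.keys x \<subseteq> carrier M\<rbrakk> \<Longrightarrow> a \<otimes>\<^bsub>monoid_ring M\<^esub> x \<in> H"
  shows "ideal H (monoid_ring M)"
proof (rule idealI)
  show ring: "ring (monoid_ring M)" by (rule monoid_ring_ring) fact
  have minus: "- a \<in> H" if "a \<in> H" for a
    using diff[OF zero that] by simp
  show "subgroup H (add_monoid (monoid_ring M))"
  proof (rule group.subgroupI[OF abelian_group.a_group[OF ring.is_abelian_group[OF ring]]])
    fix a b assume H: "a \<in> H" "b \<in> H"
    show "inv\<^bsub>add_monoid (monoid_ring M)\<^esub> a \<in> H"
      using minus[OF H(1)] monoid_ring_a_inv[OF assms(1) sub[OF H(1)]] by (simp add: a_inv_def)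
    show "a \<otimes>\<^bsub>add_monoid (monoid_ring M)\<^esub> b \<in> H"
      using diff[OF H(1) minus[OF H(2)]] by simp
  qed (use sub zero in auto)
qed (use left right in simp_all)

lemma monoid_ring_ideal_diff:
  assumes "monoid M" "ideal J (monoid_ring M)" "x \<in> J" "y \<in> J"
  shows "x - y \<in> J"
proof -
  interpret ideal J "monoid_ring M" by fact
  have "x \<oplus>\<^bsub>monoid_ring M\<^esub> (\<ominus>\<^bsub>monoid_ring M\<^esub> y) \<in> J" using assms by blast
  moreover have "Poly_Mapping.keys y \<subseteq> carrier M" using a_Hcarr[OF assms(4)] by simp
  ultimately show ?thesis using assms(1) by simp
qed

section \<open>Differential graded rings presented by symbols\<close>

lemma ring_extend_simps [simp]:
  "carrier (ring.extend R m) = carrier R"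
  "x \<otimes>\<^bsub>ring.extend R m\<^esub> y = x \<otimes>\<^bsub>R\<^esub> y"
  "x \<oplus>\<^bsub>ring.extend R m\<^esub> y = x \<oplus>\<^bsub>R\<^esub> y"
  "\<one>\<^bsub>ring.extend R m\<^esub> = \<one>\<^bsub>R\<^esub>"
  "\<zero>\<^bsub>ring.extend R m\<^esub> = \<zero>\<^bsub>R\<^esub>"
  "\<ominus>\<^bsub>ring.extend R m\<^esub> x = \<ominus>\<^bsub>R\<^esub> x"
  "x \<ominus>\<^bsub>ring.extend R m\<^esub> y = x \<ominus>\<^bsub>R\<^esub> y"
  by (simp_all add: ring.defs a_inv_def m_inv_def a_minus_def)

lemma ring_extend_ring:
  assumes "ring R" shows "ring (ring.extend R m)"
proof -
  interpret R: ring R by fact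
  show ?thesis
    by (intro ringI abelian_groupI monoidI)
      (auto simp: R.m_assoc R.a_ac R.l_distr R.r_distr intro: R.l_neg bexI[of _ "\<ominus>\<^bsub>R\<^esub> _"])
qed

lemma homog_extend [simp]:
  "homog (ring.extend R (dg_ring.fields H D)) = H"
  "differential (ring.extend R (dg_ring.fields H D)) = D"
  by (simp_all add: ring.defs dg_ring.defs)

text \<open>\<open>K q\<close> is the set of symbols of degree \<open>q\<close>, and \<open>f\<close> is the differential on symbols.  Both the de Rham
complex and the tensor product with \<open>\<rat>\<close> unfold literally to an instance.\<close>

definition symbol_quotient ::
    "('s, 'k) monoid_scheme \<Rightarrow> ('s \<Rightarrow>\<^sub>0 int) set \<Rightarrow> (nat \<Rightarrow> 's set) \<Rightarrow> ('s \<Rightarrow> 's \<Rightarrow>\<^sub>0 int) \<Rightarrow>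
      ('s \<Rightarrow>\<^sub>0 int) set dg_ring" where
  "symbol_quotient M J K f = ring.extend (monoid_ring M Quot J)
    (dg_ring.fields (\<lambda>q. {J +>\<^bsub>monoid_ring M\<^esub> c | c. Poly_Mapping.keys c \<subseteq> K q})
      (coset_map (monoid_ring M) J (frag_extend f)))"

locale dg_symbol_quotient = M: monoid M + J: ideal J "monoid_ring M"
  for M :: "('s, 'k) monoid_scheme" and J +
  fixes K :: "nat \<Rightarrow> 's set" and f :: "'s \<Rightarrow> 's \<Rightarrow>\<^sub>0 int"
  assumes K_subset: "K q \<subseteq> carrier M"
    and K_mult: "\<lbrakk>s \<in> K p; t \<in> K q\<rbrakk> \<Longrightarrow> s \<otimes>\<^bsub>M\<^esub> t \<in> K (p + q)"
    and f_closed: "s \<in> carrier M \<Longrightarrow> Poly_Mapping.keys (f s) \<subseteq> carrier M"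
    and f_degree: "s \<in> K q \<Longrightarrow> Poly_Mapping.keys (f s) \<subseteq> K (Suc q)"
    and f_ideal: "x \<in> J \<Longrightarrow> frag_extend f x \<in> J"
begin

abbreviation E where "E \<equiv> symbol_quotient M J K f"

abbreviation cls where "cls x \<equiv> J +>\<^bsub>monoid_ring M\<^esub> x"

abbreviation symbols where "symbols x \<equiv> Poly_Mapping.keys x \<subseteq> carrier M"

lemma ring_E: "ring E"
  unfolding symbol_quotient_def by (intro ring_extend_ring J.quotient_is_ring)

lemma J_symbols: "x \<in> J \<Longrightarrow> symbols x"
  using J.a_Hcarr by simp

context
begin

interpretation cls: ring_hom_ring "monoid_ring M" "monoid_ring M Quot J" "\<lambda>x. cls x"
  by (rule J.rcos_ring_hom_ring)

lemma cls_closed [simp]: "symbols x \<Longrightarrow> cls x \<in> carrier E"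
  using cls.hom_closed by (simp add: symbol_quotient_def)

lemma cls_cases:
  assumes "z \<in> carrier E"
  obtains x where "symbols x" "z = cls x"
  using assms by (auto simp: symbol_quotient_def FactRing_def A_RCOSETS_def' a_r_coset_def')

lemma cls_mult: "symbols x \<Longrightarrow> symbols y \<Longrightarrow> cls x \<otimes>\<^bsub>E\<^esub> cls y = cls (x \<otimes>\<^bsub>monoid_ring M\<^esub> y)"
  by (simp add: symbol_quotient_def)

lemma cls_add: "symbols x \<Longrightarrow> symbols y \<Longrightarrow> cls x \<oplus>\<^bsub>E\<^esub> cls y = cls (x + y)"
  using cls.hom_add[of x y] by (simp add: symbol_quotient_def)

lemma cls_a_inv: "symbols x \<Longrightarrow> \<ominus>\<^bsub>E\<^esub> cls x = cls (- x)"
  using cls.hom_a_inv[of x] by (simp add: symbol_quotient_def M.monoid_axioms)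

lemma cls_diff: "symbols x \<Longrightarrow> symbols y \<Longrightarrow> cls x \<ominus>\<^bsub>E\<^esub> cls y = cls (x - y)"
  by (simp add: a_minus_def cls_add cls_a_inv)

lemma cls_one: "\<one>\<^bsub>E\<^esub> = cls (frag_of \<one>\<^bsub>M\<^esub>)"
  using cls.hom_one by (simp add: symbol_quotient_def)

lemma cls_zero: "\<zero>\<^bsub>E\<^esub> = cls 0"
  using cls.hom_zero by (simp add: symbol_quotient_def)

end

lemma cls_ideal: "x \<in> J \<Longrightarrow> cls x = \<zero>\<^bsub>E\<^esub>"
  using J.a_rcos_zero[OF J.is_ideal, of x] by (simp add: symbol_quotient_def FactRing_def)

lemma cls_eqI:
  assumes "symbols x" "symbols y" "x - y \<in> J"
  shows "cls x = cls y"
proof -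
  interpret E: ring E by (rule ring_E)
  have "cls x \<ominus>\<^bsub>E\<^esub> cls y = \<zero>\<^bsub>E\<^esub>"
    using assms by (simp add: cls_diff cls_ideal)
  then show ?thesis using assms by simp
qed

lemma frag_extend_symbols: "symbols x \<Longrightarrow> symbols (frag_extend f x)"
  by (intro order_trans[OF keys_frag_extend] UN_least f_closed) (rule subsetD)

text \<open>The induced map on cosets is a union over all representatives; stability of \<open>J\<close> under the differential makes all
members of this union equal.\<close>

lemma differential_cls:
  assumes "symbols x"
  shows "differential E (cls x) = cls (frag_extend f x)"
proof -
  have "cls (frag_extend f y) = cls (frag_extend f x)" if y: "y \<in> cls x" for y
  proof -
    from y obtain j where j: "j \<in> J" "y = j + x" by (auto simp: a_r_coset_def')
    have "frag_extend f y - frag_extend f x \<in> J"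
      using j by (simp add: frag_extend_add f_ideal)
    moreover have "symbols y"
      unfolding j(2) by (rule order_trans[OF keys_add]) (use j(1) assms J_symbols in simp)
    ultimately show ?thesis
      using assms by (intro cls_eqI frag_extend_symbols)
  qed
  then have "(\<Union>y\<in>cls x. cls (frag_extend f y)) = (\<Union>y\<in>cls x. cls (frag_extend f x))"
    by (intro SUP_cong refl)
  moreover have "x \<in> cls x"
    using assms by (simp add: J.a_rcos_self)
  then have "(\<Union>y\<in>cls x. cls (frag_extend f x)) = cls (frag_extend f x)"
    by blast
  ultimately show ?thesis
    by (simp only: symbol_quotient_def coset_map_def homog_extend)
qed

lemma homog_E: "homog E q = {cls c | c. Poly_Mapping.keys c \<subseteq> K q}"
  by (simp add: symbol_quotient_def)

lemma K_symbols: "Poly_Mapping.keys c \<subseteq> K q \<Longrightarrow> symbols c"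
  using K_subset by blast

lemma mult_K:
  assumes "Poly_Mapping.keys x \<subseteq> K p" "Poly_Mapping.keys y \<subseteq> K q"
  shows "Poly_Mapping.keys (x \<otimes>\<^bsub>monoid_ring M\<^esub> y) \<subseteq> K (p + q)"
  using assms(1)
proof (induction x rule: frag_induction)
  case (one a)
  show ?case using assms(2)
    by (induction y rule: frag_induction)
      (use \<open>a \<in> _\<close> in \<open>simp_all add: monoid_ring_mult_diff keys_subset_diff K_mult\<close>)
qed (simp_all add: monoid_ring_mult_diff keys_subset_diff)

lemma homog_E_cases:
  assumes "u \<in> homog E q"
  obtains x where "u = cls x" "Poly_Mapping.keys x \<subseteq> K q" "symbols x"
  using assms that K_symbols unfolding homog_E by blast

lemma homog_E_I: "Poly_Mapping.keys x \<subseteq> K q \<Longrightarrow> cls x \<in> homog E q"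
  unfolding homog_E by blast

lemma dg_E:
  shows homog_E_subset: "homog E q \<subseteq> carrier E"
    and homog_E_zero: "\<zero>\<^bsub>E\<^esub> \<in> homog E q"
    and homog_E_diff: "\<lbrakk>u \<in> homog E q; v \<in> homog E q\<rbrakk> \<Longrightarrow> u \<ominus>\<^bsub>E\<^esub> v \<in> homog E q"
    and homog_E_mult: "\<lbrakk>u \<in> homog E p; v \<in> homog E q\<rbrakk> \<Longrightarrow> u \<otimes>\<^bsub>E\<^esub> v \<in> homog E (p + q)"
    and differential_E_closed: "u \<in> carrier E \<Longrightarrow> differential E u \<in> carrier E"
    and differential_E_diff: "\<lbrakk>u \<in> carrier E; v \<in> carrier E\<rbrakk> \<Longrightarrow>
      differential E (u \<ominus>\<^bsub>E\<^esub> v) = differential E u \<ominus>\<^bsub>E\<^esub> differential E v"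
    and differential_E_homog: "u \<in> homog E q \<Longrightarrow> differential E u \<in> homog E (Suc q)"
proof -
  show "homog E q \<subseteq> carrier E"
    by (rule subsetI) (erule homog_E_cases, simp)
  show "\<zero>\<^bsub>E\<^esub> \<in> homog E q"
    using homog_E_I[of 0] by (simp add: cls_zero)
  show "u \<ominus>\<^bsub>E\<^esub> v \<in> homog E q" if "u \<in> homog E q" "v \<in> homog E q"
    using that
    by (elim homog_E_cases) (simp add: cls_diff homog_E_I keys_subset_diff)
  show "u \<otimes>\<^bsub>E\<^esub> v \<in> homog E (p + q)" if "u \<in> homog E p" "v \<in> homog E q"
    using that
    by (elim homog_E_cases) (simp add: cls_mult homog_E_I mult_K)
  show "differential E u \<in> carrier E" if "u \<in> carrier E"
    using that by (elim cls_cases) (simp add: differential_cls frag_extend_symbols)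
  show "differential E (u \<ominus>\<^bsub>E\<^esub> v) = differential E u \<ominus>\<^bsub>E\<^esub> differential E v"
    if "u \<in> carrier E" "v \<in> carrier E"
    using that
    by (elim cls_cases) (simp add: differential_cls frag_extend_symbols cls_diff keys_subset_diff
        frag_extend_diff)
  show "differential E u \<in> homog E (Suc q)" if u: "u \<in> homog E q"
    using u
  proof (rule homog_E_cases)
    fix x assume x: "u = cls x" "Poly_Mapping.keys x \<subseteq> K q" "symbols x"
    have "Poly_Mapping.keys (frag_extend f x) \<subseteq> K (Suc q)"
      by (intro order_trans[OF keys_frag_extend] UN_least f_degree) (rule subsetD[OF x(2)])
    then show ?thesis
      using x by (simp add: differential_cls homog_E_I)
  qed
qed

text \<open>Statements about the quotient that are additive in a variable need only be checked on the
  classes of symbols.\<close>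

lemma E_induct [consumes 1, case_names zero symbol diff]:
  assumes "z \<in> carrier E"
    and "P \<zero>\<^bsub>E\<^esub>"
    and "\<And>s. s \<in> carrier M \<Longrightarrow> P (cls (frag_of s))"
    and diff: "\<And>u v. \<lbrakk>u \<in> carrier E; v \<in> carrier E; P u; P v\<rbrakk> \<Longrightarrow> P (u \<ominus>\<^bsub>E\<^esub> v)"
  shows "P z"
proof -
  obtain x where x: "symbols x" "z = cls x" using assms(1) by (rule cls_cases)
  have "symbols x \<and> P (cls x)" using x(1)
  proof (induction x rule: frag_induction)
    case zero
    then show ?case using assms(2) by (simp add: cls_zero)
  next
    case (one s)
    then show ?case using assms(3) by simp
  next
    case (diff a b)
    then show ?case using assms(4)[of "cls a" "cls b"] by (simp add: cls_diff keys_subset_diff)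
  qed
  then show ?thesis using x by simp
qed

end

section \<open>Differential graded rings with a central ring of constants\<close>

text \<open>These are the properties of \<open>A \<rightarrow> \<Omega>\<close> and \<open>A \<rightarrow> \<Omega>\<^sub>\<rat>\<close> on which the calculus rests.  The last two
axioms are the only instances of the Leibniz rule that occur: on constants, and on a product whose first
factor is exact of degree \<open>1\<close>, where it also contains \<open>d d = 0\<close>.\<close>

locale dg_algebra = A: cring A + B: ring B
  for A :: "('a, 'n) ring_scheme" and B :: "('b, 'm) dg_ring_scheme" +
  fixes c :: "'a \<Rightarrow> 'b"
  assumes homog_subset: "homog B q \<subseteq> carrier B"
    and homog_zero: "\<zero>\<^bsub>B\<^esub> \<in> homog B q"
    and homog_diff: "\<lbrakk>x \<in> homog B q; y \<in> homog B q\<rbrakk> \<Longrightarrow> x \<ominus>\<^bsub>B\<^esub> y \<in> homog B q"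
    and homog_mult: "\<lbrakk>x \<in> homog B p; y \<in> homog B q\<rbrakk> \<Longrightarrow> x \<otimes>\<^bsub>B\<^esub> y \<in> homog B (p + q)"
    and d_closed: "x \<in> carrier B \<Longrightarrow> differential B x \<in> carrier B"
    and d_diff: "\<lbrakk>x \<in> carrier B; y \<in> carrier B\<rbrakk> \<Longrightarrow>
      differential B (x \<ominus>\<^bsub>B\<^esub> y) = differential B x \<ominus>\<^bsub>B\<^esub> differential B y"
    and d_homog: "x \<in> homog B q \<Longrightarrow> differential B x \<in> homog B (Suc q)"
    and const_hom: "c \<in> ring_hom A B"
    and const_homog: "a \<in> carrier A \<Longrightarrow> c a \<in> homog B 0"
    and const_central: "\<lbrakk>a \<in> carrier A; x \<in> carrier B\<rbrakk> \<Longrightarrow> c a \<otimes>\<^bsub>B\<^esub> x = x \<otimes>\<^bsub>B\<^esub> c a"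
    and d_const_mult: "\<lbrakk>a \<in> carrier A; b \<in> carrier A\<rbrakk> \<Longrightarrow>
      differential B (c (a \<otimes>\<^bsub>A\<^esub> b)) = c a \<otimes>\<^bsub>B\<^esub> differential B (c b) \<oplus>\<^bsub>B\<^esub> c b \<otimes>\<^bsub>B\<^esub> differential B (c a)"
    and d_exact_mult: "\<lbrakk>a \<in> carrier A; x \<in> carrier B\<rbrakk> \<Longrightarrow>
      differential B (differential B (c a) \<otimes>\<^bsub>B\<^esub> x) = \<ominus>\<^bsub>B\<^esub> (differential B (c a) \<otimes>\<^bsub>B\<^esub> differential B x)"
begin

lemma const_closed [simp]: "a \<in> carrier A \<Longrightarrow> c a \<in> carrier B"
  using const_hom by (simp add: ring_hom_closed)

lemma d_zero [simp]: "differential B \<zero>\<^bsub>B\<^esub> = \<zero>\<^bsub>B\<^esub>"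
  using d_diff[of "\<zero>\<^bsub>B\<^esub>" "\<zero>\<^bsub>B\<^esub>"] d_closed[of "\<zero>\<^bsub>B\<^esub>"] by (simp add: a_minus_def B.r_neg)

lemma d_a_inv: "x \<in> carrier B \<Longrightarrow> differential B (\<ominus>\<^bsub>B\<^esub> x) = \<ominus>\<^bsub>B\<^esub> differential B x"
  using d_diff[of "\<zero>\<^bsub>B\<^esub>" x] by (simp add: a_minus_def d_closed)

lemma d_add:
  "\<lbrakk>x \<in> carrier B; y \<in> carrier B\<rbrakk> \<Longrightarrow>
    differential B (x \<oplus>\<^bsub>B\<^esub> y) = differential B x \<oplus>\<^bsub>B\<^esub> differential B y"
  using d_diff[of x "\<ominus>\<^bsub>B\<^esub> y"] by (simp add: a_minus_def d_closed d_a_inv)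

lemma homog_closed [simp]: "x \<in> homog B q \<Longrightarrow> x \<in> carrier B"
  using homog_subset by blast

end

section \<open>The de Rham complex\<close>

locale de_Rham_setting = A: cring A
  for A0 :: "('a0, 'm) ring_scheme" and A :: "('a, 'n) ring_scheme" and \<phi> :: "'a0 \<Rightarrow> 'a" +
  assumes phi_closed: "x \<in> carrier A0 \<Longrightarrow> \<phi> x \<in> carrier A"
begin

abbreviation M where "M \<equiv> A \<times>\<times> word_monoid (carrier A)"

abbreviation F where "F \<equiv> monoid_ring M"

abbreviation J where "J \<equiv> form_ideal A0 A \<phi>"

abbreviation symbols :: "('a \<times> 'a list \<Rightarrow>\<^sub>0 int) \<Rightarrow> bool" where
  "symbols x \<equiv> Poly_Mapping.keys x \<subseteq> carrier M"

lemma word_monoid: "monoid (word_monoid D)"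
  by (intro monoidI) (auto simp: word_monoid_def)

lemma M: "monoid M"
  by (intro DirProd_monoid A.monoid_axioms word_monoid)

lemma symbol_simps [simp]:
  "carrier (word_monoid D) = lists D"
  "v \<otimes>\<^bsub>word_monoid D\<^esub> w = v @ w"
  "\<one>\<^bsub>word_monoid D\<^esub> = []"
  by (simp_all add: word_monoid_def)

lemma F: "ring F" by (rule monoid_ring_ring[OF M])

lemma relations_symbols: "form_relations A0 A \<phi> \<subseteq> carrier F"
  by (auto simp: form_relations_def phi_closed dest!: subsetD[OF keys_diff])

lemma ideal_J: "ideal J F"
  unfolding form_ideal_def form_symbols_def by (rule ring.genideal_ideal[OF F relations_symbols])

lemma relation_J: "x \<in> form_relations A0 A \<phi> \<Longrightarrow> x \<in> J"
  unfolding form_ideal_def form_symbols_def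
  by (rule subsetD[OF ring.genideal_self[OF F relations_symbols]])

lemma J_simps:
  shows J_symbols: "x \<in> J \<Longrightarrow> symbols x"
    and J_zero: "0 \<in> J"
    and J_diff: "\<lbrakk>x \<in> J; y \<in> J\<rbrakk> \<Longrightarrow> x - y \<in> J"
    and J_left: "\<lbrakk>x \<in> J; symbols y\<rbrakk> \<Longrightarrow> y \<otimes>\<^bsub>F\<^esub> x \<in> J"
    and J_right: "\<lbrakk>x \<in> J; symbols y\<rbrakk> \<Longrightarrow> x \<otimes>\<^bsub>F\<^esub> y \<in> J"
proof -
  interpret J: ideal J F by (rule ideal_J)
  show "x \<in> J \<Longrightarrow> symbols x" using J.a_Hcarr by simp
  show "0 \<in> J" 
    using additive_subgroup.zero_closed[OF ideal.axioms(1)[OF ideal_J]] by (simp only: monoid_ring_simps)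
  show "\<lbrakk>x \<in> J; y \<in> J\<rbrakk> \<Longrightarrow> x - y \<in> J" by (rule monoid_ring_ideal_diff[OF M ideal_J])
  show "\<lbrakk>x \<in> J; symbols y\<rbrakk> \<Longrightarrow> y \<otimes>\<^bsub>F\<^esub> x \<in> J" by (rule J.I_l_closed) simp_all
  show "\<lbrakk>x \<in> J; symbols y\<rbrakk> \<Longrightarrow> x \<otimes>\<^bsub>F\<^esub> y \<in> J" by (rule J.I_r_closed) simp_all
qed

lemma J_minus: "x \<in> J \<Longrightarrow> - x \<in> J"
  using J_diff[OF J_zero, of x] by simp

lemma J_add: "\<lbrakk>x \<in> J; y \<in> J\<rbrakk> \<Longrightarrow> x + y \<in> J"
  using J_diff[OF _ J_minus, of x y] by simp

lemma J_cmul: "x \<in> J \<Longrightarrow> frag_cmul k x \<in> J"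
  by (rule frag_closure_minus_cmul[where P = "\<lambda>x. x \<in> J"]) (simp_all add: J_zero J_diff)

abbreviation D where "D \<equiv> frag_extend (\<lambda>(a, w). frag_of (\<one>\<^bsub>A\<^esub>, a # w))"

abbreviation \<sigma> where "\<sigma> \<equiv> frag_extend (\<lambda>(a, w). frag_cmul ((- 1) ^ length w) (frag_of (a, w)))"

lemma leibniz_J:
  assumes "a \<in> carrier A" "b \<in> carrier A"
  shows "frag_of (\<one>\<^bsub>A\<^esub>, [a \<otimes>\<^bsub>A\<^esub> b]) - frag_of (a, [b]) - frag_of (b, [a]) \<in> J"
  by (rule relation_J) (use assms in \<open>auto simp: form_relations_def\<close>)

lemma additive_J:
  assumes "a \<in> carrier A" "b \<in> carrier A"
  shows "frag_of (\<one>\<^bsub>A\<^esub>, [a \<oplus>\<^bsub>A\<^esub> b]) - frag_of (\<one>\<^bsub>A\<^esub>, [a]) - frag_of (\<one>\<^bsub>A\<^esub>, [b]) \<in> J"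
  by (rule relation_J) (use assms in \<open>auto simp: form_relations_def\<close>)

text \<open>Polarisation of \<open>dx \<and> dx = 0\<close> at \<open>x = a + b\<close>.\<close>

lemma anticommute_J:
  assumes "a \<in> carrier A" "b \<in> carrier A"
  shows "frag_of (\<one>\<^bsub>A\<^esub>, [a, b]) + frag_of (\<one>\<^bsub>A\<^esub>, [b, a]) \<in> J"
proof -
  let ?s = "a \<oplus>\<^bsub>A\<^esub> b"
  note add = additive_J[OF assms]
  have sq: "frag_of (\<one>\<^bsub>A\<^esub>, [x, x]) \<in> J" if "x \<in> carrier A" for x
    by (rule relation_J) (use that in \<open>auto simp: form_relations_def\<close>)
  have 1: "frag_of (\<one>\<^bsub>A\<^esub>, [?s, ?s]) - frag_of (\<one>\<^bsub>A\<^esub>, [a, ?s]) - frag_of (\<one>\<^bsub>A\<^esub>, [b, ?s]) \<in> J"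
    using J_right[OF add, of "frag_of (\<one>\<^bsub>A\<^esub>, [?s])"] assms
    by (simp add: monoid_ring_mult_diff)
  have 2: "frag_of (\<one>\<^bsub>A\<^esub>, [x, ?s]) - frag_of (\<one>\<^bsub>A\<^esub>, [x, a]) - frag_of (\<one>\<^bsub>A\<^esub>, [x, b]) \<in> J"
    if "x \<in> carrier A" for x
    using J_left[OF add, of "frag_of (\<one>\<^bsub>A\<^esub>, [x])"] assms that
    by (simp add: monoid_ring_mult_diff)
  have s: "?s \<in> carrier A" using assms by simp
  have "(frag_of (\<one>\<^bsub>A\<^esub>, [?s, ?s]) - frag_of (\<one>\<^bsub>A\<^esub>, [a, a]) - frag_of (\<one>\<^bsub>A\<^esub>, [b, b]))
      - (frag_of (\<one>\<^bsub>A\<^esub>, [?s, ?s]) - frag_of (\<one>\<^bsub>A\<^esub>, [a, ?s]) - frag_of (\<one>\<^bsub>A\<^esub>, [b, ?s]))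
      - (frag_of (\<one>\<^bsub>A\<^esub>, [a, ?s]) - frag_of (\<one>\<^bsub>A\<^esub>, [a, a]) - frag_of (\<one>\<^bsub>A\<^esub>, [a, b]))
      - (frag_of (\<one>\<^bsub>A\<^esub>, [b, ?s]) - frag_of (\<one>\<^bsub>A\<^esub>, [b, a]) - frag_of (\<one>\<^bsub>A\<^esub>, [b, b])) \<in> J"
    by (intro J_diff 1 2 sq assms s)
  then show ?thesis by simp
qed

text \<open>A differential in the middle of a word can be moved to the front at the cost of a sign, one transposition at a time.\<close>

lemma move_J:
  assumes "a \<in> carrier A" "b \<in> carrier A" "v \<in> lists (carrier A)" "w \<in> lists (carrier A)"
  shows "frag_of (a, w @ b # v) - frag_cmul ((- 1) ^ length w) (frag_of (a, b # w @ v)) \<in> J"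
  using assms(4,1)
proof (induction w arbitrary: a)
  case Nil
  then show ?case by (simp add: J_zero)
next
  case (Cons x w)
  note x = \<open>x \<in> carrier A\<close>
  have "frag_of (\<one>\<^bsub>A\<^esub>, w @ b # v) - frag_cmul ((- 1) ^ length w) (frag_of (\<one>\<^bsub>A\<^esub>, b # w @ v)) \<in> J"
    by (rule Cons.IH) simp
  from J_left[OF this, of "frag_of (a, [x])"]
  have 1: "frag_of (a, x # w @ b # v) - frag_cmul ((- 1) ^ length w) (frag_of (a, x # b # w @ v)) \<in> J"
    using Cons.prems x by (simp add: monoid_ring_mult_diff monoid_ring_mult_cmul)
  from J_left[OF J_right[OF anticommute_J[OF x assms(2)], of "frag_of (\<one>\<^bsub>A\<^esub>, w @ v)"], of "frag_of (a, [])"]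
  have 2: "frag_of (a, x # b # w @ v) + frag_of (a, b # x # w @ v) \<in> J"
    using Cons.prems Cons.hyps x assms by (simp add: monoid_ring_mult_add)
  have "frag_of (a, x # w @ b # v) + frag_cmul ((- 1) ^ length w) (frag_of (a, b # x # w @ v)) \<in> J"
    using J_add[OF 1 J_cmul[OF 2, of "(- 1) ^ length w"]] by (simp add: frag_cmul_distrib2)
  then show ?case
    by (simp add: diff_conv_add_uminus del: add_uminus_conv_diff)
qed

text \<open>The graded Leibniz rule modulo the relations.  On symbols \<open>D\<close> merely puts the coefficient in front of the word,
so the rule holds by virtue of \<open>d(a b) = a db + b da\<close>, after the differential \<open>db\<close> has been moved to its place
behind the first word.\<close>

lemma D_mult_J:
  assumes "symbols x" "symbols y"
  shows "D (x \<otimes>\<^bsub>F\<^esub> y) - D x \<otimes>\<^bsub>F\<^esub> y - \<sigma> x \<otimes>\<^bsub>F\<^esub> D y \<in> J"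
  using assms(1)
proof (induction x rule: frag_induction)
  case zero
  then show ?case by (simp add: J_zero)
next
  case (diff x x')
  show ?case
    using J_diff[OF diff] by (simp add: monoid_ring_mult_diff frag_extend_diff algebra_simps)
next
  case (one s)
  obtain a w where s: "s = (a, w)" "a \<in> carrier A" "w \<in> lists (carrier A)"
    using one by auto
  show ?case using assms(2)
  proof (induction y rule: frag_induction)
    case zero
    then show ?case by (simp add: J_zero)
  next
    case (diff y y')
    show ?case
      using J_diff[OF diff] by (simp add: monoid_ring_mult_diff frag_extend_diff algebra_simps)
  next
    case (one t)
    obtain b v where t: "t = (b, v)" "b \<in> carrier A" "v \<in> lists (carrier A)"
      using one by auto
    have "frag_of (\<one>\<^bsub>A\<^esub>, (a \<otimes>\<^bsub>A\<^esub> b) # w @ v) - frag_of (a, b # w @ v) - frag_of (b, a # w @ v) \<in> J"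
      using J_right[OF leibniz_J[OF s(2) t(2)], of "frag_of (\<one>\<^bsub>A\<^esub>, w @ v)"] s t
      by (simp add: monoid_ring_mult_diff)
    from J_diff[OF this J_cmul[OF move_J[OF s(2) t(2,3) s(3)], of "(- 1) ^ length w"]]
    have "frag_of (\<one>\<^bsub>A\<^esub>, (a \<otimes>\<^bsub>A\<^esub> b) # w @ v) - frag_of (b, a # w @ v)
        - frag_cmul ((- 1) ^ length w) (frag_of (a, w @ b # v)) \<in> J"
      by (simp add: frag_cmul_distrib2 frag_cmul_diff algebra_simps flip: power_mult_distrib)
    then show ?case using s t by (simp add: monoid_ring_mult_cmul)
  qed
qed

lemma \<sigma>_mult:
  assumes "symbols x" "symbols y"
  shows "\<sigma> (x \<otimes>\<^bsub>F\<^esub> y) = \<sigma> x \<otimes>\<^bsub>F\<^esub> \<sigma> y"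
  using assms(1)
proof (induction x rule: frag_induction)
  case (one s)
  show ?case using assms(2)
    by (induction y rule: frag_induction)
      (use one in \<open>auto simp: monoid_ring_mult_diff frag_extend_diff monoid_ring_mult_cmul power_add mult.commute\<close>)
qed (simp_all add: monoid_ring_mult_diff frag_extend_diff)

lemma D_symbols: "symbols x \<Longrightarrow> symbols (D x)"
  by (intro order_trans[OF keys_frag_extend] UN_least) (drule (1) subsetD, auto)

lemma \<sigma>_symbols: "symbols x \<Longrightarrow> symbols (\<sigma> x)"
  by (intro order_trans[OF keys_frag_extend] UN_least) (drule (1) subsetD, auto)

text \<open>The ideal is two-sided, so a relation occurs with factors on both sides, and \<open>\<sigma>\<close> of it enters through the Leibniz
rule.  Hence the elements \<open>x\<close> of the ideal for which \<open>D x\<close> and \<open>\<sigma> x\<close> are in the ideal again form an ideal, and it suffices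
to inspect the relations.\<close>

lemma D_J:
  assumes "x \<in> J"
  shows "D x \<in> J"
proof -
  let ?H = "{x \<in> J. D x \<in> J \<and> \<sigma> x \<in> J}"
  have D_eq: "D (x \<otimes>\<^bsub>F\<^esub> y) \<in> J" if "symbols x" "symbols y" "D x \<otimes>\<^bsub>F\<^esub> y \<in> J" "\<sigma> x \<otimes>\<^bsub>F\<^esub> D y \<in> J" for x y
    using J_add[OF J_add[OF D_mult_J[OF that(1,2)] that(3)] that(4)] by simp
  have ideal: "ideal ?H F"
  proof (rule monoid_ring_idealI[OF M])
    fix a x assume a: "a \<in> ?H" and x: "symbols x"
    have a': "symbols a" "a \<in> J" "D a \<in> J" "\<sigma> a \<in> J" using a J_symbols by simp_all
    have "\<sigma> (x \<otimes>\<^bsub>F\<^esub> a) \<in> J" "\<sigma> (a \<otimes>\<^bsub>F\<^esub> x) \<in> J"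
      using a' x by (simp_all only: \<sigma>_mult J_left J_right \<sigma>_symbols)
    moreover have "D (x \<otimes>\<^bsub>F\<^esub> a) \<in> J" "D (a \<otimes>\<^bsub>F\<^esub> x) \<in> J"
      by (rule D_eq; use a' x in \<open>simp only: J_left J_right D_symbols \<sigma>_symbols\<close>)+
    ultimately show "x \<otimes>\<^bsub>F\<^esub> a \<in> ?H" "a \<otimes>\<^bsub>F\<^esub> x \<in> ?H"
      using J_left[OF a'(2) x] J_right[OF a'(2) x] by (simp_all only: mem_Collect_eq simp_thms)
  next
    fix a assume "a \<in> ?H"
    then show "symbols a" by (intro J_symbols) simp
  qed (simp_all add: J_zero J_diff frag_extend_diff)
  have rel: "form_relations A0 A \<phi> \<subseteq> ?H"
  proof
    fix r assume r: "r \<in> form_relations A0 A \<phi>"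
    have rJ: "r \<in> J" using r by (rule relation_J)
    \<comment> \<open>\<open>d1 = 0\<close>, from \<open>1 = 1 \<cdot> 1\<close>\<close>
    have one: "frag_of (\<one>\<^bsub>A\<^esub>, [\<one>\<^bsub>A\<^esub>]) \<in> J"
      using J_minus[OF leibniz_J[of "\<one>\<^bsub>A\<^esub>" "\<one>\<^bsub>A\<^esub>"]] by simp
    have one': "frag_of (\<one>\<^bsub>A\<^esub>, \<one>\<^bsub>A\<^esub> # w) \<in> J" if "w \<in> lists (carrier A)" for w
      using J_right[OF one, of "frag_of (\<one>\<^bsub>A\<^esub>, w)"] that by simp
    \<comment> \<open>every relation is homogeneous\<close>
    have "\<sigma> r = r \<or> \<sigma> r = - r"
      using r by (auto simp: form_relations_def frag_extend_diff)
    then have "\<sigma> r \<in> J" using rJ J_minus[OF rJ] by (elim disjE) simp_all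
    moreover have "D r \<in> J"
      using r unfolding form_relations_def
    proof (elim UnE CollectE exE conjE)
      fix a b assume *: "r = frag_of (a \<oplus>\<^bsub>A\<^esub> b, []) - frag_of (a, []) - frag_of (b, [])"
        "a \<in> carrier A" "b \<in> carrier A"
      show ?thesis
        using additive_J[OF *(2,3)] unfolding *(1) by (simp add: frag_extend_diff)
    next
      fix a b assume *: "r = frag_of (\<one>\<^bsub>A\<^esub>, [a \<otimes>\<^bsub>A\<^esub> b]) - frag_of (a, [b]) - frag_of (b, [a])"
        "a \<in> carrier A" "b \<in> carrier A"
      show ?thesis
        using J_diff[OF one'[of "[a \<otimes>\<^bsub>A\<^esub> b]"] anticommute_J[OF *(2,3)]] *(2,3)
        unfolding *(1) by (simp add: frag_extend_diff frag_extend_add diff_diff_eq)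
    qed (auto simp: frag_extend_diff phi_closed intro!: J_diff one')
    ultimately show "r \<in> ?H" using rJ by simp
  qed
  have "J \<subseteq> ?H"
    using ring.genideal_minimal[OF F ideal rel] by (simp only: form_ideal_def form_symbols_def)
  then have "x \<in> ?H" using assms by (rule subsetD)
  then show ?thesis by simp
qed

end

lemma ideal_subset_carrier: "ideal D R \<Longrightarrow> D \<subseteq> carrier R"
  by (rule additive_subgroup.a_subset[OF ideal.axioms(1)])

lemma ideal_pow_closed:
  fixes j :: nat
  assumes D: "ideal D R" and b: "b \<in> D" and j: "0 < j"
  shows "b [^]\<^bsub>R\<^esub> j \<in> D"
proof -
  interpret D: ideal D R by fact
  obtain i where "j = Suc i" using j by (cases j) auto
  then show ?thesis using b D.a_Hcarr by (simp add: D.I_l_closed)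
qed

lemma (in ring) mult_minus_distrib:
  assumes "x \<in> carrier R" "u \<in> carrier R" "v \<in> carrier R"
  shows "x \<otimes> (u \<ominus> v) = x \<otimes> u \<ominus> x \<otimes> v" "(u \<ominus> v) \<otimes> x = u \<otimes> x \<ominus> v \<otimes> x"
  using assms by (simp_all add: a_minus_def r_distr l_distr r_minus l_minus)

lemma (in ring) a_inv_minus:
  assumes "u \<in> carrier R" "v \<in> carrier R"
  shows "\<ominus> (u \<ominus> v) = (\<ominus> u) \<ominus> (\<ominus> v)"
  using assms by (simp add: a_minus_def minus_add)

context de_Rham_setting
begin

lemma dg_symbol_quotient_de_Rham:
  "dg_symbol_quotient M J (\<lambda>q. carrier A \<times> {w \<in> lists (carrier A). length w = q})
    (\<lambda>(a, w). frag_of (\<one>\<^bsub>A\<^esub>, a # w))"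
proof (intro dg_symbol_quotient.intro M ideal_J dg_symbol_quotient_axioms.intro)
  show "Poly_Mapping.keys (case s of (a, w) \<Rightarrow> frag_of (\<one>\<^bsub>A\<^esub>, a # w)) \<subseteq>
      carrier A \<times> {w \<in> lists (carrier A). length w = Suc q}"
    if "s \<in> carrier A \<times> {w \<in> lists (carrier A). length w = q}" for s q
    using that by auto
qed (use D_J in auto)

interpretation Q: dg_symbol_quotient M J "\<lambda>q. carrier A \<times> {w \<in> lists (carrier A). length w = q}"
    "\<lambda>(a, w). frag_of (\<one>\<^bsub>A\<^esub>, a # w)"
  by (rule dg_symbol_quotient_de_Rham)

lemma de_Rham_eq: "de_Rham A0 A \<phi> = Q.E"
  by (simp only: de_Rham_def symbol_quotient_def form_symbols_def)

lemma form_const_eq: "form_const A0 A \<phi> a = Q.cls (frag_of (a, []))"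
  by (simp add: form_const_def form_symbols_def)

text \<open>The axioms about an arbitrary form are additive in it and therefore only need to be verified on symbols, where
they follow from the commutativity of \<open>A\<close> and the anticommutation of differentials.\<close>

theorem dg_algebra_de_Rham: "dg_algebra A (de_Rham A0 A \<phi>) (form_const A0 A \<phi>)"
proof -
  interpret E: ring Q.E by (rule Q.ring_E)
  have dc: "differential Q.E (Q.cls (frag_of (a, []))) = Q.cls (frag_of (\<one>\<^bsub>A\<^esub>, [a]))"
    if "a \<in> carrier A" for a
    using that by (simp add: Q.differential_cls)
  show ?thesis
    unfolding de_Rham_eq form_const_eq
  proof (intro dg_algebra.intro dg_algebra_axioms.intro A.cring_axioms E.ring_axioms Q.dg_E)
    show "(\<lambda>a. Q.cls (frag_of (a, []))) \<in> ring_hom A Q.E"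
    proof (rule ring_hom_memI)
      fix a b assume ab: "a \<in> carrier A" "b \<in> carrier A"
      have "frag_of (a \<oplus>\<^bsub>A\<^esub> b, []) - frag_of (a, []) - frag_of (b, []) \<in> J"
        by (rule relation_J) (use ab in \<open>auto simp: form_relations_def\<close>)
      then have "Q.cls (frag_of (a \<oplus>\<^bsub>A\<^esub> b, [])) = Q.cls (frag_of (a, []) + frag_of (b, []))"
        using ab by (intro Q.cls_eqI order_trans[OF keys_add]) (simp_all add: diff_diff_eq)
      then show "Q.cls (frag_of (a \<oplus>\<^bsub>A\<^esub> b, [])) =
          Q.cls (frag_of (a, [])) \<oplus>\<^bsub>Q.E\<^esub> Q.cls (frag_of (b, []))"
        using ab by (simp add: Q.cls_add)
    qed (simp_all add: Q.cls_mult Q.cls_one)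
  next
    fix a assume "a \<in> carrier A"
    then show "Q.cls (frag_of (a, [])) \<in> homog Q.E 0"
      by (intro Q.homog_E_I) simp
  next
    fix a x assume a: "a \<in> carrier A" and "x \<in> carrier Q.E"
    from this(2) show "Q.cls (frag_of (a, [])) \<otimes>\<^bsub>Q.E\<^esub> x = x \<otimes>\<^bsub>Q.E\<^esub> Q.cls (frag_of (a, []))"
    proof (induction x rule: Q.E_induct)
      case zero
      then show ?case using a by simp
    next
      case (symbol s)
      then show ?case using a by (auto simp: Q.cls_mult A.m_comm)
    next
      case (diff u v)
      then show ?case using a by (simp add: E.mult_minus_distrib)
    qed
  next
    fix a b assume ab: "a \<in> carrier A" "b \<in> carrier A"
    have "Q.cls (frag_of (\<one>\<^bsub>A\<^esub>, [a \<otimes>\<^bsub>A\<^esub> b])) = Q.cls (frag_of (a, [b]) + frag_of (b, [a]))"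
      using ab leibniz_J[OF ab]
      by (intro Q.cls_eqI order_trans[OF keys_add]) (simp_all add: diff_diff_eq)
    then show "differential Q.E (Q.cls (frag_of (a \<otimes>\<^bsub>A\<^esub> b, []))) =
        Q.cls (frag_of (a, [])) \<otimes>\<^bsub>Q.E\<^esub> differential Q.E (Q.cls (frag_of (b, []))) \<oplus>\<^bsub>Q.E\<^esub>
        Q.cls (frag_of (b, [])) \<otimes>\<^bsub>Q.E\<^esub> differential Q.E (Q.cls (frag_of (a, [])))"
      using ab by (simp add: dc Q.cls_mult Q.cls_add)
  next
    fix a x assume a: "a \<in> carrier A" and "x \<in> carrier Q.E"
    from this(2) show "differential Q.E (differential Q.E (Q.cls (frag_of (a, []))) \<otimes>\<^bsub>Q.E\<^esub> x) =
        \<ominus>\<^bsub>Q.E\<^esub> (differential Q.E (Q.cls (frag_of (a, []))) \<otimes>\<^bsub>Q.E\<^esub> differential Q.E x)"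
    proof (induction x rule: Q.E_induct)
      case zero
      have "differential Q.E \<zero>\<^bsub>Q.E\<^esub> = \<zero>\<^bsub>Q.E\<^esub>"
        using Q.differential_cls[of 0] by (simp add: Q.cls_zero)
      then show ?case using a by (simp add: dc)
    next
      case (symbol s)
      then obtain b w where s: "s = (b, w)" "b \<in> carrier A" "w \<in> lists (carrier A)" by auto
      have "frag_of (\<one>\<^bsub>A\<^esub>, b # a # w) + frag_of (\<one>\<^bsub>A\<^esub>, a # b # w) \<in> J"
        using J_right[OF anticommute_J[OF s(2) a], of "frag_of (\<one>\<^bsub>A\<^esub>, w)"] s a
        by (simp add: monoid_ring_mult_add)
      then have "Q.cls (frag_of (\<one>\<^bsub>A\<^esub>, b # a # w)) = Q.cls (- frag_of (\<one>\<^bsub>A\<^esub>, a # b # w))"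
        using s a by (intro Q.cls_eqI) simp_all
      then show ?case
        using a s by (simp add: dc Q.cls_mult Q.differential_cls Q.cls_a_inv)
    next
      case (diff u v)
      then show ?case
        using a Q.differential_E_closed
        by (simp add: dc E.mult_minus_distrib Q.differential_E_diff E.a_inv_minus)
    qed
  qed
qed

end

section \<open>Tensor product with the rational numbers\<close>

locale rational_tensor = B: ring B for B :: "('b, 'm) dg_ring_scheme" +
  assumes d_additive_closed: "x \<in> carrier B \<Longrightarrow> differential B x \<in> carrier B"
    and d_additive: "\<lbrakk>x \<in> carrier B; y \<in> carrier B\<rbrakk> \<Longrightarrow>
      differential B (x \<oplus>\<^bsub>B\<^esub> y) = differential B x \<oplus>\<^bsub>B\<^esub> differential B y"
begin

abbreviation M where "M \<equiv> B \<times>\<times> rat_monoid"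

abbreviation F where "F \<equiv> monoid_ring M"

abbreviation T where "T \<equiv> tensor_ideal B"

abbreviation symbols :: "('b \<times> rat \<Rightarrow>\<^sub>0 int) \<Rightarrow> bool" where
  "symbols x \<equiv> Poly_Mapping.keys x \<subseteq> carrier M"

abbreviation D where "D \<equiv> frag_extend (\<lambda>(x, r). frag_of (differential B x, r))"

lemma rat_monoid: "monoid rat_monoid"
  by (intro monoidI) (auto simp: rat_monoid_def)

lemma M: "monoid M"
  by (intro DirProd_monoid B.monoid_axioms rat_monoid)

lemma rat_monoid_simps [simp]:
  "carrier rat_monoid = UNIV" "r \<otimes>\<^bsub>rat_monoid\<^esub> s = r * s" "\<one>\<^bsub>rat_monoid\<^esub> = 1"
  by (simp_all add: rat_monoid_def)

lemma F: "ring F" by (rule monoid_ring_ring[OF M])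

lemma relations_symbols: "tensor_relations B \<subseteq> carrier F"
  by (auto simp: tensor_relations_def dest!: subsetD[OF keys_diff])

lemma ideal_T: "ideal T F"
  unfolding tensor_ideal_def tensor_symbols_def by (rule ring.genideal_ideal[OF F relations_symbols])

lemma relation_T: "x \<in> tensor_relations B \<Longrightarrow> x \<in> T"
  unfolding tensor_ideal_def tensor_symbols_def
  by (rule subsetD[OF ring.genideal_self[OF F relations_symbols]])

lemma T_symbols: "x \<in> T \<Longrightarrow> symbols x"
  using ideal.Icarr[OF ideal_T, of x] by simp

lemma T_diff: "\<lbrakk>x \<in> T; y \<in> T\<rbrakk> \<Longrightarrow> x - y \<in> T"
  by (rule monoid_ring_ideal_diff[OF M ideal_T])

lemma T_zero: "0 \<in> T"
  using additive_subgroup.zero_closed[OF ideal.axioms(1)[OF ideal_T]] by (simp only: monoid_ring_simps)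

lemma left_additive_T:
  assumes "x \<in> carrier B" "y \<in> carrier B"
  shows "frag_of (x \<oplus>\<^bsub>B\<^esub> y, r) - frag_of (x, r) - frag_of (y, r) \<in> T"
  by (rule relation_T) (use assms in \<open>auto simp: tensor_relations_def\<close>)

lemma right_additive_T:
  assumes "x \<in> carrier B"
  shows "frag_of (x, r + s) - frag_of (x, r) - frag_of (x, s) \<in> T"
  by (rule relation_T) (use assms in \<open>auto simp: tensor_relations_def\<close>)

text \<open>The differential acts on the first factor only and respects the relations, but it is no derivation on symbols.  So
instead of the Leibniz rule one uses that the elements all of whose two-sided multiples are mapped into the ideal
form an ideal; a two-sided multiple of a relation by symbols is a relation.\<close>

lemma D_T:
  assumes "x \<in> T"
  shows "D x \<in> T"
proof -
  let ?P = "\<lambda>x. \<forall>u v. symbols u \<longrightarrow> symbols v \<longrightarrow> D (u \<otimes>\<^bsub>F\<^esub> x \<otimes>\<^bsub>F\<^esub> v) \<in> T"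
  let ?H = "{x. symbols x \<and> ?P x}"
  interpret F: ring F by (rule F)
  have closed: "symbols (u \<otimes>\<^bsub>F\<^esub> v)" if "symbols u" "symbols v" for u v
    using F.m_closed[of u v] that by (simp only: monoid_ring_simps)
  have assoc: "u \<otimes>\<^bsub>F\<^esub> v \<otimes>\<^bsub>F\<^esub> w = u \<otimes>\<^bsub>F\<^esub> (v \<otimes>\<^bsub>F\<^esub> w)" if "symbols u" "symbols v" "symbols w" for u v w
    using F.m_assoc[of u v w] that by (simp only: monoid_ring_simps)
  have ideal: "ideal ?H F"
  proof (rule monoid_ring_idealI[OF M])
    fix a x assume a: "a \<in> ?H" and x: "symbols x"
    have a': "symbols a" and P: "?P a" using a by simp_all
    have xa: "D (u \<otimes>\<^bsub>F\<^esub> (x \<otimes>\<^bsub>F\<^esub> a) \<otimes>\<^bsub>F\<^esub> v) \<in> T" if "symbols u" "symbols v" for u v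
      using P[rule_format, OF closed[OF that(1) x] that(2)] assoc[OF that(1) x a'] by (simp only:)
    have ax: "D (u \<otimes>\<^bsub>F\<^esub> (a \<otimes>\<^bsub>F\<^esub> x) \<otimes>\<^bsub>F\<^esub> v) \<in> T" if "symbols u" "symbols v" for u v
      using P[rule_format, OF that(1) closed[OF x that(2)]] assoc[OF that(1) a' x]
        assoc[OF closed[OF that(1) a'] x that(2)] by (simp only:)
    show "x \<otimes>\<^bsub>F\<^esub> a \<in> ?H" "a \<otimes>\<^bsub>F\<^esub> x \<in> ?H"
      by (intro CollectI conjI allI impI closed[OF x a'] closed[OF a' x] xa ax; assumption)+
  qed (simp_all add: T_zero T_diff frag_extend_diff monoid_ring_mult_diff keys_subset_diff)
  have rel: "tensor_relations B \<subseteq> ?H"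
  proof
    fix x assume x: "x \<in> tensor_relations B"
    have sym: "D (frag_of s \<otimes>\<^bsub>F\<^esub> x \<otimes>\<^bsub>F\<^esub> frag_of t) \<in> T" if st: "s \<in> carrier M" "t \<in> carrier M" for s t
    proof -
      obtain y z p q where yz: "s = (y, p)" "t = (z, q)" "y \<in> carrier B" "z \<in> carrier B"
        using st by auto
      show ?thesis
        using x unfolding tensor_relations_def
      proof (elim UnE CollectE exE conjE)
        fix x1 x2 r assume *: "x = frag_of (x1 \<oplus>\<^bsub>B\<^esub> x2, r) - frag_of (x1, r) - frag_of (x2, r)"
          "x1 \<in> carrier B" "x2 \<in> carrier B"
        show ?thesis
          using left_additive_T[of "differential B (y \<otimes>\<^bsub>B\<^esub> x1 \<otimes>\<^bsub>B\<^esub> z)"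
              "differential B (y \<otimes>\<^bsub>B\<^esub> x2 \<otimes>\<^bsub>B\<^esub> z)" "p * r * q"] *(2,3) yz(3,4)
          unfolding *(1) yz(1,2)
          by (simp add: monoid_ring_mult_diff frag_extend_diff B.r_distr B.l_distr d_additive
              d_additive_closed)
      next
        fix x1 r1 r2 assume *: "x = frag_of (x1, r1 + r2) - frag_of (x1, r1) - frag_of (x1, r2)"
          "x1 \<in> carrier B"
        show ?thesis
          using right_additive_T[of "differential B (y \<otimes>\<^bsub>B\<^esub> x1 \<otimes>\<^bsub>B\<^esub> z)" "p * r1 * q" "p * r2 * q"]
            *(2) yz(3,4)
          unfolding *(1) yz(1,2)
          by (simp add: monoid_ring_mult_diff frag_extend_diff d_additive_closed ring_distribs)
      qed
    qed
    have "D (u \<otimes>\<^bsub>F\<^esub> x \<otimes>\<^bsub>F\<^esub> v) \<in> T" if u: "symbols u" and v: "symbols v" for u v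
      using u
    proof (induction u rule: frag_induction)
      case (one s)
      show ?case using v
        by (induction v rule: frag_induction)
          (simp_all add: sym[OF one] T_zero T_diff frag_extend_diff monoid_ring_mult_diff del: carrier_DirProd)
    qed (simp_all add: T_zero T_diff frag_extend_diff monoid_ring_mult_diff)
    moreover have "symbols x"
      by (intro T_symbols relation_T x)
    ultimately show "x \<in> ?H" by simp
  qed
  have "T \<subseteq> ?H"
    using ring.genideal_minimal[OF F ideal rel] by (simp only: tensor_ideal_def tensor_symbols_def)
  then have "x \<in> ?H" using assms by (rule subsetD)
  then have "D (\<one>\<^bsub>F\<^esub> \<otimes>\<^bsub>F\<^esub> x \<otimes>\<^bsub>F\<^esub> \<one>\<^bsub>F\<^esub>) \<in> T" "symbols x" by simp_all
  then show ?thesis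
    using F.l_one[of x] F.r_one[of x] by (simp only: monoid_ring_simps)
qed

end

text \<open>A separate locale, since \<open>dg_algebra\<close> is to be instantiated for \<open>\<Omega>\<^sub>\<rat>\<close> inside it, which would not terminate as a
sublocale declaration of \<open>dg_algebra\<close> in itself.\<close>

locale rational_dg_algebra = dg_algebra A B c
  for A :: "('a, 'n) ring_scheme" and B :: "('b, 'm) dg_ring_scheme" and c
begin

sublocale tensor: rational_tensor B
  by unfold_locales (simp_all add: d_closed d_add)

lemma dg_symbol_quotient_tensor:
  "dg_symbol_quotient tensor.M tensor.T (\<lambda>q. homog B q \<times> UNIV)
    (\<lambda>(x, r). frag_of (differential B x, r))"
proof (intro dg_symbol_quotient.intro tensor.M tensor.ideal_T dg_symbol_quotient_axioms.intro)
  show "Poly_Mapping.keys (case s of (x, r) \<Rightarrow> frag_of (differential B x, r)) \<subseteq> homog B (Suc q) \<times> UNIV"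
    if "s \<in> homog B q \<times> UNIV" for s q
    using that d_homog by auto
qed (use tensor.D_T homog_mult in \<open>auto simp: d_closed\<close>)

abbreviation W where "W \<equiv> rationalization B"

interpretation Q: dg_symbol_quotient tensor.M tensor.T "\<lambda>q. homog B q \<times> UNIV"
    "\<lambda>(x, r). frag_of (differential B x, r)"
  by (rule dg_symbol_quotient_tensor)

lemma W_eq: "W = Q.E"
  by (simp only: rationalization_def symbol_quotient_def tensor_symbols_def)

lemma tensor_eq: "tensor B x r = Q.cls (frag_of (x, r))"
  by (simp add: tensor_def tensor_symbols_def)

lemma ring_W: "ring W"
  unfolding W_eq by (rule Q.ring_E)

lemma tensor_closed [simp]: "x \<in> carrier B \<Longrightarrow> tensor B x r \<in> carrier W"
  by (simp add: W_eq tensor_eq)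

lemma tensor_mult:
  "\<lbrakk>x \<in> carrier B; y \<in> carrier B\<rbrakk> \<Longrightarrow>
    tensor B x r \<otimes>\<^bsub>W\<^esub> tensor B y s = tensor B (x \<otimes>\<^bsub>B\<^esub> y) (r * s)"
  by (simp add: W_eq tensor_eq Q.cls_mult)

lemma tensor_one: "\<one>\<^bsub>W\<^esub> = tensor B \<one>\<^bsub>B\<^esub> 1"
  by (simp add: W_eq tensor_eq Q.cls_one)

lemma tensor_add_left:
  assumes "x \<in> carrier B" "y \<in> carrier B"
  shows "tensor B (x \<oplus>\<^bsub>B\<^esub> y) r = tensor B x r \<oplus>\<^bsub>W\<^esub> tensor B y r"
proof -
  have "Q.cls (frag_of (x \<oplus>\<^bsub>B\<^esub> y, r)) = Q.cls (frag_of (x, r) + frag_of (y, r))"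
    using assms tensor.left_additive_T[OF assms, of r]
    by (intro Q.cls_eqI order_trans[OF keys_add]) (simp_all add: diff_diff_eq)
  then show ?thesis using assms by (simp add: W_eq tensor_eq Q.cls_add)
qed

lemma tensor_zero: "tensor B \<zero>\<^bsub>B\<^esub> r = \<zero>\<^bsub>W\<^esub>"
proof -
  interpret W: ring W by (rule ring_W)
  show ?thesis using tensor_add_left[of "\<zero>\<^bsub>B\<^esub>" "\<zero>\<^bsub>B\<^esub>" r] by simp
qed

lemma tensor_a_inv:
  assumes "x \<in> carrier B"
  shows "tensor B (\<ominus>\<^bsub>B\<^esub> x) r = \<ominus>\<^bsub>W\<^esub> tensor B x r"
proof -
  interpret W: ring W by (rule ring_W)
  have "tensor B (\<ominus>\<^bsub>B\<^esub> x) r \<oplus>\<^bsub>W\<^esub> tensor B x r = \<zero>\<^bsub>W\<^esub>"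
    using tensor_add_left[of "\<ominus>\<^bsub>B\<^esub> x" x r] assms by (simp add: B.l_neg tensor_zero)
  then show ?thesis using assms by (intro W.minus_equality[symmetric]) simp_all
qed

lemma tensor_diff:
  "\<lbrakk>x \<in> carrier B; y \<in> carrier B\<rbrakk> \<Longrightarrow> tensor B (x \<ominus>\<^bsub>B\<^esub> y) r = tensor B x r \<ominus>\<^bsub>W\<^esub> tensor B y r"
  by (simp add: a_minus_def tensor_add_left tensor_a_inv)

lemma tensor_add_right:
  assumes "x \<in> carrier B"
  shows "tensor B x (r + s) = tensor B x r \<oplus>\<^bsub>W\<^esub> tensor B x s"
proof -
  have "Q.cls (frag_of (x, r + s)) = Q.cls (frag_of (x, r) + frag_of (x, s))"
    using assms tensor.right_additive_T[OF assms, of r s]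
    by (intro Q.cls_eqI order_trans[OF keys_add]) (simp_all add: diff_diff_eq)
  then show ?thesis using assms by (simp add: W_eq tensor_eq Q.cls_add)
qed

lemma tensor_homog: "x \<in> homog B q \<Longrightarrow> tensor B x r \<in> homog W q"
  unfolding W_eq tensor_eq by (intro Q.homog_E_I) simp

lemma differential_tensor:
  "x \<in> carrier B \<Longrightarrow> differential W (tensor B x r) = tensor B (differential B x) r"
  by (simp add: W_eq tensor_eq Q.differential_cls)

lemma W_induct [consumes 1, case_names zero tensor diff]:
  assumes "z \<in> carrier W"
    and "P \<zero>\<^bsub>W\<^esub>"
    and "\<And>x r. x \<in> carrier B \<Longrightarrow> P (tensor B x r)"
    and "\<And>u v. \<lbrakk>u \<in> carrier W; v \<in> carrier W; P u; P v\<rbrakk> \<Longrightarrow> P (u \<ominus>\<^bsub>W\<^esub> v)"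
  shows "P z"
  using assms(1) unfolding W_eq
  by (induction z rule: Q.E_induct) (use assms(2-4) in \<open>auto simp: W_eq tensor_eq\<close>)

text \<open>The tensor product with \<open>\<rat>\<close> inherits the whole structure, so that the same rules are available
  in \<open>\<Omega>\<close> and in \<open>\<Omega>\<^sub>\<rat>\<close>.\<close>

sublocale W: dg_algebra A W "\<lambda>a. tensor B (c a) 1"
proof -
  interpret W: ring W by (rule ring_W)
  note dg_W = Q.dg_E[folded W_eq]
  show "dg_algebra A W (\<lambda>a. tensor B (c a) 1)"
  proof (intro dg_algebra.intro dg_algebra_axioms.intro A.cring_axioms ring_W dg_W)
    show "(\<lambda>a. tensor B (c a) 1) \<in> ring_hom A W"
      using const_hom
      by (intro ring_hom_memI) (simp_all add: ring_hom_mult ring_hom_add ring_hom_one tensor_mult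
          tensor_add_left tensor_one)
  next
    fix a assume "a \<in> carrier A"
    then show "tensor B (c a) 1 \<in> homog W 0"
      by (intro tensor_homog const_homog)
  next
    fix a x assume a: "a \<in> carrier A" and "x \<in> carrier W"
    from this(2) show "tensor B (c a) 1 \<otimes>\<^bsub>W\<^esub> x = x \<otimes>\<^bsub>W\<^esub> tensor B (c a) 1"
    proof (induction x rule: W_induct)
      case (tensor x r)
      then show ?case using a by (simp add: tensor_mult const_central)
    qed (use a in \<open>simp_all add: W.mult_minus_distrib\<close>)
  next
    fix a b assume "a \<in> carrier A" "b \<in> carrier A"
    then show "differential W (tensor B (c (a \<otimes>\<^bsub>A\<^esub> b)) 1) =
        tensor B (c a) 1 \<otimes>\<^bsub>W\<^esub> differential W (tensor B (c b) 1) \<oplus>\<^bsub>W\<^esub>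
        tensor B (c b) 1 \<otimes>\<^bsub>W\<^esub> differential W (tensor B (c a) 1)"
      by (simp add: differential_tensor tensor_mult d_closed d_const_mult tensor_add_left)
  next
    fix a x assume a: "a \<in> carrier A" and "x \<in> carrier W"
    have d0: "differential W \<zero>\<^bsub>W\<^esub> = \<zero>\<^bsub>W\<^esub>"
      using dg_W(6)[of "\<zero>\<^bsub>W\<^esub>" "\<zero>\<^bsub>W\<^esub>"] dg_W(5)[of "\<zero>\<^bsub>W\<^esub>"] by (simp add: a_minus_def W.r_neg)
    show "differential W (differential W (tensor B (c a) 1) \<otimes>\<^bsub>W\<^esub> x) =
        \<ominus>\<^bsub>W\<^esub> (differential W (tensor B (c a) 1) \<otimes>\<^bsub>W\<^esub> differential W x)"
      using \<open>x \<in> carrier W\<close>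
    proof (induction x rule: W_induct)
      case zero
      then show ?case using a by (simp add: d0 dg_W)
    next
      case (tensor x r)
      then show ?case using a
        by (simp add: differential_tensor tensor_mult d_closed d_exact_mult tensor_a_inv)
    next
      case (diff u v)
      then show ?case
        using a by (simp add: dg_W W.mult_minus_distrib W.a_inv_minus)
    qed
  qed
qed

text \<open>The image of \<open>\<rat>\<close> in \<open>\<Omega>\<^sub>\<rat>\<close>; the differential \<open>dl\<close> involves multiplication by the scalars \<open>1/k\<close>.\<close>

definition scalar :: "rat \<Rightarrow> ('b \<times> rat \<Rightarrow>\<^sub>0 int) set" where
  "scalar r = tensor B \<one>\<^bsub>B\<^esub> r"

lemma scalar_closed [simp]: "scalar r \<in> carrier W"
  by (simp add: scalar_def)

lemma scalar_mult: "scalar r \<otimes>\<^bsub>W\<^esub> scalar s = scalar (r * s)"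
  by (simp add: scalar_def tensor_mult)

lemma scalar_one: "scalar 1 = \<one>\<^bsub>W\<^esub>"
  by (simp add: scalar_def tensor_one)

lemma scalar_of_nat: "scalar (of_nat n) = [n] \<cdot>\<^bsub>W\<^esub> \<one>\<^bsub>W\<^esub>"
proof (induction n)
  case 0
  have "scalar 0 \<oplus>\<^bsub>W\<^esub> scalar 0 = scalar 0"
    using tensor_add_right[of "\<one>\<^bsub>B\<^esub>" 0 0] by (simp add: scalar_def)
  then show ?case by simp
next
  case (Suc n)
  have "scalar (of_nat (Suc n)) = scalar (of_nat n) \<oplus>\<^bsub>W\<^esub> scalar 1"
    using tensor_add_right[of "\<one>\<^bsub>B\<^esub>" "of_nat n" 1] by (simp add: scalar_def add.commute)
  then show ?case using Suc by (simp add: scalar_one)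
qed

lemma scalar_of_nat_mult: "x \<in> carrier W \<Longrightarrow> scalar (of_nat n) \<otimes>\<^bsub>W\<^esub> x = [n] \<cdot>\<^bsub>W\<^esub> x"
  by (simp add: scalar_of_nat W.B.add_pow_ldistr)

lemma scalar_central: "x \<in> carrier W \<Longrightarrow> scalar r \<otimes>\<^bsub>W\<^esub> x = x \<otimes>\<^bsub>W\<^esub> scalar r"
proof (induction x rule: W_induct)
  case (tensor x s)
  then show ?case by (simp add: scalar_def tensor_mult mult.commute)
qed (simp_all add: W.B.mult_minus_distrib)

lemma scalar_homog:
  assumes "x \<in> homog W q"
  shows "scalar r \<otimes>\<^bsub>W\<^esub> x \<in> homog W q"
proof -
  have "scalar r \<in> homog W 0"
    using const_homog[OF A.one_closed] const_hom by (simp add: scalar_def tensor_homog ring_hom_one)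
  then show ?thesis using W.homog_mult[of "scalar r" 0 x q] assms by simp
qed

lemma differential_scalar:
  "x \<in> carrier W \<Longrightarrow> differential W (scalar r \<otimes>\<^bsub>W\<^esub> x) = scalar r \<otimes>\<^bsub>W\<^esub> differential W x"
proof (induction x rule: W_induct)
  case (tensor x s)
  then show ?case by (simp add: scalar_def tensor_mult differential_tensor d_closed)
qed (simp_all add: W.B.mult_minus_distrib W.d_diff W.d_closed)

end

section \<open>Closed subgroups of powers\<close>

definition closed_subgroup ::
    "('b, 'm) ring_scheme \<Rightarrow> 'b set \<Rightarrow> nat set \<Rightarrow> (nat \<Rightarrow> 'b) set \<Rightarrow> bool" where
  "closed_subgroup R D S H \<longleftrightarrow>
    additive_subgroup H (power_ring R S) \<and> closedin (power_topology D S) H"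

definition closed_hull ::
    "('b, 'm) ring_scheme \<Rightarrow> 'b set \<Rightarrow> nat set \<Rightarrow> (nat \<Rightarrow> 'b) set \<Rightarrow> (nat \<Rightarrow> 'b) set" where
  "closed_hull R D S G = \<Inter>{H. closed_subgroup R D S H \<and> G \<subseteq> H}"

lemma power_ring_simps [simp]:
  "carrier (power_ring R S) = (\<Pi>\<^sub>E k\<in>S. carrier R)"
  "x \<otimes>\<^bsub>power_ring R S\<^esub> y = (\<lambda>k\<in>S. x k \<otimes>\<^bsub>R\<^esub> y k)"
  "x \<oplus>\<^bsub>power_ring R S\<^esub> y = (\<lambda>k\<in>S. x k \<oplus>\<^bsub>R\<^esub> y k)"
  "\<one>\<^bsub>power_ring R S\<^esub> = (\<lambda>k\<in>S. \<one>\<^bsub>R\<^esub>)"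
  "\<zero>\<^bsub>power_ring R S\<^esub> = (\<lambda>k\<in>S. \<zero>\<^bsub>R\<^esub>)"
  by (simp_all add: power_ring_def)

text \<open>The factors are discrete, so a basic neighbourhood of \<open>x\<close> prescribes finitely many coordinates.  In this form
closedness can be transported without any further topology.\<close>

lemma closedin_power_topology_iff:
  "closedin (power_topology D S) H \<longleftrightarrow> H \<subseteq> (\<Pi>\<^sub>E k\<in>S. D) \<and>
    (\<forall>x\<in>\<Pi>\<^sub>E k\<in>S. D. (\<forall>K. finite K \<longrightarrow> K \<subseteq> S \<longrightarrow> (\<exists>h\<in>H. \<forall>k\<in>K. h k = x k)) \<longrightarrow> x \<in> H)"
  (is "_ \<longleftrightarrow> _ \<and> ?approx")
proof -
  have top: "topspace (power_topology D S) = (\<Pi>\<^sub>E k\<in>S. D)"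
    by (simp add: power_topology_def)
  have "openin (power_topology D S) ((\<Pi>\<^sub>E k\<in>S. D) - H) \<longleftrightarrow> ?approx" if sub: "H \<subseteq> (\<Pi>\<^sub>E k\<in>S. D)"
  proof
    assume opn: "openin (power_topology D S) ((\<Pi>\<^sub>E k\<in>S. D) - H)"
    show ?approx
    proof (intro ballI impI)
      fix x assume x: "x \<in> (\<Pi>\<^sub>E k\<in>S. D)"
        and app: "\<forall>K. finite K \<longrightarrow> K \<subseteq> S \<longrightarrow> (\<exists>h\<in>H. \<forall>k\<in>K. h k = x k)"
      show "x \<in> H"
      proof (rule ccontr)
        assume "x \<notin> H"
        then have "x \<in> (\<Pi>\<^sub>E k\<in>S. D) - H" using x by simp
        then obtain U where U: "finite {i \<in> S. U i \<noteq> D}" "x \<in> Pi\<^sub>E S U"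
          "Pi\<^sub>E S U \<subseteq> (\<Pi>\<^sub>E k\<in>S. D) - H"
          using opn[unfolded power_topology_def openin_product_topology_alt]
          by (elim ballE[of _ _ x] exE conjE) auto
        obtain h where h: "h \<in> H" "\<forall>k\<in>{i \<in> S. U i \<noteq> D}. h k = x k"
          using app U(1) by (elim allE[of _ "{i \<in> S. U i \<noteq> D}"] impE) auto
        have "h \<in> Pi\<^sub>E S U"
        proof (rule PiE_I)
          fix k assume k: "k \<in> S"
          show "h k \<in> U k"
          proof (cases "U k = D")
            case True
            then show ?thesis using h(1) sub k by auto
          next
            case False
            then show ?thesis using h(2) k U(2) by (auto simp: PiE_iff)
          qed
        qed (use h(1) sub in auto)
        then show False using h(1) U(3) by blast
      qed
    qed
  next
    assume app: ?approx
    show "openin (power_topology D S) ((\<Pi>\<^sub>E k\<in>S. D) - H)"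
      unfolding power_topology_def openin_product_topology_alt
    proof (intro ballI)
      fix x assume x: "x \<in> (\<Pi>\<^sub>E k\<in>S. D) - H"
      then obtain K where K: "finite K" "K \<subseteq> S" "\<And>h. h \<in> H \<Longrightarrow> \<exists>k\<in>K. h k \<noteq> x k"
        using bspec[OF app, of x] by auto
      let ?U = "\<lambda>i. if i \<in> K then {x i} else D"
      have "finite {i \<in> S. ?U i \<noteq> D}"
        by (rule finite_subset[OF _ K(1)]) auto
      moreover have "x \<in> Pi\<^sub>E S ?U" using x by (auto simp: PiE_iff)
      moreover have "Pi\<^sub>E S ?U \<subseteq> (\<Pi>\<^sub>E k\<in>S. D) - H"
      proof
        fix y assume y: "y \<in> Pi\<^sub>E S ?U"
        have "y \<notin> H" using K(2,3) y by (force simp: PiE_iff)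
        moreover have "y k \<in> D" if "k \<in> S" for k
          using y x that by (cases "k \<in> K") (auto simp: PiE_iff)
        then have "y \<in> (\<Pi>\<^sub>E k\<in>S. D)" using y by (auto simp: PiE_iff)
        ultimately show "y \<in> (\<Pi>\<^sub>E k\<in>S. D) - H" by blast
      qed
      moreover have "\<forall>i\<in>S. openin (discrete_topology D) (?U i)" using x by (auto simp: PiE_iff)
      ultimately show "\<exists>U. finite {i \<in> S. U i \<noteq> topspace (discrete_topology D)} \<and>
          (\<forall>i\<in>S. openin (discrete_topology D) (U i)) \<and> x \<in> Pi\<^sub>E S U \<and> Pi\<^sub>E S U \<subseteq> (\<Pi>\<^sub>E k\<in>S. D) - H"
        by (intro exI[of _ ?U]) simp
    qed
  qed
  then show ?thesis unfolding closedin_def top by auto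
qed

lemma (in ring) abelian_group_power_ring: "abelian_group (power_ring R S)"
proof (rule abelian_groupI)
  fix x assume x: "x \<in> carrier (power_ring R S)"
  show "\<exists>y\<in>carrier (power_ring R S). y \<oplus>\<^bsub>power_ring R S\<^esub> x = \<zero>\<^bsub>power_ring R S\<^esub>"
    using x by (intro bexI[of _ "\<lambda>k\<in>S. \<ominus> x k"]) (auto simp: PiE_iff l_neg intro!: restrict_ext)
qed (auto simp: PiE_iff extensional_def fun_eq_iff a_ac)

lemma (in ring) power_ring_a_inv:
  assumes "x \<in> (\<Pi>\<^sub>E k\<in>S. carrier R)"
  shows "\<ominus>\<^bsub>power_ring R S\<^esub> x = (\<lambda>k\<in>S. \<ominus> x k)"
  by (rule abelian_group.minus_equality[OF abelian_group_power_ring])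
    (use assms in \<open>auto simp: PiE_iff l_neg intro!: restrict_ext\<close>)

text \<open>\<open>D\<close> is the group of allowed coordinates: all of \<open>A\<close> for \<open>X\<^sub>S(A)\<close>, the forms of degree \<open>q\<close> for the graded
objects.\<close>

locale coefficient_group = R: ring R for R :: "('b, 'm) ring_scheme" +
  fixes D :: "'b set"
  assumes D_subset: "D \<subseteq> carrier R"
    and D_zero: "\<zero>\<^bsub>R\<^esub> \<in> D"
    and D_diff: "\<lbrakk>a \<in> D; b \<in> D\<rbrakk> \<Longrightarrow> a \<ominus>\<^bsub>R\<^esub> b \<in> D"
begin

lemma D_closed: "a \<in> D \<Longrightarrow> a \<in> carrier R"
  using D_subset by (rule subsetD)

lemma closed_subgroup_iff:
  "closed_subgroup R D S H \<longleftrightarrow> H \<subseteq> (\<Pi>\<^sub>E k\<in>S. D) \<and> (\<lambda>k\<in>S. \<zero>\<^bsub>R\<^esub>) \<in> H \<and>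
    (\<forall>x\<in>H. \<forall>y\<in>H. (\<lambda>k\<in>S. x k \<ominus>\<^bsub>R\<^esub> y k) \<in> H) \<and>
    (\<forall>x\<in>\<Pi>\<^sub>E k\<in>S. D. (\<forall>K. finite K \<longrightarrow> K \<subseteq> S \<longrightarrow> (\<exists>h\<in>H. \<forall>k\<in>K. h k = x k)) \<longrightarrow> x \<in> H)"
proof (cases "H \<subseteq> (\<Pi>\<^sub>E k\<in>S. D)")
  case True
  interpret P: abelian_group "power_ring R S" by (rule R.abelian_group_power_ring)
  have H: "x \<in> (\<Pi>\<^sub>E k\<in>S. carrier R)" if "x \<in> H" for x
    using subsetD[OF True that] D_closed by (auto simp: PiE_iff)
  have minus: "x \<ominus>\<^bsub>power_ring R S\<^esub> y = (\<lambda>k\<in>S. x k \<ominus>\<^bsub>R\<^esub> y k)" if "x \<in> H" "y \<in> H" for x y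
    using H[OF that(2)] by (auto simp: a_minus_def R.power_ring_a_inv intro!: restrict_ext)
  have "additive_subgroup H (power_ring R S) \<longleftrightarrow> (\<lambda>k\<in>S. \<zero>\<^bsub>R\<^esub>) \<in> H \<and>
    (\<forall>x\<in>H. \<forall>y\<in>H. (\<lambda>k\<in>S. x k \<ominus>\<^bsub>R\<^esub> y k) \<in> H)" (is "_ \<longleftrightarrow> ?zero \<and> ?diff")
  proof
    assume "additive_subgroup H (power_ring R S)"
    then interpret H: additive_subgroup H "power_ring R S" .
    have "x \<ominus>\<^bsub>power_ring R S\<^esub> y \<in> H" if "x \<in> H" "y \<in> H" for x y
      unfolding a_minus_def using that by (intro H.a_closed H.a_inv_closed)
    then have ?diff using minus by simp
    moreover have ?zero
      using H.zero_closed by (simp only: power_ring_simps)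
    ultimately show "?zero \<and> ?diff" by (rule conjI[rotated])
  next
    assume a: "?zero \<and> ?diff"
    then have diff: "x \<ominus>\<^bsub>power_ring R S\<^esub> y \<in> H" if "x \<in> H" "y \<in> H" for x y
      using minus that by simp
    have zero: "\<zero>\<^bsub>power_ring R S\<^esub> \<in> H" using a by simp
    have inv: "\<ominus>\<^bsub>power_ring R S\<^esub> x \<in> H" if "x \<in> H" for x
      using diff[OF zero that] P.l_zero[OF P.a_inv_closed, of x] H[OF that]
      by (simp only: a_minus_def power_ring_simps(1))
    have add: "x \<oplus>\<^bsub>power_ring R S\<^esub> y \<in> H" if "x \<in> H" "y \<in> H" for x y
      using diff[OF that(1) inv[OF that(2)]] H[OF that(2)] 
      by (simp only: a_minus_def P.minus_minus power_ring_simps(1))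
    show "additive_subgroup H (power_ring R S)"
      by (intro additive_subgroup.intro group.subgroupI[OF P.a_group])
        (use H zero inv add in \<open>auto simp: a_inv_def simp del: power_ring_simps(2-)\<close>)

  qed
  then show ?thesis
    using True by (simp add: closed_subgroup_def closedin_power_topology_iff)
next
  case False
  then show ?thesis by (simp add: closed_subgroup_def closedin_power_topology_iff)
qed

lemma closed_subgroupD:
  assumes "closed_subgroup R D S H"
  shows "x \<in> H \<Longrightarrow> x \<in> (\<Pi>\<^sub>E k\<in>S. D)" "(\<lambda>k\<in>S. \<zero>\<^bsub>R\<^esub>) \<in> H"
    "\<lbrakk>x \<in> H; y \<in> H\<rbrakk> \<Longrightarrow> (\<lambda>k\<in>S. x k \<ominus>\<^bsub>R\<^esub> y k) \<in> H"
  using assms unfolding closed_subgroup_iff by auto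

lemma closed_subgroup_PiE:
  assumes "L \<subseteq> D" "\<zero>\<^bsub>R\<^esub> \<in> L" "\<And>a b. \<lbrakk>a \<in> L; b \<in> L\<rbrakk> \<Longrightarrow> a \<ominus>\<^bsub>R\<^esub> b \<in> L"
  shows "closed_subgroup R D S (\<Pi>\<^sub>E k\<in>S. L)"
  unfolding closed_subgroup_iff
proof (intro conjI ballI impI)
  fix x assume x: "x \<in> (\<Pi>\<^sub>E k\<in>S. D)"
    "\<forall>K. finite K \<longrightarrow> K \<subseteq> S \<longrightarrow> (\<exists>h\<in>\<Pi>\<^sub>E k\<in>S. L. \<forall>k\<in>K. h k = x k)"
  have "x k \<in> L" if "k \<in> S" for k
    using x(2)[rule_format, of "{k}"] that PiE_mem by fastforce
  then show "x \<in> (\<Pi>\<^sub>E k\<in>S. L)" using x(1) by (auto simp: PiE_iff)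
qed (use assms in \<open>auto simp: PiE_iff\<close>)

text \<open>The map \<open>x \<mapsto> (g\<^sub>k(x\<^bsub>s(k)\<^esub>))\<^sub>k\<close> is additive and continuous, since the values at finitely many places \<open>k\<close>
only depend on the finitely many coordinates \<open>s(k)\<close>.\<close>

lemma closed_subgroup_vimage:
  assumes H: "closed_subgroup R D S H" 
    and R': "coefficient_group R' D'"
    and s: "\<And>k. k \<in> S \<Longrightarrow> s k \<in> S'"
    and g: "\<And>k a. \<lbrakk>k \<in> S; a \<in> D'\<rbrakk> \<Longrightarrow> g k a \<in> D"
    and diff: "\<And>k a b. \<lbrakk>k \<in> S; a \<in> D'; b \<in> D'\<rbrakk> \<Longrightarrow> g k (a \<ominus>\<^bsub>R'\<^esub> b) = g k a \<ominus>\<^bsub>R\<^esub> g k b"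
  shows "closed_subgroup R' D' S' {x \<in> \<Pi>\<^sub>E k\<in>S'. D'. (\<lambda>k\<in>S. g k (x (s k))) \<in> H}"
proof -
  interpret R': coefficient_group R' D' by fact
  have zero: "g k \<zero>\<^bsub>R'\<^esub> = \<zero>\<^bsub>R\<^esub>" if "k \<in> S" for k
  proof -
    have "\<zero>\<^bsub>R'\<^esub> \<ominus>\<^bsub>R'\<^esub> \<zero>\<^bsub>R'\<^esub> = \<zero>\<^bsub>R'\<^esub>" by simp
    then show ?thesis
      using diff[OF that R'.D_zero R'.D_zero] D_closed[OF g[OF that R'.D_zero]]
      by (simp add: a_minus_def R.r_neg)
  qed
  show ?thesis
    unfolding R'.closed_subgroup_iff
  proof (intro conjI ballI impI)
    show "(\<lambda>k\<in>S'. \<zero>\<^bsub>R'\<^esub>) \<in> {x \<in> \<Pi>\<^sub>E k\<in>S'. D'. (\<lambda>k\<in>S. g k (x (s k))) \<in> H}"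
      using closed_subgroupD(2)[OF H] s R'.D_zero by (auto simp: zero cong: restrict_cong)
  next
    fix x y assume x: "x \<in> {x \<in> \<Pi>\<^sub>E k\<in>S'. D'. (\<lambda>k\<in>S. g k (x (s k))) \<in> H}"
      and y: "y \<in> {x \<in> \<Pi>\<^sub>E k\<in>S'. D'. (\<lambda>k\<in>S. g k (x (s k))) \<in> H}"
    have "(\<lambda>k\<in>S. (\<lambda>k\<in>S. g k (x (s k))) k \<ominus>\<^bsub>R\<^esub> (\<lambda>k\<in>S. g k (y (s k))) k) \<in> H"
      by (rule closed_subgroupD(3)[OF H]) (use x y in blast)+
    moreover have "g k ((\<lambda>k\<in>S'. x k \<ominus>\<^bsub>R'\<^esub> y k) (s k)) = g k (x (s k)) \<ominus>\<^bsub>R\<^esub> g k (y (s k))" if "k \<in> S" for k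
      using s[OF that] diff[OF that] PiE_mem[OF _ s[OF that]] x y by simp blast
    ultimately have "(\<lambda>k\<in>S. g k ((\<lambda>k\<in>S'. x k \<ominus>\<^bsub>R'\<^esub> y k) (s k))) \<in> H"
      by (simp cong: restrict_cong)
    then show "(\<lambda>k\<in>S'. x k \<ominus>\<^bsub>R'\<^esub> y k) \<in> {x \<in> \<Pi>\<^sub>E k\<in>S'. D'. (\<lambda>k\<in>S. g k (x (s k))) \<in> H}"
      using x y R'.D_diff by (auto simp: PiE_iff)
  next
    fix x assume x: "x \<in> (\<Pi>\<^sub>E k\<in>S'. D')"
      and app: "\<forall>K. finite K \<longrightarrow> K \<subseteq> S' \<longrightarrow>
        (\<exists>h\<in>{x \<in> \<Pi>\<^sub>E k\<in>S'. D'. (\<lambda>k\<in>S. g k (x (s k))) \<in> H}. \<forall>k\<in>K. h k = x k)"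
    have "\<exists>h\<in>H. \<forall>k\<in>K. h k = (\<lambda>k\<in>S. g k (x (s k))) k" if K: "finite K" "K \<subseteq> S" for K
    proof -
      have "s ` K \<subseteq> S'" using K s by auto
      then obtain h where "h \<in> {x \<in> \<Pi>\<^sub>E k\<in>S'. D'. (\<lambda>k\<in>S. g k (x (s k))) \<in> H}" "\<forall>k\<in>s ` K. h k = x k"
        using app K(1) by (elim allE[of _ "s ` K"] impE) auto
      then show ?thesis
        using K(2) by (intro bexI[of _ "\<lambda>k\<in>S. g k (h (s k))"]) auto
    qed
    moreover have "(\<lambda>k\<in>S. g k (x (s k))) \<in> (\<Pi>\<^sub>E k\<in>S. D)"
      using x s g by (auto simp: PiE_iff)
    ultimately have "(\<lambda>k\<in>S. g k (x (s k))) \<in> H"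
      using H unfolding closed_subgroup_iff by simp
    then show "x \<in> {x \<in> \<Pi>\<^sub>E k\<in>S'. D'. (\<lambda>k\<in>S. g k (x (s k))) \<in> H}" using x by simp
  qed auto
qed

lemma closed_hull_least: "\<lbrakk>closed_subgroup R D S H; G \<subseteq> H\<rbrakk> \<Longrightarrow> closed_hull R D S G \<subseteq> H"
  unfolding closed_hull_def by auto

lemma closed_hull_superset: "G \<subseteq> closed_hull R D S G"
  unfolding closed_hull_def by auto

lemma closed_subgroup_full: "closed_subgroup R D S (\<Pi>\<^sub>E k\<in>S. D)"
  by (rule closed_subgroup_PiE) (use D_zero D_diff in auto)

lemma closed_subgroup_Inter:
  assumes "\<H> \<noteq> {}" "\<And>H. H \<in> \<H> \<Longrightarrow> closed_subgroup R D S H"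
  shows "closed_subgroup R D S (\<Inter>\<H>)"
  unfolding closed_subgroup_iff
proof (intro conjI ballI impI)
  show "\<Inter>\<H> \<subseteq> (\<Pi>\<^sub>E k\<in>S. D)" 
    using assms(1) closed_subgroupD(1)[OF assms(2)] by (meson Inter_lower ex_in_conv subset_eq)
next
  fix x assume x: "x \<in> (\<Pi>\<^sub>E k\<in>S. D)"
    "\<forall>K. finite K \<longrightarrow> K \<subseteq> S \<longrightarrow> (\<exists>h\<in>\<Inter>\<H>. \<forall>k\<in>K. h k = x k)"
  have "x \<in> H" if "H \<in> \<H>" for H
  proof -
    have "\<exists>h\<in>H. \<forall>k\<in>K. h k = x k" if "finite K" "K \<subseteq> S" for K
      using x(2) that \<open>H \<in> \<H>\<close> by blast
    then show ?thesis
      using assms(2)[OF that] x(1) unfolding closed_subgroup_iff by simp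
  qed
  then show "x \<in> \<Inter>\<H>" by simp
qed (use assms(2) closed_subgroupD(2,3) in blast)+

lemma closed_subgroup_hull:
  assumes "G \<subseteq> (\<Pi>\<^sub>E k\<in>S. D)"
  shows "closed_subgroup R D S (closed_hull R D S G)"
  unfolding closed_hull_def
  by (rule closed_subgroup_Inter) (use closed_subgroup_full[of S] assms in auto)

end

context coefficient_group
begin

text \<open>The principle by which all statements about closed subgroups are reduced to generators.\<close>

lemma closed_hull_coordinatewise:
  assumes H: "closed_subgroup R D S H"
    and R': "coefficient_group R' D'"
    and s: "\<And>k. k \<in> S \<Longrightarrow> s k \<in> S'"
    and g: "\<And>k a. \<lbrakk>k \<in> S; a \<in> D'\<rbrakk> \<Longrightarrow> g k a \<in> D"
    and diff: "\<And>k a b. \<lbrakk>k \<in> S; a \<in> D'; b \<in> D'\<rbrakk> \<Longrightarrow> g k (a \<ominus>\<^bsub>R'\<^esub> b) = g k a \<ominus>\<^bsub>R\<^esub> g k b"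
    and gen: "G \<subseteq> (\<Pi>\<^sub>E k\<in>S'. D')" "\<And>x. x \<in> G \<Longrightarrow> (\<lambda>k\<in>S. g k (x (s k))) \<in> H"
    and x: "x \<in> closed_hull R' D' S' G"
  shows "(\<lambda>k\<in>S. g k (x (s k))) \<in> H"
proof -
  have "closed_hull R' D' S' G \<subseteq> {x \<in> \<Pi>\<^sub>E k\<in>S'. D'. (\<lambda>k\<in>S. g k (x (s k))) \<in> H}"
    by (intro coefficient_group.closed_hull_least[OF R'] closed_subgroup_vimage[where s = s and g = g, OF H R' s g diff])
      (use gen in auto)
  then show ?thesis using x by auto
qed

lemma nat_multiple_closed:
  fixes n :: nat
  assumes H: "closed_subgroup R D S H" and x: "x \<in> H"
  shows "(\<lambda>k\<in>S. [n] \<cdot>\<^bsub>R\<^esub> x k) \<in> H"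
proof (induction n)
  case 0
  have "(\<lambda>k\<in>S. [(0::nat)] \<cdot>\<^bsub>R\<^esub> x k) = (\<lambda>k\<in>S. \<zero>\<^bsub>R\<^esub>)"
    by (rule restrict_ext) simp
  then show ?case using closed_subgroupD(2)[OF H] by (simp only:)
next
  case (Suc n)
  have xD: "x k \<in> carrier R" if "k \<in> S" for k
    using closed_subgroupD(1)[OF H x] that D_closed by (auto simp: PiE_iff)
  have minus: "(\<lambda>k\<in>S. (\<lambda>k\<in>S. \<zero>\<^bsub>R\<^esub>) k \<ominus>\<^bsub>R\<^esub> x k) \<in> H"
    by (rule closed_subgroupD(3)[OF H closed_subgroupD(2)[OF H] x])
  have "(\<lambda>k\<in>S. [Suc n] \<cdot>\<^bsub>R\<^esub> x k) =
      (\<lambda>k\<in>S. (\<lambda>k\<in>S. [n] \<cdot>\<^bsub>R\<^esub> x k) k \<ominus>\<^bsub>R\<^esub> (\<lambda>k\<in>S. (\<lambda>k\<in>S. \<zero>\<^bsub>R\<^esub>) k \<ominus>\<^bsub>R\<^esub> x k) k)"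
    by (rule restrict_ext) (simp add: xD a_minus_def)
  then show ?case
    using closed_subgroupD(3)[OF H Suc minus] by (simp only:)
qed

text \<open>By Bezout an element is the difference of a multiple of \<open>p x\<close> and a multiple of \<open>q x\<close>.\<close>

lemma coprime_multiples:
  fixes p q :: nat
  assumes H: "closed_subgroup R D S H" and x: "x \<in> (\<Pi>\<^sub>E k\<in>S. D)" and "coprime p q" "p \<noteq> 0"
    and p: "(\<lambda>k\<in>S. [p] \<cdot>\<^bsub>R\<^esub> x k) \<in> H" and q: "(\<lambda>k\<in>S. [q] \<cdot>\<^bsub>R\<^esub> x k) \<in> H"
  shows "x \<in> H"
proof -
  obtain u v where uv: "p * u = q * v + 1"
    using bezout_nat[OF \<open>p \<noteq> 0\<close>, of q] \<open>coprime p q\<close> by (metis coprime_imp_gcd_eq_1)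
  have xD: "x k \<in> carrier R" if "k \<in> S" for k
    using x that D_closed by (auto simp: PiE_iff)
  have "[u] \<cdot>\<^bsub>R\<^esub> ([p] \<cdot>\<^bsub>R\<^esub> x k) \<ominus>\<^bsub>R\<^esub> [v] \<cdot>\<^bsub>R\<^esub> ([q] \<cdot>\<^bsub>R\<^esub> x k) = x k" if "k \<in> S" for k
  proof -
    have "[u] \<cdot>\<^bsub>R\<^esub> ([p] \<cdot>\<^bsub>R\<^esub> x k) = x k \<oplus>\<^bsub>R\<^esub> [v] \<cdot>\<^bsub>R\<^esub> ([q] \<cdot>\<^bsub>R\<^esub> x k)"
      using xD[OF that] uv by (simp add: R.add.nat_pow_pow mult.commute R.add.m_comm)
    then show ?thesis using xD[OF that] by (simp add: a_minus_def R.a_assoc R.r_neg)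
  qed
  moreover have "(\<lambda>k\<in>S. [u] \<cdot>\<^bsub>R\<^esub> ([p] \<cdot>\<^bsub>R\<^esub> x k) \<ominus>\<^bsub>R\<^esub> [v] \<cdot>\<^bsub>R\<^esub> ([q] \<cdot>\<^bsub>R\<^esub> x k)) \<in> H"
    using closed_subgroupD(3)[OF H nat_multiple_closed[OF H p, of u] nat_multiple_closed[OF H q, of v]]
    by (simp cong: restrict_cong)
  ultimately have "restrict x S \<in> H" by (simp cong: restrict_cong)
  then show ?thesis using x by (simp add: PiE_restrict)
qed

end

section \<open>Truncation sets and the groups \<open>X\<^sub>S(A)\<close> and \<open>X\<^sub>S(I)\<close>\<close>

lemma truncation_setD:
  assumes "truncation_set S"
  shows "k \<in> S \<Longrightarrow> 0 < k" "\<lbrakk>k \<in> S; n dvd k\<rbrakk> \<Longrightarrow> n \<in> S"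
  using assms by (auto simp: truncation_set_def)

lemma truncation_set_quot:
  assumes "truncation_set S" "n \<in> S"
  shows "truncation_set (trunc_quot S n)"
  unfolding truncation_set_def
proof (intro conjI ballI allI impI)
  show "trunc_quot S n \<noteq> {}"
    using assms(2) by (auto simp: trunc_quot_def intro!: exI[of _ 1])
next
  fix k assume k: "k \<in> trunc_quot S n"
  then show "0 < k" by (simp add: trunc_quot_def)
  fix j assume j: "j dvd k"
  then have "j * n dvd k * n" by simp
  then show "j \<in> trunc_quot S n"
    using truncation_setD(2)[OF assms(1), of "k * n" "j * n"] dvd_pos_nat[OF _ j] k
    by (simp add: trunc_quot_def)
qed

lemma div_mult_div_dvd:
  fixes n l k :: nat
  assumes "n dvd l" "l dvd k" "0 < l"
  shows "l div n * (k div l) = k div n"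
proof -
  obtain u v where "l = n * u" "k = l * v" using assms by (meson dvd_def)
  then show ?thesis using assms(3) by simp
qed

lemma gcd_decomposition:
  fixes n m :: nat
  assumes "0 < n" "0 < m"
  obtains g n' m' where "n = g * n'" "m = g * m'" "coprime n' m'" "0 < g" "0 < n'" "0 < m'"
proof -
  obtain n' m' where *: "n = n' * gcd n m" "m = m' * gcd n m" "coprime n' m'"
    using gcd_coprime_exists[of n m] assms(1) by auto
  show ?thesis
  proof (rule that)
    show "n = gcd n m * n'" "m = gcd n m * m'"
      by (subst mult.commute; rule *)+
    show "0 < n'" "0 < m'" using * assms by (auto intro!: Nat.gr0I)
  qed (use * assms in simp_all)
qed

lemma trunc_quot_div:
  assumes "truncation_set S" "k \<in> S" "n dvd k"
  shows "k div n \<in> trunc_quot S n"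
  using assms truncation_setD(1)[OF assms(1,2)] by (auto simp: trunc_quot_def)

text \<open>The element \<open>V\<^sub>n\<langle>a\<rangle>\<close>.  The formula also makes sense for \<open>n\<close> outside \<open>S\<close>, where it gives \<open>0\<close>; this saves
distinctions of cases when \<open>n\<close> is a least common multiple.\<close>

definition ver_gen :: "('a, 'm) ring_scheme \<Rightarrow> nat set \<Rightarrow> nat \<Rightarrow> 'a \<Rightarrow> nat \<Rightarrow> 'a" where
  "ver_gen A S n a = (\<lambda>k\<in>S. if n dvd k then [n] \<cdot>\<^bsub>A\<^esub> (a [^]\<^bsub>A\<^esub> (k div n)) else \<zero>\<^bsub>A\<^esub>)"

lemma verschiebung_angle:
  assumes "truncation_set S"
  shows "verschiebung A S n (angle A (trunc_quot S n) a) = ver_gen A S n a"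
  unfolding verschiebung_def ver_gen_def angle_def
  by (rule restrict_ext) (simp add: trunc_quot_div[OF assms])

text \<open>The shape required by \<open>closed_subgroup_vimage\<close>; at places \<open>k\<close> that \<open>n\<close> does not divide, the index \<open>1\<close> serves as a default
because it lies in every truncation set.\<close>

lemma verschiebung_coordinatewise:
  "verschiebung R S n x =
    (\<lambda>k\<in>S. (if n dvd k then [n] \<cdot>\<^bsub>R\<^esub> x (if n dvd k then k div n else 1) else \<zero>\<^bsub>R\<^esub>))"
  by (auto simp: verschiebung_def)

context cring
begin

sublocale whole: coefficient_group R "carrier R"
  by unfold_locales (auto simp: minus_closed)

lemma X0_eq_hull:
  assumes "truncation_set S"
  shows "X0 R S D = closed_hull R (carrier R) S {ver_gen R S n a | n a. n \<in> S \<and> a \<in> D}"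
  unfolding X0_def closed_hull_def closed_subgroup_def verschiebung_angle[OF assms] conj_assoc ..

lemma ver_gen_closed: "a \<in> carrier R \<Longrightarrow> ver_gen R S n a \<in> (\<Pi>\<^sub>E k\<in>S. carrier R)"
  by (auto simp: ver_gen_def)

lemma generators_closed:
  "D \<subseteq> carrier R \<Longrightarrow> {ver_gen R S n a | n a. n \<in> S \<and> a \<in> D} \<subseteq> (\<Pi>\<^sub>E k\<in>S. carrier R)"
  using ver_gen_closed by (intro subsetI) (elim CollectE exE conjE, simp only: subset_eq)

lemma closed_subgroup_X0:
  assumes "truncation_set S" "D \<subseteq> carrier R"
  shows "closed_subgroup R (carrier R) S (X0 R S D)"
  unfolding X0_eq_hull[OF assms(1)] by (intro whole.closed_subgroup_hull generators_closed assms(2))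

lemma X0_mono:
  assumes "truncation_set S" "D \<subseteq> D'" "D' \<subseteq> carrier R"
  shows "X0 R S D \<subseteq> X0 R S D'"
  unfolding X0_eq_hull[OF assms(1)]
  by (intro whole.closed_hull_least whole.closed_subgroup_hull generators_closed assms(3)
      order_trans[OF _ whole.closed_hull_superset]) (use assms(2) in auto)

lemma ver_gen_X0:
  assumes S: "truncation_set S" and "D \<subseteq> carrier R" "0 < n" "a \<in> D"
  shows "ver_gen R S n a \<in> X0 R S D"
proof (cases "n \<in> S")
  case True
  then show ?thesis
    unfolding X0_eq_hull[OF S]
    by (intro subsetD[OF whole.closed_hull_superset]) (use \<open>a \<in> D\<close> in auto)
next
  case False
  then have "ver_gen R S n a = (\<lambda>k\<in>S. \<zero>)"
    using truncation_setD(2)[OF S] by (auto simp: ver_gen_def intro!: restrict_ext)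
  then show ?thesis
    using whole.closed_subgroupD(2)[OF closed_subgroup_X0[OF S assms(2)]] by simp
qed

lemma X0_coordinatewise:
  assumes S: "truncation_set S'" and D: "D \<subseteq> carrier R"
    and R': "coefficient_group R' D'" and H: "closed_subgroup R' D' S H"
    and s: "\<And>k. k \<in> S \<Longrightarrow> s k \<in> S'"
    and g: "\<And>k a. \<lbrakk>k \<in> S; a \<in> carrier R\<rbrakk> \<Longrightarrow> g k a \<in> D'"
    and diff: "\<And>k a b. \<lbrakk>k \<in> S; a \<in> carrier R; b \<in> carrier R\<rbrakk> \<Longrightarrow> g k (a \<ominus> b) = g k a \<ominus>\<^bsub>R'\<^esub> g k b"
    and gen: "\<And>n a. \<lbrakk>n \<in> S'; a \<in> D\<rbrakk> \<Longrightarrow> (\<lambda>k\<in>S. g k (ver_gen R S' n a (s k))) \<in> H"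
    and x: "x \<in> X0 R S' D"
  shows "(\<lambda>k\<in>S. g k (x (s k))) \<in> H"
  by (rule coefficient_group.closed_hull_coordinatewise[where s = s and g = g, OF R' H whole.coefficient_group_axioms s g diff
      generators_closed[OF D] _ x[unfolded X0_eq_hull[OF S]]]) (use gen in auto)

text \<open>\<open>V\<^sub>n\<langle>a\<rangle> V\<^sub>m\<langle>b\<rangle> = gcd(n,m) V\<^sub>l\<langle>a\<^bsup>l/n\<^esup> b\<^bsup>l/m\<^esup>\<rangle>\<close> with \<open>l = lcm(n,m)\<close>: both sides live at the multiples of \<open>l\<close>,
and \<open>n m = gcd(n,m) l\<close>.\<close>

lemma ver_gen_mult:
  assumes "truncation_set S" "a \<in> carrier R" "b \<in> carrier R" "0 < n" "0 < m" "k \<in> S"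
  shows "ver_gen R S n a k \<otimes> ver_gen R S m b k =
    [gcd n m] \<cdot> ver_gen R S (lcm n m) (a [^] (lcm n m div n) \<otimes> b [^] (lcm n m div m)) k"
proof (cases "lcm n m dvd k")
  case True
  then have d: "n dvd k" "m dvd k" by (auto dest: lcm_dvdD1 lcm_dvdD2)
  let ?l = "lcm n m"
  have "?l div n * (k div ?l) = k div n" "?l div m * (k div ?l) = k div m"
    using True assms by (simp_all add: div_mult_div_dvd lcm_pos_nat)
  moreover have "gcd n m * ?l = n * m" by (rule prod_gcd_lcm_nat[symmetric])
  ultimately show ?thesis
    using assms True d
    by (simp add: ver_gen_def nat_pow_distrib nat_pow_pow add_pow_ldistr add_pow_rdistr add.nat_pow_pow
        mult.commute)
next
  case False
  then have "\<not> (n dvd k \<and> m dvd k)" by (auto intro: lcm_least)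
  then show ?thesis using False assms by (auto simp: ver_gen_def)
qed

lemma X0_mult:
  assumes S: "truncation_set S" and D: "ideal D R"
    and x: "x \<in> X0 R S (carrier R)" and y: "y \<in> X0 R S D"
  shows "(\<lambda>k\<in>S. x k \<otimes> y k) \<in> X0 R S D"
proof -
  interpret D: ideal D R by fact
  have sub: "D \<subseteq> carrier R" by (rule D.a_subset)
  note H = closed_subgroup_X0[OF S sub]
  have yc: "y k \<in> carrier R" if "k \<in> S" for k
    using whole.closed_subgroupD(1)[OF H y] that by auto
  note pow = ideal_pow_closed[OF D]
  have gen: "(\<lambda>k\<in>S. ver_gen R S n a k \<otimes> ver_gen R S m b k) \<in> X0 R S D"
    if "n \<in> S" "a \<in> carrier R" "m \<in> S" "b \<in> D" for n a m b
  proof -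
    have nm: "0 < n" "0 < m" using that truncation_setD(1)[OF S] by auto
    have "0 < lcm n m div m" using nm by (simp add: div_greater_zero_iff dvd_imp_le lcm_pos_nat)
    then have "a [^] (lcm n m div n) \<otimes> b [^] (lcm n m div m) \<in> D"
      using that pow by (intro D.I_l_closed) auto
    then have "ver_gen R S (lcm n m) (a [^] (lcm n m div n) \<otimes> b [^] (lcm n m div m)) \<in> X0 R S D"
      using nm by (intro ver_gen_X0 S sub) (simp_all add: lcm_pos_nat)
    from whole.nat_multiple_closed[OF H this, of "gcd n m"] show ?thesis
      using that(2,4) nm sub ver_gen_mult[OF S that(2) _ nm, of b] by (auto cong: restrict_cong)
  qed
  have "(\<lambda>k\<in>S. ver_gen R S n a k \<otimes> y k) \<in> X0 R S D" if n: "n \<in> S" "a \<in> carrier R" for n a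
    by (rule X0_coordinatewise[where S' = S and S = S and s = "\<lambda>k. k" and
          g = "\<lambda>k b. ver_gen R S n a k \<otimes> b", OF S sub whole.coefficient_group_axioms H])
      (use gen[OF n] y PiE_mem[OF ver_gen_closed[OF n(2)]] in \<open>auto simp: mult_minus_distrib\<close>)
  note gen_y = this
  show ?thesis
    by (rule X0_coordinatewise[where S' = S and S = S and s = "\<lambda>k. k" and g = "\<lambda>k a. a \<otimes> y k",
          OF S subset_refl whole.coefficient_group_axioms H _ _ _ _ x])
      (use gen_y yc in \<open>simp_all add: mult_minus_distrib\<close>)
qed

lemma X0_one:
  assumes "truncation_set S"
  shows "(\<lambda>k\<in>S. \<one>) \<in> X0 R S (carrier R)"
  using ver_gen_X0[OF assms subset_refl, of 1 \<one>] by (simp add: ver_gen_def)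

text \<open>\<open>F\<^sub>m V\<^sub>n\<langle>a\<rangle> = g V\<^bsub>n'\<^esub>\<langle>a\<^bsup>m'\<^esup>\<rangle>\<close> with \<open>g = gcd(n,m)\<close>, \<open>n = g n'\<close> and \<open>m = g m'\<close>.\<close>

lemma X0_frobenius:
  assumes S: "truncation_set S" and D: "ideal D R" and m: "m \<in> S" and x: "x \<in> X0 R S D"
  shows "frobenius S m x \<in> X0 R (trunc_quot S m) D"
proof -
  interpret D: ideal D R by fact
  have sub: "D \<subseteq> carrier R" by (rule D.a_subset)
  note S' = truncation_set_quot[OF S m]
  note H = closed_subgroup_X0[OF S' sub]
  note pow = ideal_pow_closed[OF D]
  show ?thesis
    unfolding frobenius_def
  proof (rule X0_coordinatewise[OF S sub whole.coefficient_group_axioms H _ _ _ _ x,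
        of "\<lambda>k. k * m" "\<lambda>k a. a"])
    fix n a assume n: "n \<in> S" and a: "a \<in> D"
    obtain g n' m' where nm: "n = g * n'" "m = g * m'" "coprime n' m'" and pos: "0 < g" "0 < n'" "0 < m'"
      using gcd_decomposition[of n m] truncation_setD(1)[OF S n] truncation_setD(1)[OF S m] by metis
    have "[g] \<cdot> ver_gen R (trunc_quot S m) n' (a [^] m') k = ver_gen R S n a (k * m)"
      if k: "k \<in> trunc_quot S m" for k
    proof -
      have dvd: "n dvd k * m \<longleftrightarrow> n' dvd k"
        using nm pos by (simp add: coprime_dvd_mult_left_iff mult.left_commute)
      have div: "k * m div n = m' * (k div n')" if n': "n' dvd k"
      proof -
        obtain v where v: "k = n' * v" using n' by (rule dvdE)
        have eq: "k * m = n * (m' * v)" by (simp add: nm(1,2) v)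
        have "k * m div n = m' * v" unfolding eq using pos nm(1) by simp
        moreover have "k div n' = v" unfolding v using pos by simp
        ultimately show ?thesis by simp
      qed
      have "[g] \<cdot> ([n'] \<cdot> z) = [n] \<cdot> z" if "z \<in> carrier R" for z
        using that unfolding nm(1) by (simp add: add.nat_pow_pow mult.commute)
      then show ?thesis
        using k a sub dvd div by (auto simp: ver_gen_def trunc_quot_def nat_pow_pow)
    qed
    then have "(\<lambda>k\<in>trunc_quot S m. ver_gen R S n a (k * m)) =
        (\<lambda>k\<in>trunc_quot S m. [g] \<cdot> ver_gen R (trunc_quot S m) n' (a [^] m') k)"
      by (intro restrict_ext) simp
    moreover have "ver_gen R (trunc_quot S m) n' (a [^] m') \<in> X0 R (trunc_quot S m) D"
      by (intro ver_gen_X0 S' sub pow a pos)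
    ultimately show "(\<lambda>k\<in>trunc_quot S m. ver_gen R S n a (k * m)) \<in> X0 R (trunc_quot S m) D"
      using whole.nat_multiple_closed[OF H, of _ g] by simp
  qed (auto simp: trunc_quot_def)
qed

text \<open>\<open>V\<^sub>n V\<^sub>m\<langle>a\<rangle> = V\<^bsub>n m\<^esub>\<langle>a\<rangle>\<close>.\<close>

lemma X0_verschiebung:
  assumes S: "truncation_set S" and D: "D \<subseteq> carrier R" and n: "n \<in> S"
    and x: "x \<in> X0 R (trunc_quot S n) D"
  shows "verschiebung R S n x \<in> X0 R S D"
proof -
  note S' = truncation_set_quot[OF S n]
  show ?thesis
    unfolding verschiebung_coordinatewise
  proof (rule X0_coordinatewise[OF S' D whole.coefficient_group_axioms closed_subgroup_X0[OF S D] _ _ _ _ x,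
        where g = "\<lambda>k a. if n dvd k then [n] \<cdot> a else \<zero>" and s = "\<lambda>k. if n dvd k then k div n else 1"])
    show "(if n dvd k then k div n else 1) \<in> trunc_quot S n" if "k \<in> S" for k
      using that n trunc_quot_div[OF S that] by (simp add: trunc_quot_def)
    show "(if n dvd k then [n] \<cdot> (a \<ominus> b) else \<zero>) =
        (if n dvd k then [n] \<cdot> a else \<zero>) \<ominus> (if n dvd k then [n] \<cdot> b else \<zero>)"
      if "a \<in> carrier R" "b \<in> carrier R" for k a b
      using that by (simp add: a_minus_def add.nat_pow_distrib add.nat_pow_inv)
    fix m a assume m: "m \<in> trunc_quot S n" and a: "a \<in> D"
    have mn: "0 < n" "0 < m" using n m truncation_setD(1)[OF S n] by (auto simp: trunc_quot_def)
    have "(if n dvd k then [n] \<cdot> ver_gen R (trunc_quot S n) m a (if n dvd k then k div n else 1) else \<zero>) =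
        ver_gen R S (n * m) a k" if k: "k \<in> S" for k
    proof -
      have "n * m dvd k \<longleftrightarrow> n dvd k \<and> m dvd k div n"
      proof (cases "n dvd k")
        case True
        then obtain c where "k = n * c" by (rule dvdE)
        then show ?thesis using mn by simp
      next
        case False
        then show ?thesis by (auto dest: dvd_mult_left)
      qed
      moreover have "k div (m * n) = k div n div m"
        by (subst mult.commute) (rule div_mult2_eq)
      ultimately show ?thesis
        using k a D trunc_quot_div[OF S k]
        by (auto simp: ver_gen_def add.nat_pow_pow mult.commute)
    qed
    moreover have "ver_gen R S (n * m) a \<in> X0 R S D"
      using mn by (intro ver_gen_X0 S D a) simp
    ultimately show "(\<lambda>k\<in>S. if n dvd k then [n] \<cdot> ver_gen R (trunc_quot S n) m a (if n dvd k then k div n else 1)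
        else \<zero>) \<in> X0 R S D"
      by (simp add: ver_gen_def cong: restrict_cong)
  qed auto
qed

end

section \<open>Generating the forms degree by degree\<close>

lemma additive_subgroup_extend:
  "additive_subgroup H (ring.extend R m) \<longleftrightarrow> additive_subgroup H R"
  by (simp add: additive_subgroup_def subgroup_def ring.defs m_inv_def)

context dg_algebra
begin

lemma coefficient_group_homog: "coefficient_group B (homog B q)"
  by unfold_locales (simp_all add: homog_subset homog_zero homog_diff)

lemma const_diff: "\<lbrakk>a \<in> carrier A; b \<in> carrier A\<rbrakk> \<Longrightarrow> c (a \<ominus>\<^bsub>A\<^esub> b) = c a \<ominus>\<^bsub>B\<^esub> c b"
proof -
  interpret ring_hom_ring A B c
    by (intro ring_hom_ringI2 A.ring_axioms B.ring_axioms const_hom)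
  show "\<lbrakk>a \<in> carrier A; b \<in> carrier A\<rbrakk> \<Longrightarrow> c (a \<ominus>\<^bsub>A\<^esub> b) = c a \<ominus>\<^bsub>B\<^esub> c b"
    by (simp add: a_minus_def)
qed

lemma const_simps:
  fixes n :: nat
  assumes "a \<in> carrier A"
  shows const_mult: "b \<in> carrier A \<Longrightarrow> c (a \<otimes>\<^bsub>A\<^esub> b) = c a \<otimes>\<^bsub>B\<^esub> c b"
    and const_one: "c \<one>\<^bsub>A\<^esub> = \<one>\<^bsub>B\<^esub>"
    and const_zero: "c \<zero>\<^bsub>A\<^esub> = \<zero>\<^bsub>B\<^esub>"
    and const_nat: "c ([n] \<cdot>\<^bsub>A\<^esub> a) = [n] \<cdot>\<^bsub>B\<^esub> c a"
proof -
  interpret ring_hom_ring A B c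
    by (intro ring_hom_ringI2 A.ring_axioms B.ring_axioms const_hom)
  show "b \<in> carrier A \<Longrightarrow> c (a \<otimes>\<^bsub>A\<^esub> b) = c a \<otimes>\<^bsub>B\<^esub> c b" using assms by simp
  show "c \<one>\<^bsub>A\<^esub> = \<one>\<^bsub>B\<^esub>" "c \<zero>\<^bsub>A\<^esub> = \<zero>\<^bsub>B\<^esub>" by simp_all
  show "c ([n] \<cdot>\<^bsub>A\<^esub> a) = [n] \<cdot>\<^bsub>B\<^esub> c a"
    using assms by (induction n) simp_all
qed

lemma d_nat:
  fixes n :: nat
  shows "x \<in> carrier B \<Longrightarrow> differential B ([n] \<cdot>\<^bsub>B\<^esub> x) = [n] \<cdot>\<^bsub>B\<^esub> differential B x"
  by (induction n) (simp_all add: d_add d_closed)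

lemma d_const_one: "differential B (c \<one>\<^bsub>A\<^esub>) = \<zero>\<^bsub>B\<^esub>"
proof -
  have "differential B (c \<one>\<^bsub>A\<^esub>) = differential B (c \<one>\<^bsub>A\<^esub>) \<oplus>\<^bsub>B\<^esub> differential B (c \<one>\<^bsub>A\<^esub>)"
    using d_const_mult[of "\<one>\<^bsub>A\<^esub>" "\<one>\<^bsub>A\<^esub>"] const_one[of "\<one>\<^bsub>A\<^esub>"] d_closed[of "\<one>\<^bsub>B\<^esub>"] by simp
  then show ?thesis using d_closed[of "c \<one>\<^bsub>A\<^esub>"] by simp
qed

lemma d_const_pow:
  fixes n :: nat
  assumes "a \<in> carrier A"
  shows "differential B (c (a [^]\<^bsub>A\<^esub> n)) = [n] \<cdot>\<^bsub>B\<^esub> (c (a [^]\<^bsub>A\<^esub> (n - 1)) \<otimes>\<^bsub>B\<^esub> differential B (c a))"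
proof (induction n)
  case 0
  then show ?case by (simp add: d_const_one)
next
  case (Suc n)
  note da = d_closed[OF const_closed[OF assms]]
  have "c a \<otimes>\<^bsub>B\<^esub> ([n] \<cdot>\<^bsub>B\<^esub> (c (a [^]\<^bsub>A\<^esub> (n - 1)) \<otimes>\<^bsub>B\<^esub> differential B (c a))) =
      [n] \<cdot>\<^bsub>B\<^esub> (c (a [^]\<^bsub>A\<^esub> n) \<otimes>\<^bsub>B\<^esub> differential B (c a))"
  proof (cases n)
    case (Suc k)
    have pow: "c a \<otimes>\<^bsub>B\<^esub> c (a [^]\<^bsub>A\<^esub> k) = c (a [^]\<^bsub>A\<^esub> n)"
      using assms Suc by (simp add: A.m_comm flip: const_mult)
    have "c a \<otimes>\<^bsub>B\<^esub> ([n] \<cdot>\<^bsub>B\<^esub> (c (a [^]\<^bsub>A\<^esub> k) \<otimes>\<^bsub>B\<^esub> differential B (c a))) =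
        [n] \<cdot>\<^bsub>B\<^esub> ((c a \<otimes>\<^bsub>B\<^esub> c (a [^]\<^bsub>A\<^esub> k)) \<otimes>\<^bsub>B\<^esub> differential B (c a))"
      using assms da by (simp add: B.add_pow_rdistr B.m_assoc)
    moreover have "n - 1 = k" using Suc by simp
    ultimately show ?thesis by (simp only: pow)
  qed (use assms da in simp)
  then show ?case
    using assms da Suc.IH by (simp add: d_const_mult B.add.m_comm)
qed

end

context rational_dg_algebra
begin

abbreviation const where "const a \<equiv> tensor B (c a) 1"

abbreviation dW where "dW \<equiv> differential W"

abbreviation hom_power where "hom_power S q \<equiv> (\<Pi>\<^sub>E k\<in>S. homog W q)"

abbreviation closed_span where "closed_span S q \<equiv> closed_hull W (homog W q) S"

abbreviation closed_in_degree where "closed_in_degree S q \<equiv> closed_subgroup W (homog W q) S"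

definition emb :: "nat set \<Rightarrow> (nat \<Rightarrow> 'a) \<Rightarrow> nat \<Rightarrow> ('b \<times> rat \<Rightarrow>\<^sub>0 int) set" where
  "emb S x = (\<lambda>k\<in>S. const (x k))"

definition dl :: "nat set \<Rightarrow> (nat \<Rightarrow> ('b \<times> rat \<Rightarrow>\<^sub>0 int) set) \<Rightarrow> nat \<Rightarrow> ('b \<times> rat \<Rightarrow>\<^sub>0 int) set" where
  "dl S x = (\<lambda>k\<in>S. scalar (inverse (of_nat k)) \<otimes>\<^bsub>W\<^esub> dW (x k))"

definition times :: "nat set \<Rightarrow> (nat \<Rightarrow> ('b \<times> rat \<Rightarrow>\<^sub>0 int) set) \<Rightarrow> (nat \<Rightarrow> ('b \<times> rat \<Rightarrow>\<^sub>0 int) set) \<Rightarrow>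
    nat \<Rightarrow> ('b \<times> rat \<Rightarrow>\<^sub>0 int) set" where
  "times S x y = (\<lambda>k\<in>S. x k \<otimes>\<^bsub>W\<^esub> y k)"

text \<open>\<open>D\<close> is \<open>carrier A\<close> for \<open>X\<^sub>S\<^sup>\<bullet>(A)\<close> (then the two families of generators agree) and \<open>I\<close> for \<open>X\<^sub>S\<^sup>\<bullet>(I,A)\<close>, so that both
cases are treated at once.  The degree comes first and the recursion is on functions, because the recursive
calls use two different sets \<open>D\<close>.\<close>

primrec graded_forms :: "nat \<Rightarrow> nat set \<Rightarrow> 'a set \<Rightarrow> (nat \<Rightarrow> ('b \<times> rat \<Rightarrow>\<^sub>0 int) set) set" where
  "graded_forms 0 = (\<lambda>S D. closed_span S 0 (emb S ` X0 A S D))"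
| "graded_forms (Suc q) = (\<lambda>S D. closed_span S (Suc q)
    ({times S (dl S (emb S a)) w | a w. a \<in> X0 A S (carrier A) \<and> w \<in> graded_forms q S D} \<union>
     {times S (dl S (emb S x)) w | x w. x \<in> X0 A S D \<and> w \<in> graded_forms q S (carrier A)}))"

abbreviation forms where "forms S D q \<equiv> graded_forms q S D"

lemma coefficient_group_W: "coefficient_group W (homog W q)"
  by (rule W.coefficient_group_homog)

lemma X0_D:
  assumes "truncation_set S" "D \<subseteq> carrier A" "x \<in> X0 A S D"
  shows "x \<in> (\<Pi>\<^sub>E k\<in>S. carrier A)"
  by (rule A.whole.closed_subgroupD(1)[OF A.closed_subgroup_X0[OF assms(1,2)] assms(3)])

lemma dl_homog: "x \<in> hom_power S q \<Longrightarrow> dl S x \<in> hom_power S (Suc q)"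
  by (auto simp: dl_def intro!: scalar_homog W.d_homog)

lemma emb_homog: "x \<in> (\<Pi>\<^sub>E k\<in>S. carrier A) \<Longrightarrow> emb S x \<in> hom_power S 0"
  by (auto simp: emb_def intro!: W.const_homog)

lemma times_homog: "\<lbrakk>x \<in> hom_power S p; y \<in> hom_power S q\<rbrakk> \<Longrightarrow> times S x y \<in> hom_power S (p + q)"
  by (auto simp: times_def intro!: W.homog_mult)

lemma times_homog_Suc: "\<lbrakk>x \<in> hom_power S 1; y \<in> hom_power S q\<rbrakk> \<Longrightarrow> times S x y \<in> hom_power S (Suc q)"
  using times_homog[of x S 1 y q] by simp

lemma closed_forms:
  assumes "truncation_set S" "D \<subseteq> carrier A"
  shows "closed_in_degree S q (forms S D q)"
  using assms(2)
proof (induction q arbitrary: D)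
  case 0
  then show ?case
    unfolding graded_forms.simps
    by (intro coefficient_group.closed_subgroup_hull[OF coefficient_group_W] image_subsetI emb_homog
        X0_D[OF assms(1)])
next
  case (Suc q)
  note IH = coefficient_group.closed_subgroupD(1)[OF coefficient_group_W Suc.IH]
  note dla = dl_homog[OF emb_homog[OF X0_D[OF assms(1)]], folded One_nat_def]
  show ?case
    unfolding graded_forms.simps
    by (intro coefficient_group.closed_subgroup_hull[OF coefficient_group_W] Un_least subsetI;
        elim CollectE exE conjE; simp only:; intro times_homog_Suc dla IH; (assumption | rule subset_refl Suc.prems))
qed

lemma forms_homog:
  "\<lbrakk>truncation_set S; D \<subseteq> carrier A; w \<in> forms S D q\<rbrakk> \<Longrightarrow> w \<in> hom_power S q"
  by (rule coefficient_group.closed_subgroupD(1)[OF coefficient_group_W closed_forms])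

lemma forms_gen_0: "x \<in> X0 A S D \<Longrightarrow> emb S x \<in> forms S D 0"
  unfolding graded_forms.simps
  by (rule subsetD[OF coefficient_group.closed_hull_superset[OF coefficient_group_W]]) (rule imageI)

lemma forms_gen_1:
  "\<lbrakk>a \<in> X0 A S (carrier A); w \<in> forms S D q\<rbrakk> \<Longrightarrow> times S (dl S (emb S a)) w \<in> forms S D (Suc q)"
  unfolding graded_forms.simps
  by (rule subsetD[OF coefficient_group.closed_hull_superset[OF coefficient_group_W]])
    (rule UnI1, rule CollectI, rule exI[of _ a], rule exI[of _ w], simp)

lemma forms_gen_2:
  "\<lbrakk>x \<in> X0 A S D; w \<in> forms S (carrier A) q\<rbrakk> \<Longrightarrow> times S (dl S (emb S x)) w \<in> forms S D (Suc q)"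
  unfolding graded_forms.simps
  by (rule subsetD[OF coefficient_group.closed_hull_superset[OF coefficient_group_W]])
    (rule UnI2, rule CollectI, rule exI[of _ x], rule exI[of _ w], simp)

lemma forms_coordinatewise:
  assumes S': "truncation_set S'" "D \<subseteq> carrier A"
    and H: "closed_in_degree S p H"
    and s: "\<And>k. k \<in> S \<Longrightarrow> s k \<in> S'"
    and g: "\<And>k a. \<lbrakk>k \<in> S; a \<in> homog W q\<rbrakk> \<Longrightarrow> g k a \<in> homog W p"
    and diff: "\<And>k a b. \<lbrakk>k \<in> S; a \<in> homog W q; b \<in> homog W q\<rbrakk> \<Longrightarrow> g k (a \<ominus>\<^bsub>W\<^esub> b) = g k a \<ominus>\<^bsub>W\<^esub> g k b"
    and gen0: "\<And>x. \<lbrakk>q = 0; x \<in> X0 A S' D\<rbrakk> \<Longrightarrow> (\<lambda>k\<in>S. g k (emb S' x (s k))) \<in> H"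
    and gen1: "\<And>r a w. \<lbrakk>q = Suc r; a \<in> X0 A S' (carrier A); w \<in> forms S' D r\<rbrakk> \<Longrightarrow>
      (\<lambda>k\<in>S. g k (times S' (dl S' (emb S' a)) w (s k))) \<in> H"
    and gen2: "\<And>r x w. \<lbrakk>q = Suc r; x \<in> X0 A S' D; w \<in> forms S' (carrier A) r\<rbrakk> \<Longrightarrow>
      (\<lambda>k\<in>S. g k (times S' (dl S' (emb S' x)) w (s k))) \<in> H"
    and w: "w \<in> forms S' D q"
  shows "(\<lambda>k\<in>S. g k (w (s k))) \<in> H"
proof (cases q)
  case 0
  have G: "emb S' ` X0 A S' D \<subseteq> hom_power S' 0"
    by (intro image_subsetI emb_homog X0_D[OF S'])
  have gen: "(\<lambda>k\<in>S. g k (y (s k))) \<in> H" if y: "y \<in> emb S' ` X0 A S' D" for y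
    using y by (rule imageE) (simp only: gen0[OF 0])
  show ?thesis
    by (rule coefficient_group.closed_hull_coordinatewise[where s = s and g = g, OF coefficient_group_W H
          coefficient_group_W s g[unfolded 0] diff[unfolded 0] G gen w[unfolded 0 graded_forms.simps]])
next
  case (Suc r)
  let ?G = "{times S' (dl S' (emb S' a)) w | a w. a \<in> X0 A S' (carrier A) \<and> w \<in> forms S' D r} \<union>
     {times S' (dl S' (emb S' x)) w | x w. x \<in> X0 A S' D \<and> w \<in> forms S' (carrier A) r}"
  have G: "?G \<subseteq> hom_power S' (Suc r)"
    by (intro Un_least subsetI forms_homog[OF S']; elim CollectE exE conjE; simp only: forms_gen_1 forms_gen_2)
  have gen: "(\<lambda>k\<in>S. g k (y (s k))) \<in> H" if y: "y \<in> ?G" for y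
    using y by (elim UnE CollectE exE conjE) (simp_all only: gen1[OF Suc] gen2[OF Suc])
  show ?thesis
    by (rule coefficient_group.closed_hull_coordinatewise[where s = s and g = g, OF coefficient_group_W H
          coefficient_group_W s g[unfolded Suc] diff[unfolded Suc] G gen w[unfolded Suc graded_forms.simps]])
qed

lemma forms_times_left:
  assumes "truncation_set S" "D \<subseteq> carrier A" "closed_in_degree S (p + q) H" and x: "x \<in> hom_power S p"
    and gen0: "\<And>y. \<lbrakk>q = 0; y \<in> X0 A S D\<rbrakk> \<Longrightarrow> times S x (emb S y) \<in> H"
    and gen1: "\<And>r a w. \<lbrakk>q = Suc r; a \<in> X0 A S (carrier A); w \<in> forms S D r\<rbrakk> \<Longrightarrow>
      times S x (times S (dl S (emb S a)) w) \<in> H"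
    and gen2: "\<And>r y w. \<lbrakk>q = Suc r; y \<in> X0 A S D; w \<in> forms S (carrier A) r\<rbrakk> \<Longrightarrow>
      times S x (times S (dl S (emb S y)) w) \<in> H"
    and w: "w \<in> forms S D q"
  shows "times S x w \<in> H"
  unfolding times_def
proof (rule forms_coordinatewise[where s = "\<lambda>k. k" and g = "\<lambda>k b. x k \<otimes>\<^bsub>W\<^esub> b", OF assms(1,2,3) _ _ _ _ _ _ w])
  show "x k \<otimes>\<^bsub>W\<^esub> a \<in> homog W (p + q)" if "k \<in> S" "a \<in> homog W q" for k a
    using W.homog_mult PiE_mem[OF x that(1)] that(2) .
  show "x k \<otimes>\<^bsub>W\<^esub> (a \<ominus>\<^bsub>W\<^esub> b) = x k \<otimes>\<^bsub>W\<^esub> a \<ominus>\<^bsub>W\<^esub> x k \<otimes>\<^bsub>W\<^esub> b"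
    if "k \<in> S" "a \<in> homog W q" "b \<in> homog W q" for k a b
    using W.homog_closed[OF PiE_mem[OF x that(1)]] that(2,3) by (simp add: W.B.mult_minus_distrib)
qed (use gen0 gen1 gen2 in \<open>simp_all add: times_def\<close>)

lemma forms_times_right:
  assumes "truncation_set S" "D \<subseteq> carrier A" "closed_in_degree S (p + q) H" and x: "x \<in> hom_power S q"
    and gen0: "\<And>y. \<lbrakk>p = 0; y \<in> X0 A S D\<rbrakk> \<Longrightarrow> times S (emb S y) x \<in> H"
    and gen1: "\<And>r a w. \<lbrakk>p = Suc r; a \<in> X0 A S (carrier A); w \<in> forms S D r\<rbrakk> \<Longrightarrow>
      times S (times S (dl S (emb S a)) w) x \<in> H"
    and gen2: "\<And>r y w. \<lbrakk>p = Suc r; y \<in> X0 A S D; w \<in> forms S (carrier A) r\<rbrakk> \<Longrightarrow>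
      times S (times S (dl S (emb S y)) w) x \<in> H"
    and w: "w \<in> forms S D p"
  shows "times S w x \<in> H"
  unfolding times_def
proof (rule forms_coordinatewise[where s = "\<lambda>k. k" and g = "\<lambda>k b. b \<otimes>\<^bsub>W\<^esub> x k", OF assms(1,2,3) _ _ _ _ _ _ w])
  show "a \<otimes>\<^bsub>W\<^esub> x k \<in> homog W (p + q)" if "k \<in> S" "a \<in> homog W p" for k a
    using W.homog_mult that(2) PiE_mem[OF x that(1)] .
  show "(a \<ominus>\<^bsub>W\<^esub> b) \<otimes>\<^bsub>W\<^esub> x k = a \<otimes>\<^bsub>W\<^esub> x k \<ominus>\<^bsub>W\<^esub> b \<otimes>\<^bsub>W\<^esub> x k"
    if "k \<in> S" "a \<in> homog W p" "b \<in> homog W p" for k a b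
    using W.homog_closed[OF PiE_mem[OF x that(1)]] that(2,3) by (simp add: W.B.mult_minus_distrib)
qed (use gen0 gen1 gen2 in \<open>simp_all add: times_def\<close>)

lemma hom_power_closed: "x \<in> hom_power S q \<Longrightarrow> k \<in> S \<Longrightarrow> x k \<in> carrier W"
  by (rule W.homog_closed) (rule PiE_mem)

lemma times_assoc:
  assumes "x \<in> hom_power S p" "y \<in> hom_power S q" "z \<in> hom_power S r"
  shows "times S (times S x y) z = times S x (times S y z)"
  unfolding times_def
  by (rule restrict_ext) (simp add: W.B.m_assoc hom_power_closed[OF assms(1)]
      hom_power_closed[OF assms(2)] hom_power_closed[OF assms(3)])

lemma emb_central:
  assumes "a \<in> (\<Pi>\<^sub>E k\<in>S. carrier A)" "w \<in> hom_power S q"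
  shows "times S (emb S a) w = times S w (emb S a)"
  unfolding times_def
  by (rule restrict_ext)
    (simp add: emb_def W.const_central[OF PiE_mem[OF assms(1)] hom_power_closed[OF assms(2)]])

text \<open>Constants move past the exact factors, which is what makes the generated groups modules over \<open>X\<^sub>S(A)\<close>.\<close>

lemma emb_left_commute:
  assumes "a \<in> (\<Pi>\<^sub>E k\<in>S. carrier A)" "x \<in> hom_power S p" "w \<in> hom_power S q"
  shows "times S (emb S a) (times S x w) = times S x (times S (emb S a) w)"
  by (simp add: times_assoc[OF emb_homog[OF assms(1)] assms(2,3), symmetric] emb_central[OF assms(1,2)]
      times_assoc[OF assms(2) emb_homog[OF assms(1)] assms(3)])

lemma emb_mult:
  assumes "x \<in> (\<Pi>\<^sub>E k\<in>S. carrier A)" "y \<in> (\<Pi>\<^sub>E k\<in>S. carrier A)"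
  shows "times S (emb S x) (emb S y) = emb S (\<lambda>k\<in>S. x k \<otimes>\<^bsub>A\<^esub> y k)"
  unfolding times_def emb_def
  by (rule restrict_ext) (simp add: W.const_mult[OF PiE_mem[OF assms(1)] PiE_mem[OF assms(2)]])

lemma dl_emb_homog: "a \<in> (\<Pi>\<^sub>E k\<in>S. carrier A) \<Longrightarrow> dl S (emb S a) \<in> hom_power S (Suc 0)"
  by (rule dl_homog[OF emb_homog])

context
  fixes S D
  assumes S: "truncation_set S" and D: "ideal D A"
begin

lemma D_carrier: "D \<subseteq> carrier A"
  by (rule ideal_subset_carrier[OF D])

text \<open>The induction for the second claim uses the first one for the generators \<open>dl(x) \<eta>\<close>, where \<open>\<eta>\<close> is a form for \<open>A\<close>.  In the
third claim a generator \<open>dl(b) \<eta>\<close> is multiplied into \<open>dl(b) (x \<eta>)\<close>, to which the induction hypothesis applies.\<close>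

lemma emb_times_forms:
  "\<lbrakk>a \<in> X0 A S (carrier A); w \<in> forms S (carrier A) q\<rbrakk> \<Longrightarrow> times S (emb S a) w \<in> forms S (carrier A) q"
  "\<lbrakk>a \<in> X0 A S (carrier A); w \<in> forms S D q\<rbrakk> \<Longrightarrow> times S (emb S a) w \<in> forms S D q"
  "\<lbrakk>x \<in> X0 A S D; w \<in> forms S (carrier A) q\<rbrakk> \<Longrightarrow> times S (emb S x) w \<in> forms S D q"
proof -
  note XA = X0_D[OF S subset_refl] and XD = X0_D[OF S D_carrier]
  have ideal_case: "times S (emb S a) w \<in> forms S E q"
    if E: "ideal E A" and a: "a \<in> X0 A S (carrier A)" and w: "w \<in> forms S E q"
      and IH: "\<And>r w. \<lbrakk>q = Suc r; w \<in> forms S E r\<rbrakk> \<Longrightarrow> times S (emb S a) w \<in> forms S E r"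
        "\<And>r w. \<lbrakk>q = Suc r; w \<in> forms S (carrier A) r\<rbrakk> \<Longrightarrow> times S (emb S a) w \<in> forms S (carrier A) r"
    for E a w q
  proof -
    have Ec: "E \<subseteq> carrier A"
      by (rule ideal_subset_carrier[OF E])
    note XE = X0_D[OF S Ec]
    show ?thesis
    proof (rule forms_times_left[where p = 0, OF S Ec _ emb_homog[OF XA[OF a]] _ _ _ w])
      show "closed_in_degree S (0 + q) (forms S E q)" using closed_forms[OF S Ec] by simp
      show "times S (emb S a) (emb S y) \<in> forms S E q" if "q = 0" "y \<in> X0 A S E" for y
        unfolding that(1) emb_mult[OF XA[OF a] XE[OF that(2)]]
        by (intro forms_gen_0 A.X0_mult S E a that(2))
      show "times S (emb S a) (times S (dl S (emb S b)) w) \<in> forms S E q"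
        if "q = Suc r" "b \<in> X0 A S (carrier A)" "w \<in> forms S E r" for r b w
        unfolding that(1) emb_left_commute[OF XA[OF a] dl_emb_homog[OF XA[OF that(2)]]
            forms_homog[OF S Ec that(3)]]
        by (intro forms_gen_1 that(2) IH(1) that(1,3))
      show "times S (emb S a) (times S (dl S (emb S b)) w) \<in> forms S E q"
        if "q = Suc r" "b \<in> X0 A S E" "w \<in> forms S (carrier A) r" for r b w
        unfolding that(1) emb_left_commute[OF XA[OF a] dl_emb_homog[OF XE[OF that(2)]]
            forms_homog[OF S subset_refl that(3)]]
        by (intro forms_gen_2 that(2) IH(2) that(1,3))
    qed
  qed
  show whole: "times S (emb S a) w \<in> forms S (carrier A) q"
    if a: "a \<in> X0 A S (carrier A)" and "w \<in> forms S (carrier A) q" for a w q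
    using that(2) by (induction q arbitrary: w) (rule ideal_case[OF A.oneideal a]; simp)+
  show "times S (emb S a) w \<in> forms S D q"
    if a: "a \<in> X0 A S (carrier A)" and "w \<in> forms S D q" for a w q
    using that(2) by (induction q arbitrary: w) (rule ideal_case[OF D a]; simp add: whole[OF a])+
  show "times S (emb S x) w \<in> forms S D q" if x: "x \<in> X0 A S D" and "w \<in> forms S (carrier A) q" for x w q
    using that(2)
  proof (induction q arbitrary: w)
    case 0
    show ?case
    proof (rule forms_times_left[where p = 0, OF S subset_refl _ emb_homog[OF XD[OF x]] _ _ _ 0])
      show "closed_in_degree S (0 + 0) (forms S D 0)" using closed_forms[OF S D_carrier, of 0] by simp
      show "times S (emb S x) (emb S y) \<in> forms S D 0" if "y \<in> X0 A S (carrier A)" for y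
        unfolding emb_central[OF XD[OF x] emb_homog[OF XA[OF that]]] emb_mult[OF XA[OF that] XD[OF x]]
        by (intro forms_gen_0 A.X0_mult S D x that)
    qed simp_all
  next
    case (Suc q)
    have *: "times S (emb S x) (times S (dl S (emb S b)) w) \<in> forms S D (Suc q)"
      if "b \<in> X0 A S (carrier A)" "w \<in> forms S (carrier A) q" for b w
      unfolding emb_left_commute[OF XD[OF x] dl_emb_homog[OF XA[OF that(1)]]
          forms_homog[OF S subset_refl that(2)]]
      by (intro forms_gen_1 that(1) Suc.IH that(2))
    show ?case
    proof (rule forms_times_left[where p = 0, OF S subset_refl _ emb_homog[OF XD[OF x]] _ _ _ Suc.prems])
      show "closed_in_degree S (0 + Suc q) (forms S D (Suc q))"
        using closed_forms[OF S D_carrier, of "Suc q"] by simp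
    qed (use * in simp_all)
  qed
qed

end

text \<open>Induction on the degree of the left factor: by associativity a generator \<open>dl(b) \<omega>\<close> times \<open>y\<close> is \<open>dl(b)\<close> times
\<open>\<omega> y\<close>, so no commutation of forms of positive degree is involved.\<close>

lemma forms_mult:
  assumes S: "truncation_set S" and D: "ideal D A"
  shows "\<lbrakk>x \<in> forms S (carrier A) p; y \<in> forms S D q\<rbrakk> \<Longrightarrow> times S x y \<in> forms S D (p + q)"
    and "\<lbrakk>x \<in> forms S D p; y \<in> forms S (carrier A) q\<rbrakk> \<Longrightarrow> times S x y \<in> forms S D (p + q)"
proof -
  have Ec: "E \<subseteq> carrier A" if "ideal E A" for E
    by (rule ideal_subset_carrier[OF that])
  note XA = X0_D[OF S subset_refl] and XD = X0_D[OF S Ec[OF D]]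
  note emb = emb_times_forms[OF S]
  have left: "times S x y \<in> forms S E (p + q)"
    if E: "ideal E A" and x: "x \<in> forms S (carrier A) p" and y: "y \<in> forms S E q" for x y p q E
    using x
  proof (induction p arbitrary: x)
    case 0
    show ?case
      by (rule forms_times_right[OF S subset_refl closed_forms[OF S Ec[OF E]] forms_homog[OF S Ec[OF E] y]
            _ _ _ 0]) (use emb(2)[OF E _ y] in simp_all)
  next
    case (Suc p)
    have *: "times S (times S (dl S (emb S b)) w) y \<in> forms S E (Suc p + q)"
      if "b \<in> X0 A S (carrier A)" "w \<in> forms S (carrier A) p" for b w
      unfolding times_assoc[OF dl_emb_homog[OF XA[OF that(1)]] forms_homog[OF S subset_refl that(2)]
          forms_homog[OF S Ec[OF E] y]] add_Suc
      by (intro forms_gen_1 that(1) Suc.IH that(2))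
    show ?case
      by (rule forms_times_right[OF S subset_refl closed_forms[OF S Ec[OF E]] forms_homog[OF S Ec[OF E] y]
            _ _ _ Suc.prems]) (use * in simp_all)
  qed
  show "\<lbrakk>x \<in> forms S (carrier A) p; y \<in> forms S D q\<rbrakk> \<Longrightarrow> times S x y \<in> forms S D (p + q)"
    by (rule left[OF D])
  assume "x \<in> forms S D p" and y: "y \<in> forms S (carrier A) q"
  then show "times S x y \<in> forms S D (p + q)"
  proof (induction p arbitrary: x)
    case 0
    show ?case
      by (rule forms_times_right[OF S Ec[OF D] closed_forms[OF S Ec[OF D]] forms_homog[OF S subset_refl y]
            _ _ _ 0(1)]) (use emb(3)[OF D _ y] in simp_all)
  next
    case (Suc p)
    have 1: "times S (times S (dl S (emb S b)) w) y \<in> forms S D (Suc p + q)"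
      if "b \<in> X0 A S (carrier A)" "w \<in> forms S D p" for b w
      unfolding times_assoc[OF dl_emb_homog[OF XA[OF that(1)]] forms_homog[OF S Ec[OF D] that(2)]
          forms_homog[OF S subset_refl y]] add_Suc
      by (intro forms_gen_1 that(1) Suc.IH that(2) y)
    have 2: "times S (times S (dl S (emb S b)) w) y \<in> forms S D (Suc p + q)"
      if "b \<in> X0 A S D" "w \<in> forms S (carrier A) p" for b w
      unfolding times_assoc[OF dl_emb_homog[OF XD[OF that(1)]] forms_homog[OF S subset_refl that(2)]
          forms_homog[OF S subset_refl y]] add_Suc
      by (intro forms_gen_2 that(1) left[OF A.oneideal] that(2) y)
    show ?case
      by (rule forms_times_right[OF S Ec[OF D] closed_forms[OF S Ec[OF D]] forms_homog[OF S subset_refl y]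
            _ _ _ Suc.prems(1)]) (use 1 2 in simp_all)
  qed
qed

lemma one_forms:
  assumes "truncation_set S"
  shows "(\<lambda>k\<in>S. \<one>\<^bsub>W\<^esub>) \<in> forms S (carrier A) 0"
proof -
  have "emb S (\<lambda>k\<in>S. \<one>\<^bsub>A\<^esub>) = (\<lambda>k\<in>S. \<one>\<^bsub>W\<^esub>)"
    unfolding emb_def by (rule restrict_ext) (simp add: W.const_one[OF A.one_closed])
  then show ?thesis using forms_gen_0[OF A.X0_one[OF assms]] by simp
qed

lemma times_one: "x \<in> hom_power S q \<Longrightarrow> times S x (\<lambda>k\<in>S. \<one>\<^bsub>W\<^esub>) = x"
  unfolding times_def
  by (rule trans[OF restrict_ext PiE_restrict]) (simp_all add: hom_power_closed)

lemma dl_emb_forms: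
  assumes "truncation_set S" "D \<subseteq> carrier A" "x \<in> X0 A S D"
  shows "dl S (emb S x) \<in> forms S D (Suc 0)"
  using forms_gen_2[OF assms(3) one_forms[OF assms(1)]]
  by (simp only: times_one[OF dl_emb_homog[OF X0_D[OF assms]]])

text \<open>The scalars \<open>1/k\<close> are central and constant, so \<open>dl\<close> inherits this rule from \<open>d\<close> in each coordinate.\<close>

lemma dl_times_exact:
  assumes "a \<in> (\<Pi>\<^sub>E k\<in>S. carrier A)" "w \<in> hom_power S q"
  shows "dl S (times S (dl S (emb S a)) w) = (\<lambda>k\<in>S. \<ominus>\<^bsub>W\<^esub> times S (dl S (emb S a)) (dl S w) k)"
  unfolding dl_def times_def emb_def
proof (rule restrict_ext)
  fix k assume k: "k \<in> S"
  let ?e = "scalar (inverse (of_nat k))" and ?da = "dW (const (a k))"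
  have ak: "a k \<in> carrier A" using assms(1) k by auto
  have da: "?da \<in> carrier W" using ak by (intro W.d_closed) simp
  have wk: "w k \<in> carrier W" by (rule hom_power_closed[OF assms(2) k])
  have "?e \<otimes>\<^bsub>W\<^esub> dW (?e \<otimes>\<^bsub>W\<^esub> ?da \<otimes>\<^bsub>W\<^esub> w k) = ?e \<otimes>\<^bsub>W\<^esub> (?e \<otimes>\<^bsub>W\<^esub> dW (?da \<otimes>\<^bsub>W\<^esub> w k))"
    using da wk by (simp add: W.B.m_assoc differential_scalar)
  also have "\<dots> = \<ominus>\<^bsub>W\<^esub> (?e \<otimes>\<^bsub>W\<^esub> ?e \<otimes>\<^bsub>W\<^esub> ?da \<otimes>\<^bsub>W\<^esub> dW (w k))"
    using da wk ak by (simp add: W.d_exact_mult W.B.r_minus W.B.m_assoc W.d_closed)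
  also have "?e \<otimes>\<^bsub>W\<^esub> ?e \<otimes>\<^bsub>W\<^esub> ?da = ?e \<otimes>\<^bsub>W\<^esub> ?da \<otimes>\<^bsub>W\<^esub> ?e"
    using W.B.m_assoc[of ?e ?e ?da] W.B.m_assoc[of ?e ?da ?e] scalar_central[OF da] da by simp
  finally show "?e \<otimes>\<^bsub>W\<^esub> dW ((\<lambda>k\<in>S. (\<lambda>k\<in>S. scalar (inverse (of_nat k)) \<otimes>\<^bsub>W\<^esub>
        dW ((\<lambda>k\<in>S. const (a k)) k)) k \<otimes>\<^bsub>W\<^esub> w k) k) =
      \<ominus>\<^bsub>W\<^esub> (\<lambda>k\<in>S. (\<lambda>k\<in>S. scalar (inverse (of_nat k)) \<otimes>\<^bsub>W\<^esub> dW ((\<lambda>k\<in>S. const (a k)) k)) k \<otimes>\<^bsub>W\<^esub>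
        (\<lambda>k\<in>S. scalar (inverse (of_nat k)) \<otimes>\<^bsub>W\<^esub> dW (w k)) k) k"
    using k da wk by (simp add: W.B.m_assoc W.d_closed)
qed

lemma closed_a_inv:
  assumes "closed_in_degree S q H" "x \<in> H"
  shows "(\<lambda>k\<in>S. \<ominus>\<^bsub>W\<^esub> x k) \<in> H"
proof -
  note cl = coefficient_group.closed_subgroupD[OF coefficient_group_W assms(1)]
  have "(\<lambda>k\<in>S. (\<lambda>k\<in>S. \<zero>\<^bsub>W\<^esub>) k \<ominus>\<^bsub>W\<^esub> x k) = (\<lambda>k\<in>S. \<ominus>\<^bsub>W\<^esub> x k)"
    by (rule restrict_ext) (simp add: a_minus_def hom_power_closed[OF cl(1)[OF assms(2)]])
  then show ?thesis using cl(3)[OF cl(2) assms(2)] by simp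
qed

lemma forms_dl:
  assumes S: "truncation_set S" and D: "D \<subseteq> carrier A" and w: "w \<in> forms S D q"
  shows "dl S w \<in> forms S D (Suc q)"
  using D w
proof (induction q arbitrary: D w)
  case (0 D)
  note H = closed_forms[OF S 0(1), of "Suc 0"]
  show ?case
    unfolding dl_def
    by (rule forms_coordinatewise[where s = "\<lambda>k. k" and g = "\<lambda>k a. scalar (inverse (of_nat k)) \<otimes>\<^bsub>W\<^esub> dW a",
          OF S 0(1) H _ _ _ _ _ _ 0(2)])
      (use dl_emb_forms[OF S 0(1)] in \<open>auto simp: dl_def W.d_diff W.d_closed W.B.mult_minus_distrib
        intro!: scalar_homog W.d_homog\<close>)
next
  case (Suc q D)
  note H = closed_forms[OF S Suc.prems(1), of "Suc (Suc q)"]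
  note neg = closed_a_inv[OF H]
  have 1: "dl S (times S (dl S (emb S a)) w) \<in> forms S D (Suc (Suc q))"
    if "a \<in> X0 A S (carrier A)" "w \<in> forms S D q" for a w
    unfolding dl_times_exact[OF X0_D[OF S subset_refl that(1)] forms_homog[OF S Suc.prems(1) that(2)]]
    by (intro neg forms_gen_1 that(1) Suc.IH Suc.prems(1) that(2))
  have 2: "dl S (times S (dl S (emb S x)) w) \<in> forms S D (Suc (Suc q))"
    if "x \<in> X0 A S D" "w \<in> forms S (carrier A) q" for x w
    unfolding dl_times_exact[OF X0_D[OF S Suc.prems(1) that(1)] forms_homog[OF S subset_refl that(2)]]
    by (intro neg forms_gen_2 that(1) Suc.IH subset_refl that(2))
  show ?case
    unfolding dl_def
    by (rule forms_coordinatewise[where s = "\<lambda>k. k" and g = "\<lambda>k a. scalar (inverse (of_nat k)) \<otimes>\<^bsub>W\<^esub> dW a",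
          OF S Suc.prems(1) H _ _ _ _ _ _ Suc.prems(2)])
      (use 1 2 in \<open>auto simp: dl_def W.d_diff W.d_closed W.B.mult_minus_distrib
        intro!: scalar_homog W.d_homog\<close>)
qed

end

section \<open>Integrality\<close>

context rational_dg_algebra
begin

lemma coordinate_dl_diff:
  assumes "a \<in> carrier A" "b \<in> carrier A"
  shows "scalar r \<otimes>\<^bsub>W\<^esub> dW (const (a \<ominus>\<^bsub>A\<^esub> b)) =
    scalar r \<otimes>\<^bsub>W\<^esub> dW (const a) \<ominus>\<^bsub>W\<^esub> scalar r \<otimes>\<^bsub>W\<^esub> dW (const b)"
  using W.d_closed[OF W.const_closed[OF assms(1)]] W.d_closed[OF W.const_closed[OF assms(2)]] assms
  by (simp add: W.const_diff W.d_diff W.B.mult_minus_distrib)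

lemma coordinate_dl_homog: "a \<in> carrier A \<Longrightarrow> scalar r \<otimes>\<^bsub>W\<^esub> dW (const a) \<in> homog W (Suc 0)"
  by (intro scalar_homog W.d_homog W.const_homog)

text \<open>\<open>(1/k) d(n a\<^bsup>k/n\<^esup>) = a\<^bsup>k/n-1\<^esup> da\<close>.  The factor \<open>n\<close> of \<open>V\<^sub>n\<close> and the exponent \<open>k/n\<close> together cancel the denominator
\<open>k\<close>, which is the source of the integrality.\<close>

lemma dl_ver_gen:
  assumes "0 < k" "0 < n" "k \<in> S" "a \<in> carrier A"
  shows "scalar (inverse (of_nat k)) \<otimes>\<^bsub>W\<^esub> dW (const (ver_gen A S n a k)) =
    (if n dvd k then const (a [^]\<^bsub>A\<^esub> (k div n - 1)) \<otimes>\<^bsub>W\<^esub> dW (const a) else \<zero>\<^bsub>W\<^esub>)"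
proof (cases "n dvd k")
  case True
  let ?P = "const (a [^]\<^bsub>A\<^esub> (k div n - 1)) \<otimes>\<^bsub>W\<^esub> dW (const a)"
  have P: "?P \<in> carrier W"
    using assms by (intro W.B.m_closed W.d_closed W.const_closed) simp_all
  have "dW (const (ver_gen A S n a k)) = [n] \<cdot>\<^bsub>W\<^esub> ([(k div n)] \<cdot>\<^bsub>W\<^esub> ?P)"
    using assms True W.const_closed[of "a [^]\<^bsub>A\<^esub> (k div n)"]
    by (simp add: ver_gen_def W.const_nat W.d_nat W.d_const_pow)
  also have "\<dots> = [k] \<cdot>\<^bsub>W\<^esub> ?P"
    using P True by (simp add: W.B.add.nat_pow_pow)
  also have "\<dots> = scalar (of_nat k) \<otimes>\<^bsub>W\<^esub> ?P"
    by (rule scalar_of_nat_mult[OF P, symmetric])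
  also have "scalar (inverse (of_nat k)) \<otimes>\<^bsub>W\<^esub> \<dots> = ?P"
    using P assms(1) by (simp add: W.B.m_assoc[symmetric] scalar_mult scalar_one)
  finally show ?thesis using True by simp
next
  case False
  then show ?thesis
    using assms by (simp add: ver_gen_def W.const_zero[OF A.zero_closed])
qed

definition integral_part :: "nat \<Rightarrow> ('b \<times> rat \<Rightarrow>\<^sub>0 int) set set" where
  "integral_part q = (\<lambda>x. tensor B x 1) ` homog B q"

lemma integral_mult:
  "\<lbrakk>x \<in> integral_part p; y \<in> integral_part q\<rbrakk> \<Longrightarrow> x \<otimes>\<^bsub>W\<^esub> y \<in> integral_part (p + q)"
  unfolding integral_part_def using homog_mult by (auto simp: tensor_mult)

lemma integral_zero: "\<zero>\<^bsub>W\<^esub> \<in> integral_part q"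
  unfolding integral_part_def
  using imageI[OF homog_zero, of "\<lambda>x. tensor B x 1"] by (simp add: tensor_zero)

lemma closed_integral: "closed_in_degree S q (\<Pi>\<^sub>E k\<in>S. integral_part q)"
proof (rule coefficient_group.closed_subgroup_PiE[OF coefficient_group_W])
  show "integral_part q \<subseteq> homog W q"
    unfolding integral_part_def by (intro image_subsetI tensor_homog)
  show "\<zero>\<^bsub>W\<^esub> \<in> integral_part q" by (rule integral_zero)
  show "a \<ominus>\<^bsub>W\<^esub> b \<in> integral_part q" if "a \<in> integral_part q" "b \<in> integral_part q" for a b
    using that unfolding integral_part_def
    by (elim imageE; simp only: tensor_diff[OF homog_closed homog_closed, symmetric]; intro imageI homog_diff)
qed

lemma const_integral: "a \<in> carrier A \<Longrightarrow> const a \<in> integral_part 0"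
  unfolding integral_part_def by (intro imageI const_homog)

lemma d_const_integral: "a \<in> carrier A \<Longrightarrow> dW (const a) \<in> integral_part (Suc 0)"
  unfolding integral_part_def differential_tensor[OF const_closed] by (intro imageI d_homog const_homog)

lemma dl_emb_integral:
  assumes S: "truncation_set S" and a: "a \<in> X0 A S (carrier A)"
  shows "dl S (emb S a) \<in> (\<Pi>\<^sub>E k\<in>S. integral_part (Suc 0))"
proof -
  have eq: "dl S (emb S y) = (\<lambda>k\<in>S. scalar (inverse (of_nat k)) \<otimes>\<^bsub>W\<^esub> dW (const (y k)))" for y
    unfolding dl_def emb_def by (rule restrict_ext) simp
  show ?thesis
    unfolding eq
  proof (rule A.X0_coordinatewise[where s = "\<lambda>k. k" and
        g = "\<lambda>k y. scalar (inverse (of_nat k)) \<otimes>\<^bsub>W\<^esub> dW (const y)",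
        OF S subset_refl coefficient_group_W closed_integral _ _ _ _ a])
    fix n b assume n: "n \<in> S" and b: "b \<in> carrier A"
    have "0 < n" using truncation_setD(1)[OF S n] .
    have "const (b [^]\<^bsub>A\<^esub> j) \<otimes>\<^bsub>W\<^esub> dW (const b) \<in> integral_part (Suc 0)" for j :: nat
      using integral_mult[OF const_integral d_const_integral, of "b [^]\<^bsub>A\<^esub> j" b] b by simp
    then show "(\<lambda>k\<in>S. scalar (inverse (of_nat k)) \<otimes>\<^bsub>W\<^esub> dW (const (ver_gen A S n b k)))
        \<in> (\<Pi>\<^sub>E k\<in>S. integral_part (Suc 0))"
      using truncation_setD(1)[OF S] \<open>0 < n\<close> b by (auto simp: dl_ver_gen integral_zero)
  qed (simp_all add: coordinate_dl_homog coordinate_dl_diff)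
qed

lemma forms_integral:
  assumes S: "truncation_set S"
  shows "forms S (carrier A) q \<subseteq> (\<Pi>\<^sub>E k\<in>S. integral_part q)"
proof (induction q)
  case 0
  have "emb S x \<in> (\<Pi>\<^sub>E k\<in>S. integral_part 0)" if "x \<in> X0 A S (carrier A)" for x
    using X0_D[OF S subset_refl that] const_integral by (auto simp: emb_def)
  then show ?case
    unfolding graded_forms.simps
    by (intro coefficient_group.closed_hull_least[OF coefficient_group_W closed_integral] image_subsetI)
next
  case (Suc q)
  have *: "times S (dl S (emb S a)) w \<in> (\<Pi>\<^sub>E k\<in>S. integral_part (Suc q))"
    if "a \<in> X0 A S (carrier A)" "w \<in> forms S (carrier A) q" for a w
    unfolding times_def
  proof (rule restrict_PiE_iff[THEN iffD2], rule ballI)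
    fix k assume k: "k \<in> S"
    show "dl S (emb S a) k \<otimes>\<^bsub>W\<^esub> w k \<in> integral_part (Suc q)"
      using integral_mult[OF PiE_mem[OF dl_emb_integral[OF S that(1)] k] PiE_mem[OF subsetD[OF Suc that(2)] k]]
      by simp
  qed
  show ?case
    unfolding graded_forms.simps
    by (intro coefficient_group.closed_hull_least[OF coefficient_group_W closed_integral] Un_least subsetI;
        elim CollectE exE conjE; simp only: *)
qed

section \<open>Frobenius and Verschiebung on forms\<close>

text \<open>For \<open>x = V\<^sub>n\<langle>a\<rangle>\<close> the coordinate of \<open>F\<^sub>m dl x\<close> at \<open>k = n' j\<close> is \<open>a\<^bsup>j m'-1\<^esup> da\<close>, and the coordinates at other places are
\<open>0\<close>.  This element is called \<open>w\<close> in the proof.  Only the coprime multiples \<open>m' w\<close> and \<open>n' w\<close> are written in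
terms of generators.\<close>

lemma frobenius_dl_emb:
  assumes S: "truncation_set S" and D: "ideal D A" and m: "m \<in> S" and x: "x \<in> X0 A S D"
  shows "frobenius S m (dl S (emb S x)) \<in> forms (trunc_quot S m) D (Suc 0)"
proof -
  define S' where "S' = trunc_quot S m"
  have S': "truncation_set S'" unfolding S'_def by (rule truncation_set_quot[OF S m])
  have DA: "D \<subseteq> carrier A"
    by (rule ideal_subset_carrier[OF D])
  have kS: "k * m \<in> S" "0 < k" if "k \<in> S'" for k
    using that by (simp_all add: S'_def trunc_quot_def)
  note H = closed_forms[OF S' DA, of "Suc 0"]
  have eq: "frobenius S m (dl S (emb S y)) =
      (\<lambda>k\<in>S'. scalar (inverse (of_nat (k * m))) \<otimes>\<^bsub>W\<^esub> dW (const (y (k * m))))" for y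
    unfolding frobenius_def dl_def emb_def S'_def[symmetric] by (rule restrict_ext) (simp add: kS)
  note pow = ideal_pow_closed[OF D]
  show ?thesis
    unfolding eq S'_def[symmetric]
  proof (rule A.X0_coordinatewise[where s = "\<lambda>k. k * m" and
        g = "\<lambda>k y. scalar (inverse (of_nat (k * m))) \<otimes>\<^bsub>W\<^esub> dW (const y)",
        OF S DA coefficient_group_W H _ _ _ _ x])
    fix n a assume n: "n \<in> S" and aD: "a \<in> D"
    have a: "a \<in> carrier A" using aD DA by (rule subsetD[rotated])
    have n0: "0 < n" and m0: "0 < m" using truncation_setD(1)[OF S] n m by blast+
    obtain g n' m' where nm: "n = g * n'" "m = g * m'" "coprime n' m'"
      and pos: "0 < g" "0 < n'" "0 < m'"
      using gcd_decomposition[OF n0 m0] by metis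
    let ?da = "dW (const a)"
    have da: "?da \<in> carrier W" using a by (intro W.d_closed W.const_closed)
    define w where "w = (\<lambda>k\<in>S'. if n' dvd k then const (a [^]\<^bsub>A\<^esub> (k div n' * m' - 1)) \<otimes>\<^bsub>W\<^esub> ?da else \<zero>\<^bsub>W\<^esub>)"
    have w_eq: "(\<lambda>k\<in>S'. scalar (inverse (of_nat (k * m))) \<otimes>\<^bsub>W\<^esub> dW (const (ver_gen A S n a (k * m)))) = w"
      unfolding w_def
    proof (rule restrict_ext)
      fix k assume k: "k \<in> S'"
      have dvd: "n dvd k * m \<longleftrightarrow> n' dvd k"
        using nm pos by (simp add: coprime_dvd_mult_left_iff mult.left_commute)
      have div: "k * m div n = k div n' * m'" if n': "n' dvd k"
      proof -
        obtain v where v: "k = n' * v" using n' by (rule dvdE)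
        have e: "k * m = n * (v * m')" by (simp add: nm(1,2) v)
        have "k * m div n = v * m'" unfolding e using n0 by simp
        moreover have "k div n' = v" unfolding v using pos by simp
        ultimately show ?thesis by simp
      qed
      show "scalar (inverse (of_nat (k * m))) \<otimes>\<^bsub>W\<^esub> dW (const (ver_gen A S n a (k * m))) =
          (if n' dvd k then const (a [^]\<^bsub>A\<^esub> (k div n' * m' - 1)) \<otimes>\<^bsub>W\<^esub> ?da else \<zero>\<^bsub>W\<^esub>)"
        using dl_ver_gen[OF _ n0 kS(1)[OF k] a] kS(2)[OF k] m0 dvd div by auto
    qed
    have wD: "w \<in> hom_power S' (Suc 0)"
    proof -
      have "const (a [^]\<^bsub>A\<^esub> j) \<otimes>\<^bsub>W\<^esub> ?da \<in> homog W (Suc 0)" for j :: nat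
        using W.homog_mult[OF W.const_homog W.d_homog[OF W.const_homog], of "a [^]\<^bsub>A\<^esub> j" a] a by simp
      then show ?thesis unfolding w_def by (auto simp: W.homog_zero)
    qed
    have j_pos: "0 < k div n'" if "k \<in> S'" "n' dvd k" for k
      using dvd_imp_le[OF that(2) kS(2)[OF that(1)]] pos by (simp add: div_greater_zero_iff)
    have cpow: "const (a [^]\<^bsub>A\<^esub> i) \<otimes>\<^bsub>W\<^esub> const (a [^]\<^bsub>A\<^esub> j) = const (a [^]\<^bsub>A\<^esub> (i + j))" for i j :: nat
      using a by (simp add: W.const_mult[symmetric] A.nat_pow_mult)
    \<comment> \<open>\<open>m' w = dl V\<^bsub>n'\<^esub>\<langle>b\<rangle>\<close> for \<open>b = a\<^bsup>m'\<^esup>\<close>, as \<open>b\<^bsup>j-1\<^esup> db = m' a\<^bsup>j m'-1\<^esup> da\<close>\<close>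
    have "(\<lambda>k\<in>S'. [m'] \<cdot>\<^bsub>W\<^esub> w k) = dl S' (emb S' (ver_gen A S' n' (a [^]\<^bsub>A\<^esub> m')))"
      unfolding dl_def
    proof (rule restrict_ext)
      fix k assume k: "k \<in> S'"
      have am: "a [^]\<^bsub>A\<^esub> m' \<in> carrier A" using a by simp
      have "const ((a [^]\<^bsub>A\<^esub> m') [^]\<^bsub>A\<^esub> (k div n' - 1)) \<otimes>\<^bsub>W\<^esub> dW (const (a [^]\<^bsub>A\<^esub> m')) =
          [m'] \<cdot>\<^bsub>W\<^esub> (const (a [^]\<^bsub>A\<^esub> (k div n' * m' - 1)) \<otimes>\<^bsub>W\<^esub> ?da)" if n': "n' dvd k"
      proof -
        obtain i where i: "k div n' = Suc i" using j_pos[OF k n'] by (cases "k div n'") auto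
        have "m' * i + (m' - 1) = k div n' * m' - 1" using pos unfolding i by (simp add: mult.commute)
        then have "const (a [^]\<^bsub>A\<^esub> (m' * i)) \<otimes>\<^bsub>W\<^esub> const (a [^]\<^bsub>A\<^esub> (m' - 1)) = const (a [^]\<^bsub>A\<^esub> (k div n' * m' - 1))"
          using cpow by simp
        moreover have "(a [^]\<^bsub>A\<^esub> m') [^]\<^bsub>A\<^esub> (k div n' - 1) = a [^]\<^bsub>A\<^esub> (m' * i)"
          using a by (simp add: i A.nat_pow_pow)
        ultimately show ?thesis
          using a da by (simp add: W.d_const_pow W.B.add_pow_rdistr W.B.m_assoc[symmetric])
      qed
      then show "[m'] \<cdot>\<^bsub>W\<^esub> w k = scalar (inverse (of_nat k)) \<otimes>\<^bsub>W\<^esub> dW (emb S' (ver_gen A S' n' (a [^]\<^bsub>A\<^esub> m')) k)"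
        using k dl_ver_gen[OF kS(2)[OF k] pos(2) k am] by (simp add: emb_def w_def)
    qed
    moreover have "dl S' (emb S' (ver_gen A S' n' (a [^]\<^bsub>A\<^esub> m'))) \<in> forms S' D (Suc 0)"
      by (intro dl_emb_forms S' DA A.ver_gen_X0 pos pow aD)
    ultimately have m'w: "(\<lambda>k\<in>S'. [m'] \<cdot>\<^bsub>W\<^esub> w k) \<in> forms S' D (Suc 0)" by simp
    \<comment> \<open>\<open>n' w = V\<^bsub>n'\<^esub>\<langle>a\<^bsup>m'-1\<^esup>\<rangle> dl V\<^bsub>n'\<^esub>\<langle>a\<rangle>\<close>, as \<open>(m' - 1) j + (j - 1) = j m' - 1\<close>\<close>
    have "(\<lambda>k\<in>S'. [n'] \<cdot>\<^bsub>W\<^esub> w k) =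
        times S' (emb S' (ver_gen A S' n' (a [^]\<^bsub>A\<^esub> (m' - 1)))) (dl S' (emb S' (ver_gen A S' n' a)))"
      unfolding times_def
    proof (rule restrict_ext)
      fix k assume k: "k \<in> S'"
      have "[n'] \<cdot>\<^bsub>W\<^esub> (const (a [^]\<^bsub>A\<^esub> (k div n' * m' - 1)) \<otimes>\<^bsub>W\<^esub> ?da) =
          const ([n'] \<cdot>\<^bsub>A\<^esub> ((a [^]\<^bsub>A\<^esub> (m' - 1)) [^]\<^bsub>A\<^esub> (k div n'))) \<otimes>\<^bsub>W\<^esub>
          (const (a [^]\<^bsub>A\<^esub> (k div n' - 1)) \<otimes>\<^bsub>W\<^esub> ?da)" if n': "n' dvd k"
      proof -
        obtain i where i: "k div n' = Suc i" using j_pos[OF k n'] by (cases "k div n'") auto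
        obtain l where l: "m' = Suc l" using pos by (cases m') auto
        have "(m' - 1) * (k div n') + (k div n' - 1) = k div n' * m' - 1"
          unfolding i l by (simp add: algebra_simps)
        then have "const ((a [^]\<^bsub>A\<^esub> (m' - 1)) [^]\<^bsub>A\<^esub> (k div n')) \<otimes>\<^bsub>W\<^esub> const (a [^]\<^bsub>A\<^esub> (k div n' - 1)) =
            const (a [^]\<^bsub>A\<^esub> (k div n' * m' - 1))"
          using a cpow by (simp add: A.nat_pow_pow)
        then show ?thesis
          using a da by (simp add: W.const_nat W.B.add_pow_ldistr W.B.m_assoc[symmetric])
      qed
      then show "[n'] \<cdot>\<^bsub>W\<^esub> w k = emb S' (ver_gen A S' n' (a [^]\<^bsub>A\<^esub> (m' - 1))) k \<otimes>\<^bsub>W\<^esub>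
          dl S' (emb S' (ver_gen A S' n' a)) k"
        using k dl_ver_gen[OF kS(2)[OF k] pos(2) k a] a
        by (auto simp: emb_def dl_def w_def ver_gen_def W.const_zero[OF A.zero_closed])
    qed
    moreover have "times S' (emb S' (ver_gen A S' n' (a [^]\<^bsub>A\<^esub> (m' - 1)))) (dl S' (emb S' (ver_gen A S' n' a)))
        \<in> forms S' D (Suc 0)"
      by (intro emb_times_forms(2) dl_emb_forms S' D DA A.ver_gen_X0 pos aD subset_refl A.nat_pow_closed a)
    ultimately have n'w: "(\<lambda>k\<in>S'. [n'] \<cdot>\<^bsub>W\<^esub> w k) \<in> forms S' D (Suc 0)" by simp
    have "w \<in> forms S' D (Suc 0)"
      by (rule coefficient_group.coprime_multiples[OF coefficient_group_W H wD nm(3) _ n'w m'w])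
        (use pos in simp)
    then show "(\<lambda>k\<in>S'. scalar (inverse (of_nat (k * m))) \<otimes>\<^bsub>W\<^esub> dW (const (ver_gen A S n a (k * m))))
        \<in> forms S' D (Suc 0)"
      unfolding w_eq .
  qed (simp_all only: kS coordinate_dl_homog coordinate_dl_diff)
qed

lemma emb_frobenius:
  "emb (trunc_quot S m) (frobenius S m x) = frobenius S m (emb S x)"
  unfolding emb_def frobenius_def by (rule restrict_ext) (simp add: trunc_quot_def)

lemma frobenius_times:
  "frobenius S m (times S x y) = times (trunc_quot S m) (frobenius S m x) (frobenius S m y)"
  unfolding times_def frobenius_def by (rule restrict_ext) (simp add: trunc_quot_def)

lemma forms_frobenius:
  assumes S: "truncation_set S" and D: "ideal D A" and m: "m \<in> S" and w: "w \<in> forms S D q"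
  shows "frobenius S m w \<in> forms (trunc_quot S m) D q"
  using D w
proof (induction q arbitrary: D w)
  case (0 D)
  note S' = truncation_set_quot[OF S m]
  have DA: "D \<subseteq> carrier A"
    by (rule ideal_subset_carrier[OF 0(1)])
  have gen: "(\<lambda>k\<in>trunc_quot S m. emb S x (k * m)) \<in> forms (trunc_quot S m) D 0" if "x \<in> X0 A S D" for x
    using forms_gen_0[OF A.X0_frobenius[OF S 0(1) m that]] unfolding emb_frobenius
    unfolding frobenius_def .
  show ?case
    unfolding frobenius_def
    by (rule forms_coordinatewise[where s = "\<lambda>k. k * m" and g = "\<lambda>k a. a",
          OF S DA closed_forms[OF S' DA] _ _ _ _ _ _ 0(2)])
      (use gen in \<open>simp_all add: trunc_quot_def\<close>)
next
  case (Suc q D)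
  note S' = truncation_set_quot[OF S m]
  have DA: "D \<subseteq> carrier A"
    by (rule ideal_subset_carrier[OF Suc.prems(1)])
  have 1: "(\<lambda>k\<in>trunc_quot S m. times S (dl S (emb S a)) w (k * m)) \<in> forms (trunc_quot S m) D (Suc q)"
    if "a \<in> X0 A S (carrier A)" "w \<in> forms S D q" for a w
    using forms_mult(1)[OF S' Suc.prems(1) frobenius_dl_emb[OF S A.oneideal m that(1)]
        Suc.IH[OF Suc.prems(1) that(2)]]
    unfolding frobenius_times[symmetric] by (simp add: frobenius_def)
  have 2: "(\<lambda>k\<in>trunc_quot S m. times S (dl S (emb S x)) w (k * m)) \<in> forms (trunc_quot S m) D (Suc q)"
    if "x \<in> X0 A S D" "w \<in> forms S (carrier A) q" for x w
    using forms_mult(2)[OF S' Suc.prems(1) frobenius_dl_emb[OF S Suc.prems(1) m that(1)]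
        Suc.IH[OF A.oneideal that(2)]]
    unfolding frobenius_times[symmetric] by (simp add: frobenius_def)
  show ?case
    unfolding frobenius_def
    by (rule forms_coordinatewise[where s = "\<lambda>k. k * m" and g = "\<lambda>k a. a",
          OF S DA closed_forms[OF S' DA] _ _ _ _ _ _ Suc.prems(2)])
      (use 1 2 in \<open>simp_all add: trunc_quot_def\<close>)
qed

lemma emb_verschiebung:
  assumes "truncation_set S" "x \<in> (\<Pi>\<^sub>E k\<in>trunc_quot S n. carrier A)"
  shows "emb S (verschiebung A S n x) = verschiebung W S n (emb (trunc_quot S n) x)"
  unfolding emb_def verschiebung_def
proof (rule restrict_ext)
  fix k assume k: "k \<in> S"
  show "const ((\<lambda>k\<in>S. if n dvd k then [n] \<cdot>\<^bsub>A\<^esub> x (k div n) else \<zero>\<^bsub>A\<^esub>) k) =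
      (if n dvd k then [n] \<cdot>\<^bsub>W\<^esub> (\<lambda>k\<in>trunc_quot S n. const (x k)) (k div n) else \<zero>\<^bsub>W\<^esub>)"
  proof (cases "n dvd k")
    case True
    note kn = trunc_quot_div[OF assms(1) k True]
    show ?thesis using k True kn W.const_nat[OF PiE_mem[OF assms(2) kn], of n] by simp
  next
    case False
    then show ?thesis using k by (simp add: W.const_zero[OF A.zero_closed])
  qed
qed

text \<open>At \<open>k = n j\<close> the factor \<open>n\<close> of \<open>V\<^sub>n a\<close> turns the denominator \<open>k\<close> of \<open>dl\<close> on \<open>S\<close> into the denominator \<open>j\<close> of
\<open>dl\<close> on \<open>S/n\<close>, and the factor \<open>n\<close> of \<open>V\<^sub>n \<omega>\<close> is the one of the left-hand side.\<close>

lemma verschiebung_dl_times: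
  assumes S: "truncation_set S" and n: "n \<in> S"
    and a: "a \<in> (\<Pi>\<^sub>E k\<in>trunc_quot S n. carrier A)" and w: "w \<in> hom_power (trunc_quot S n) q"
  shows "verschiebung W S n (times (trunc_quot S n) (dl (trunc_quot S n) (emb (trunc_quot S n) a)) w) =
    times S (dl S (emb S (verschiebung A S n a))) (verschiebung W S n w)"
  unfolding emb_verschiebung[OF S a]
  unfolding times_def verschiebung_def dl_def emb_def
proof (rule restrict_ext)
  fix k assume k: "k \<in> S"
  show "(if n dvd k then [n] \<cdot>\<^bsub>W\<^esub> (\<lambda>k\<in>trunc_quot S n. (\<lambda>k\<in>trunc_quot S n. scalar (inverse (of_nat k)) \<otimes>\<^bsub>W\<^esub>
          dW ((\<lambda>k\<in>trunc_quot S n. const (a k)) k)) k \<otimes>\<^bsub>W\<^esub> w k) (k div n) else \<zero>\<^bsub>W\<^esub>) =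
      (\<lambda>k\<in>S. scalar (inverse (of_nat k)) \<otimes>\<^bsub>W\<^esub> dW ((\<lambda>k\<in>S. if n dvd k
          then [n] \<cdot>\<^bsub>W\<^esub> (\<lambda>k\<in>trunc_quot S n. const (a k)) (k div n) else \<zero>\<^bsub>W\<^esub>) k)) k \<otimes>\<^bsub>W\<^esub>
      (\<lambda>k\<in>S. if n dvd k then [n] \<cdot>\<^bsub>W\<^esub> w (k div n) else \<zero>\<^bsub>W\<^esub>) k"
  proof (cases "n dvd k")
    case False
    then show ?thesis using k by simp
  next
    case True
    note kn = trunc_quot_div[OF S k True]
    let ?j = "k div n" and ?da = "dW (const (a (k div n)))"
    have ak: "a ?j \<in> carrier A" by (rule PiE_mem[OF a kn])
    have da: "?da \<in> carrier W" using ak by (intro W.d_closed W.const_closed)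
    have wk: "w ?j \<in> carrier W" by (rule hom_power_closed[OF w kn])
    have pos: "0 < k" "0 < n" using truncation_setD(1)[OF S] k n by blast+
    have "of_nat k = (of_nat n * of_nat ?j :: rat)"
      using True by (simp flip: of_nat_mult)
    then have "inverse (of_nat k) * of_nat n = (inverse (of_nat ?j) :: rat)"
      using pos by simp
    then have "scalar (inverse (of_nat ?j)) = scalar (inverse (of_nat k)) \<otimes>\<^bsub>W\<^esub> scalar (of_nat n)"
      by (simp add: scalar_mult)
    then have "scalar (inverse (of_nat ?j)) \<otimes>\<^bsub>W\<^esub> ?da = scalar (inverse (of_nat k)) \<otimes>\<^bsub>W\<^esub> ([n] \<cdot>\<^bsub>W\<^esub> ?da)"
      using da by (simp add: W.B.m_assoc scalar_of_nat_mult)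
    moreover have "dW ([n] \<cdot>\<^bsub>W\<^esub> const (a ?j)) = [n] \<cdot>\<^bsub>W\<^esub> ?da"
      by (rule W.d_nat[OF W.const_closed[OF ak]])
    ultimately show ?thesis
      using k True kn da wk by (simp add: W.B.add_pow_rdistr)
  qed
qed

lemma forms_verschiebung:
  assumes S: "truncation_set S" and D: "D \<subseteq> carrier A" and n: "n \<in> S"
    and w: "w \<in> forms (trunc_quot S n) D q"
  shows "verschiebung W S n w \<in> forms S D q"
proof -
  define S' where "S' = trunc_quot S n"
  have S': "truncation_set S'" unfolding S'_def by (rule truncation_set_quot[OF S n])
  have s: "(if n dvd k then k div n else 1) \<in> S'" if "k \<in> S" for k
    using that n trunc_quot_div[OF S that] by (simp add: S'_def trunc_quot_def)
  have nat_homog: "[n] \<cdot>\<^bsub>W\<^esub> a \<in> homog W q" if "a \<in> homog W q" for a q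
    using scalar_homog[OF that, of "of_nat n"] scalar_of_nat_mult[OF W.homog_closed[OF that], of n] by simp
  have diff: "(if n dvd k then [n] \<cdot>\<^bsub>W\<^esub> (a \<ominus>\<^bsub>W\<^esub> b) else \<zero>\<^bsub>W\<^esub>) =
      (if n dvd k then [n] \<cdot>\<^bsub>W\<^esub> a else \<zero>\<^bsub>W\<^esub>) \<ominus>\<^bsub>W\<^esub> (if n dvd k then [n] \<cdot>\<^bsub>W\<^esub> b else \<zero>\<^bsub>W\<^esub>)"
    if "a \<in> homog W q" "b \<in> homog W q" for k a b q
    using W.homog_closed[OF that(1)] W.homog_closed[OF that(2)]
    by (simp add: a_minus_def W.B.add.nat_pow_distrib W.B.add.nat_pow_inv)
  have step: "verschiebung W S n w \<in> forms S D q"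
    if D: "D \<subseteq> carrier A" and w: "w \<in> forms S' D q"
      and IH: "\<And>r w E. \<lbrakk>q = Suc r; E \<subseteq> carrier A; w \<in> forms S' E r\<rbrakk> \<Longrightarrow> verschiebung W S n w \<in> forms S E r"
    for D w q
    unfolding verschiebung_coordinatewise
  proof (rule forms_coordinatewise[where s = "\<lambda>k. if n dvd k then k div n else 1" and
        g = "\<lambda>k a. if n dvd k then [n] \<cdot>\<^bsub>W\<^esub> a else \<zero>\<^bsub>W\<^esub>",
        OF S' D closed_forms[OF S D] s _ diff _ _ _ w])
    show "(if n dvd k then [n] \<cdot>\<^bsub>W\<^esub> a else \<zero>\<^bsub>W\<^esub>) \<in> homog W q" if "a \<in> homog W q" for k a
      using nat_homog[OF that] W.homog_zero by simp
    fix x assume "q = 0" "x \<in> X0 A S' D"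
    then show "(\<lambda>k\<in>S. if n dvd k then [n] \<cdot>\<^bsub>W\<^esub> emb S' x (if n dvd k then k div n else 1) else \<zero>\<^bsub>W\<^esub>) \<in> forms S D q"
      unfolding verschiebung_coordinatewise[symmetric] S'_def
      using forms_gen_0[OF A.X0_verschiebung[OF S D n]] emb_verschiebung[OF S X0_D[OF truncation_set_quot[OF S n] D]]
      by simp
  next
    fix r a w assume q: "q = Suc r" and a: "a \<in> X0 A S' (carrier A)" and w: "w \<in> forms S' D r"
    have "times S (dl S (emb S (verschiebung A S n a))) (verschiebung W S n w) \<in> forms S D q"
      unfolding q by (intro forms_gen_1 A.X0_verschiebung[OF S subset_refl n a[unfolded S'_def]] IH q D w)
    then show "(\<lambda>k\<in>S. if n dvd k then [n] \<cdot>\<^bsub>W\<^esub> times S' (dl S' (emb S' a)) w (if n dvd k then k div n else 1)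
        else \<zero>\<^bsub>W\<^esub>) \<in> forms S D q"
      unfolding verschiebung_coordinatewise[symmetric] S'_def
      using verschiebung_dl_times[OF S n X0_D[OF S' subset_refl a, unfolded S'_def]
          forms_homog[OF S' D w, unfolded S'_def]] by simp
  next
    fix r x w assume q: "q = Suc r" and x: "x \<in> X0 A S' D" and w: "w \<in> forms S' (carrier A) r"
    have "times S (dl S (emb S (verschiebung A S n x))) (verschiebung W S n w) \<in> forms S D q"
      unfolding q by (intro forms_gen_2 A.X0_verschiebung[OF S D n x[unfolded S'_def]] IH q subset_refl w)
    then show "(\<lambda>k\<in>S. if n dvd k then [n] \<cdot>\<^bsub>W\<^esub> times S' (dl S' (emb S' x)) w (if n dvd k then k div n else 1)
        else \<zero>\<^bsub>W\<^esub>) \<in> forms S D q"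
      unfolding verschiebung_coordinatewise[symmetric] S'_def
      using verschiebung_dl_times[OF S n X0_D[OF S' D x, unfolded S'_def]
          forms_homog[OF S' subset_refl w, unfolded S'_def]] by simp
  qed
  show ?thesis
    using D w unfolding S'_def[symmetric]
    by (induction q arbitrary: D w) (rule step; simp)+
qed

end

section \<open>The universal property\<close>

context rational_dg_algebra
begin

lemma rat_power_simps:
  "x \<otimes>\<^bsub>rat_power B S\<^esub> y = times S x y"
  "\<one>\<^bsub>rat_power B S\<^esub> = (\<lambda>k\<in>S. \<one>\<^bsub>W\<^esub>)"
  "homog (rat_power B S) q = hom_power S q"
  "differential (rat_power B S) x = dl S x"
  by (simp_all add: rat_power_def times_def dl_def scalar_def)

lemma closed_graded_subgroup_iff:
  "closed_graded_subgroup B S Y \<longleftrightarrow> (\<forall>q. closed_in_degree S q (Y q))"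
proof -
  have "additive_subgroup H (rat_power B S) \<longleftrightarrow> additive_subgroup H (power_ring W S)" for H
    by (simp add: rat_power_def additive_subgroup_extend)
  then show ?thesis
    unfolding closed_graded_subgroup_def closed_subgroup_def rat_power_simps
    by (auto simp: closedin_power_topology_iff)
qed

lemma closed_dg_subring_forms:
  assumes "truncation_set S"
  shows "closed_dg_subring B S (forms S (carrier A))"
  unfolding closed_dg_subring_def closed_graded_subgroup_iff rat_power_simps
  using closed_forms[OF assms subset_refl] one_forms[OF assms] forms_mult(1)[OF assms A.oneideal]
    forms_dl[OF assms subset_refl] by simp

lemma forms_mono:
  assumes S: "truncation_set S" and D: "D \<subseteq> carrier A"
  shows "forms S D q \<subseteq> forms S (carrier A) q"
proof (induction q)
  note H = closed_forms[OF S subset_refl]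
  note XD = subsetD[OF A.X0_mono[OF S D subset_refl]]
  case 0
  have "emb S ` X0 A S D \<subseteq> forms S (carrier A) 0"
    by (intro image_subsetI forms_gen_0 XD)
  then show ?case
    unfolding fun_cong[OF fun_cong[OF graded_forms.simps(1)], of S D]
    by (rule coefficient_group.closed_hull_least[OF coefficient_group_W H])
next
  note H = closed_forms[OF S subset_refl]
  note XD = subsetD[OF A.X0_mono[OF S D subset_refl]]
  case (Suc q)
  have 1: "times S (dl S (emb S a)) w \<in> forms S (carrier A) (Suc q)"
    if "a \<in> X0 A S (carrier A)" "w \<in> forms S D q" for a w
    by (intro forms_gen_1 that(1) subsetD[OF Suc that(2)])
  have 2: "times S (dl S (emb S x)) w \<in> forms S (carrier A) (Suc q)"
    if "x \<in> X0 A S D" "w \<in> forms S (carrier A) q" for x w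
    by (intro forms_gen_1 XD that)
  show ?case
    unfolding fun_cong[OF fun_cong[OF graded_forms.simps(2)], of q S D]
    by (intro coefficient_group.closed_hull_least[OF coefficient_group_W H] Un_least subsetI;
        elim CollectE exE conjE; simp only: 1 2)
qed

lemma closed_dg_ideal_forms:
  assumes S: "truncation_set S" and D: "ideal D A"
  shows "closed_dg_ideal B S (forms S (carrier A)) (forms S D)"
proof -
  have DA: "D \<subseteq> carrier A"
    by (rule ideal_subset_carrier[OF D])
  show ?thesis
    unfolding closed_dg_ideal_def closed_graded_subgroup_iff rat_power_simps
    using closed_forms[OF S DA] forms_mono[OF S DA] forms_mult[OF S D] forms_dl[OF S DA] by simp
qed

lemma forms_subset_closed_dg_subring:
  assumes Y: "closed_dg_subring B S Y" and gen: "emb S ` X0 A S (carrier A) \<subseteq> Y 0"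
  shows "forms S (carrier A) q \<subseteq> Y q"
proof (induction q)
  case 0
  have "closed_in_degree S 0 (Y 0)"
    using Y unfolding closed_dg_subring_def closed_graded_subgroup_iff by blast
  then show ?case
    unfolding graded_forms.simps
    by (rule coefficient_group.closed_hull_least[OF coefficient_group_W _ gen])
next
  case (Suc q)
  have H: "closed_in_degree S (Suc q) (Y (Suc q))"
    and mult: "\<And>x y p q. \<lbrakk>x \<in> Y p; y \<in> Y q\<rbrakk> \<Longrightarrow> times S x y \<in> Y (p + q)"
    and d: "\<And>x q. x \<in> Y q \<Longrightarrow> dl S x \<in> Y (Suc q)"
    using Y unfolding closed_dg_subring_def closed_graded_subgroup_iff rat_power_simps by blast+
  have "times S (dl S (emb S a)) w \<in> Y (Suc q)" if "a \<in> X0 A S (carrier A)" "w \<in> forms S (carrier A) q" for a w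
    using mult[OF d[OF subsetD[OF gen imageI[OF that(1)]]] subsetD[OF Suc that(2)]] by simp
  then show ?case
    unfolding graded_forms.simps
    by (intro coefficient_group.closed_hull_least[OF coefficient_group_W H] Un_least subsetI;
        elim CollectE exE conjE; simp only:)
qed

text \<open>The generators \<open>dl(a) \<omega>\<close> require that \<open>Y\<close> absorbs products from the left, the generators \<open>dl(x) \<eta>\<close> that it absorbs
them from the right.\<close>

lemma forms_subset_closed_dg_ideal:
  assumes S: "truncation_set S" and D: "D \<subseteq> carrier A"
    and Y: "closed_dg_ideal B S (forms S (carrier A)) Y" and gen: "emb S ` X0 A S D \<subseteq> Y 0"
  shows "forms S D q \<subseteq> Y q"
proof (induction q)
  case 0
  have "closed_in_degree S 0 (Y 0)"
    using Y unfolding closed_dg_ideal_def closed_graded_subgroup_iff by blast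
  then show ?case
    unfolding graded_forms.simps
    by (rule coefficient_group.closed_hull_least[OF coefficient_group_W _ gen])
next
  case (Suc q)
  have H: "closed_in_degree S (Suc q) (Y (Suc q))"
    and left: "\<And>x y p q. \<lbrakk>x \<in> forms S (carrier A) p; y \<in> Y q\<rbrakk> \<Longrightarrow> times S x y \<in> Y (p + q)"
    and right: "\<And>x y p q. \<lbrakk>x \<in> forms S (carrier A) p; y \<in> Y q\<rbrakk> \<Longrightarrow> times S y x \<in> Y (q + p)"
    and d: "\<And>x q. x \<in> Y q \<Longrightarrow> dl S x \<in> Y (Suc q)"
    using Y unfolding closed_dg_ideal_def closed_graded_subgroup_iff rat_power_simps by blast+
  have 1: "times S (dl S (emb S a)) w \<in> Y (Suc q)" if "a \<in> X0 A S (carrier A)" "w \<in> forms S D q" for a w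
    using left[OF dl_emb_forms[OF S subset_refl that(1)] subsetD[OF Suc that(2)]] by simp
  have 2: "times S (dl S (emb S x)) w \<in> Y (Suc q)" if "x \<in> X0 A S D" "w \<in> forms S (carrier A) q" for x w
    using right[OF that(2) d[OF subsetD[OF gen imageI[OF that(1)]]]] by simp
  show ?case
    unfolding graded_forms.simps
    by (intro coefficient_group.closed_hull_least[OF coefficient_group_W H] Un_least subsetI;
        elim CollectE exE conjE; simp only: 1 2)
qed

end

context de_Rham_setting
begin

interpretation Q: rational_dg_algebra A "de_Rham A0 A \<phi>" "form_const A0 A \<phi>"
  by (rule rational_dg_algebra.intro[OF dg_algebra_de_Rham])

lemma const_image_eq: "const_image A0 A \<phi> S H = Q.emb S ` H"
  by (simp add: const_image_def Q.emb_def[abs_def])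

lemma X_dg_eq:
  assumes "truncation_set S"
  shows "X_dg A0 A \<phi> S = (\<lambda>q. Q.forms S (carrier A) q)"
proof (intro ext antisym)
  fix q
  let ?P = "\<lambda>Y. closed_dg_subring (de_Rham A0 A \<phi>) S Y \<and> Q.emb S ` X0 A S (carrier A) \<subseteq> Y 0"
  have forms: "?P (\<lambda>q. Q.forms S (carrier A) q)"
    by (intro conjI Q.closed_dg_subring_forms[OF assms] image_subsetI Q.forms_gen_0)
  show "X_dg A0 A \<phi> S q \<subseteq> Q.forms S (carrier A) q"
    unfolding X_dg_def const_image_eq
    by (rule Inter_lower, rule CollectI, rule exI, rule conjI[OF refl forms])
  show "Q.forms S (carrier A) q \<subseteq> X_dg A0 A \<phi> S q"
    unfolding X_dg_def const_image_eq
  proof (rule Inter_greatest)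
    fix H assume "H \<in> {Y q | Y. ?P Y}"
    then obtain Y where "H = Y q" "?P Y" by (elim CollectE exE conjE) simp
    then show "Q.forms S (carrier A) q \<subseteq> H"
      by (simp only: Q.forms_subset_closed_dg_subring)
  qed
qed

lemma X_dg_ideal_eq:
  assumes S: "truncation_set S" and I: "ideal I A"
  shows "X_dg_ideal A0 A \<phi> I S q = Q.forms S I q"
proof (rule antisym)
  have IA: "I \<subseteq> carrier A"
    by (rule ideal_subset_carrier[OF I])
  let ?P = "\<lambda>Y. closed_dg_ideal (de_Rham A0 A \<phi>) S (\<lambda>q. Q.forms S (carrier A) q) Y \<and>
    Q.emb S ` X0 A S I \<subseteq> Y 0"
  have forms: "?P (\<lambda>q. Q.forms S I q)"
    by (intro conjI Q.closed_dg_ideal_forms[OF S I] image_subsetI Q.forms_gen_0)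
  show "X_dg_ideal A0 A \<phi> I S q \<subseteq> Q.forms S I q"
    unfolding X_dg_ideal_def const_image_eq X_dg_eq[OF S]
    by (rule Inter_lower, rule CollectI, rule exI, rule conjI[OF refl forms])
  show "Q.forms S I q \<subseteq> X_dg_ideal A0 A \<phi> I S q"
    unfolding X_dg_ideal_def const_image_eq X_dg_eq[OF S]
  proof (rule Inter_greatest)
    fix H assume "H \<in> {Y q | Y. ?P Y}"
    then obtain Y where "H = Y q" "?P Y" by (elim CollectE exE conjE) simp
    then show "Q.forms S I q \<subseteq> H"
      by (simp only: Q.forms_subset_closed_dg_ideal[OF S IA])
  qed
qed

lemma integral_power_eq:
  "integral_power (de_Rham A0 A \<phi>) S q = (\<Pi>\<^sub>E k\<in>S. Q.integral_part q)"
  by (simp add: integral_power_def Q.integral_part_def)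

theorem X_dg_inclusions:
  assumes S: "truncation_set S" and I: "ideal I A"
  shows "X_dg_ideal A0 A \<phi> I S q \<subseteq> X_dg A0 A \<phi> S q"
    and "X_dg A0 A \<phi> S q \<subseteq> integral_power (de_Rham A0 A \<phi>) S q"
    and "m \<in> S \<Longrightarrow> frobenius S m ` X_dg A0 A \<phi> S q \<subseteq> X_dg A0 A \<phi> (trunc_quot S m) q"
    and "m \<in> S \<Longrightarrow> frobenius S m ` X_dg_ideal A0 A \<phi> I S q \<subseteq> X_dg_ideal A0 A \<phi> I (trunc_quot S m) q"
    and "n \<in> S \<Longrightarrow> verschiebung (rationalization (de_Rham A0 A \<phi>)) S n ` X_dg A0 A \<phi> (trunc_quot S n) q
      \<subseteq> X_dg A0 A \<phi> S q"
    and "n \<in> S \<Longrightarrow> verschiebung (rationalization (de_Rham A0 A \<phi>)) S n `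
      X_dg_ideal A0 A \<phi> I (trunc_quot S n) q \<subseteq> X_dg_ideal A0 A \<phi> I S q"
proof -
  have IA: "I \<subseteq> carrier A"
    by (rule ideal_subset_carrier[OF I])
  show "X_dg_ideal A0 A \<phi> I S q \<subseteq> X_dg A0 A \<phi> S q"
    unfolding X_dg_eq[OF S] X_dg_ideal_eq[OF S I] by (rule Q.forms_mono[OF S IA])
  show "X_dg A0 A \<phi> S q \<subseteq> integral_power (de_Rham A0 A \<phi>) S q"
    unfolding X_dg_eq[OF S] integral_power_eq by (rule Q.forms_integral[OF S])
  assume "m \<in> S"
  note S' = truncation_set_quot[OF S this] and frobenius = Q.forms_frobenius[OF S _ this]
  show "frobenius S m ` X_dg A0 A \<phi> S q \<subseteq> X_dg A0 A \<phi> (trunc_quot S m) q"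
    unfolding X_dg_eq[OF S] X_dg_eq[OF S'] by (intro image_subsetI frobenius A.oneideal)
  show "frobenius S m ` X_dg_ideal A0 A \<phi> I S q \<subseteq> X_dg_ideal A0 A \<phi> I (trunc_quot S m) q"
    unfolding X_dg_ideal_eq[OF S I] X_dg_ideal_eq[OF S' I] by (intro image_subsetI frobenius I)
next
  have IA: "I \<subseteq> carrier A"
    by (rule ideal_subset_carrier[OF I])
  assume "n \<in> S"
  note S' = truncation_set_quot[OF S this] and verschiebung = Q.forms_verschiebung[OF S _ this]
  show "verschiebung Q.W S n ` X_dg A0 A \<phi> (trunc_quot S n) q \<subseteq> X_dg A0 A \<phi> S q"
    unfolding X_dg_eq[OF S] X_dg_eq[OF S'] by (intro image_subsetI verschiebung subset_refl)
  show "verschiebung Q.W S n ` X_dg_ideal A0 A \<phi> I (trunc_quot S n) q \<subseteq> X_dg_ideal A0 A \<phi> I S q"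
    unfolding X_dg_ideal_eq[OF S I] X_dg_ideal_eq[OF S' I] by (intro image_subsetI verschiebung IA)
qed

end

theorem theorem3p8:
  fixes S :: "nat set"
    and R0 :: "('r0, 'k) ring_scheme" and R :: "('r, 'l) ring_scheme"
    and \<rho> :: "'r0 \<Rightarrow> 'r"
    and A0 :: "('a0, 'm) ring_scheme" and A :: "('a, 'n) ring_scheme"
    and \<phi> :: "'a0 \<Rightarrow> 'a"
    and \<pi>0 :: "'a0 \<Rightarrow> 'r0" and \<pi> :: "'a \<Rightarrow> 'r"
    and I0 :: "'a0 set" and I :: "'a set"
  assumes "truncation_set S"
    and "algebra_presentation R0 R \<rho> A0 A \<phi> \<pi>0 \<pi> I0 I"
  shows
    "(\<forall>q. X_dg_ideal A0 A \<phi> I S q \<subseteq> X_dg A0 A \<phi> S q \<and>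
          X_dg A0 A \<phi> S q \<subseteq> integral_power (de_Rham A0 A \<phi>) S q) \<and>
     (\<forall>m\<in>S. \<forall>q.
        frobenius S m ` X_dg A0 A \<phi> S q \<subseteq> X_dg A0 A \<phi> (trunc_quot S m) q \<and>
        frobenius S m ` X_dg_ideal A0 A \<phi> I S q \<subseteq> X_dg_ideal A0 A \<phi> I (trunc_quot S m) q) \<and>
     (\<forall>n\<in>S. \<forall>q.
        verschiebung (rationalization (de_Rham A0 A \<phi>)) S n ` X_dg A0 A \<phi> (trunc_quot S n) q
          \<subseteq> X_dg A0 A \<phi> S q \<and>
        verschiebung (rationalization (de_Rham A0 A \<phi>)) S n ` X_dg_ideal A0 A \<phi> I (trunc_quot S n) q
          \<subseteq> X_dg_ideal A0 A \<phi> I S q)"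
proof -
  interpret P: algebra_presentation R0 R \<rho> A0 A \<phi> \<pi>0 \<pi> I0 I by fact
  interpret de_Rham_setting A0 A \<phi>
    by unfold_locales (rule ring_hom_closed[OF P.incl_hom])
  have "ideal I A"
    unfolding P.kernel
    by (intro ring_hom_ring.kernel_is_ideal ring_hom_ringI2 P.A.ring_axioms P.R.ring_axioms P.pi_hom)
  note inclusions = X_dg_inclusions[OF assms(1) this]
  show ?thesis
    by (intro conjI allI ballI inclusions)
qed

end
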